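(* Let $(\Omega,M)$ be a finite $0$-transitive transformation monoid and let $K$ be a field of characteristic $0$. Let $e\neq 0$ be an idempotent of the $0$-minimal ideal $I$ of $M$. Then the natural homomorphism $$\varphi\colon \mathrm{Ind}_e(K_0\Omega e)\to K_0\Omega$$ of $KM$-modules induced by the identity map on $K_0\Omega e$ is the projective cover of $K_0\Omega$. In particular, if $KM$ is semisimple, then $\mathrm{Ind}_e(K_0\Omega e)\cong K_0\Omega$.
   Context: A transformation monoid $(\Omega,M)$ is a non-empty set $\Omega$ with a submonoid $M$ of the monoid $T_\Omega$ of all self-maps of $\Omega$, acting on the right; it is finite if $\Omega$ is finite. It is $0$-transitive if $\Omega$ has a distinguished element $0$ with $0M=\{0\}$ and $\alpha M=\Omega$ for all $\alpha\in\Omega\setminus\{0\}$. In the finite $0$-transitive case $M$ contains the zero map $\Omega\to\{0\}$, which is the zero of $M$ and is also denoted $0$, and $M$ has a unique $0$-minimal ideal $I$, i.e., a unique two-sided ideal minimal among the non-zero ideals. For an idempotent $e\in M$, $G_e$ is the group of units of the monoid $eMe$ (with identity $e$), and $I_e=\{m\in M\mid e\notin MmM\}$, an ideal of $M$. $KM$ is the monoid algebra. For a right $KG_e$-module $V$, $\mathrm{Ind}_e(V)=V\otimes_{KG_e}e(KM/KI_e)$, a right $KM$-module (here $KI_e$ is the span of $I_e$, and $e(KM/KI_e)e\cong KG_e$). $K_0\Omega$ is the right $KM$-module obtained as the quotient of the permutation-like module $K\Omega$ (with basis $\Omega$ and $M$ acting by linear extension of its action on $\Omega$) by the submodule spanned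 by the element $0\in\Omega$; it has basis $\Omega\setminus\{0\}$, and the element $0\in\Omega$ is identified with the zero vector. Then $K_0\Omega e$ is the right $KG_e$-module with basis $\Omega e\setminus\{0\}$. The map $\varphi$ is given by $\varphi(v\otimes a)=va$. A projective cover of a finite-dimensional module $V$ over a finite-dimensional algebra is an epimorphism $\pi\colon P\to V$ with $P$ a projective module and $\ker\pi\subseteq\mathrm{rad}(P)$, where $\mathrm{rad}(P)$ is the intersection of all maximal submodules of $P$. *)

theory Defs
  imports "HOL-Algebra.Module" "HOL-Algebra.QuotRing" "HOL-Algebra.Free_Abelian_Groups"
begin

section \<open>Right modules over a not necessarily commutative ring\<close>

text \<open>As in \<^locale>\<open>module\<close>, the record extends \<^typ>\<open>'v ring\<close> in order to reuse the
  additive notions of the library; the multiplicative fields carry no meaning.\<close>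

record ('v, 'r) right_mod = "'v ring" +
  ract :: "'v \<Rightarrow> 'r \<Rightarrow> 'v" (infixl "\<triangleleft>\<index>" 75)

locale right_module = R?: ring R + V?: abelian_group V
  for R :: "('r, 'x) ring_scheme" (structure) and V :: "('v, 'r, 'y) right_mod_scheme" (structure) +
  assumes ract_closed: "\<lbrakk>v \<in> carrier V; a \<in> carrier R\<rbrakk> \<Longrightarrow> v \<triangleleft>\<^bsub>V\<^esub> a \<in> carrier V"
    and ract_add_left: "\<lbrakk>v \<in> carrier V; w \<in> carrier V; a \<in> carrier R\<rbrakk>
          \<Longrightarrow> (v \<oplus>\<^bsub>V\<^esub> w) \<triangleleft>\<^bsub>V\<^esub> a = (v \<triangleleft>\<^bsub>V\<^esub> a) \<oplus>\<^bsub>V\<^esub> (w \<triangleleft>\<^bsub>V\<^esub> a)"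
    and ract_add_right: "\<lbrakk>v \<in> carrier V; a \<in> carrier R; b \<in> carrier R\<rbrakk>
          \<Longrightarrow> v \<triangleleft>\<^bsub>V\<^esub> (a \<oplus>\<^bsub>R\<^esub> b) = (v \<triangleleft>\<^bsub>V\<^esub> a) \<oplus>\<^bsub>V\<^esub> (v \<triangleleft>\<^bsub>V\<^esub> b)"
    and ract_mult: "\<lbrakk>v \<in> carrier V; a \<in> carrier R; b \<in> carrier R\<rbrakk>
          \<Longrightarrow> v \<triangleleft>\<^bsub>V\<^esub> (a \<otimes>\<^bsub>R\<^esub> b) = (v \<triangleleft>\<^bsub>V\<^esub> a) \<triangleleft>\<^bsub>V\<^esub> b"
    and ract_one: "v \<in> carrier V \<Longrightarrow> v \<triangleleft>\<^bsub>V\<^esub> \<one>\<^bsub>R\<^esub> = v"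

definition right_module_hom ::
    "('r, 'x) ring_scheme \<Rightarrow> ('v, 'r, 'y) right_mod_scheme \<Rightarrow> ('w, 'r, 'u) right_mod_scheme \<Rightarrow> ('v \<Rightarrow> 'w) set"
  where "right_module_hom R V W =
    {f \<in> carrier V \<rightarrow> carrier W.
       (\<forall>v\<in>carrier V. \<forall>w\<in>carrier V. f (v \<oplus>\<^bsub>V\<^esub> w) = f v \<oplus>\<^bsub>W\<^esub> f w) \<and>
       (\<forall>v\<in>carrier V. \<forall>a\<in>carrier R. f (v \<triangleleft>\<^bsub>V\<^esub> a) = f v \<triangleleft>\<^bsub>W\<^esub> a)}"

definition right_module_iso ::
    "('r, 'x) ring_scheme \<Rightarrow> ('v, 'r, 'y) right_mod_scheme \<Rightarrow> ('w, 'r, 'u) right_mod_scheme \<Rightarrow> bool"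
  where "right_module_iso R V W \<longleftrightarrow>
    (\<exists>f \<in> right_module_hom R V W. bij_betw f (carrier V) (carrier W))"

definition right_submodule ::
    "('r, 'x) ring_scheme \<Rightarrow> 'v set \<Rightarrow> ('v, 'r, 'y) right_mod_scheme \<Rightarrow> bool"
  where "right_submodule R N V \<longleftrightarrow>
    additive_subgroup N V \<and> (\<forall>v\<in>N. \<forall>a\<in>carrier R. v \<triangleleft>\<^bsub>V\<^esub> a \<in> N)"

definition quotient_module ::
    "('v, 'r, 'y) right_mod_scheme \<Rightarrow> 'v set \<Rightarrow> ('v set, 'r) right_mod"
  where "quotient_module V N =
    \<lparr>carrier = a_rcosets\<^bsub>V\<^esub> N, monoid.mult = undefined, one = undefined,
     ring.zero = N, add = set_add V,
     ract = (\<lambda>Y a. \<Union>v\<in>Y. N +>\<^bsub>V\<^esub> (v \<triangleleft>\<^bsub>V\<^esub> a))\<rparr>"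

definition regular_module :: "('r, 'x) ring_scheme \<Rightarrow> ('r, 'r) right_mod"
  where "regular_module R =
    \<lparr>carrier = carrier R, monoid.mult = undefined, one = undefined,
     ring.zero = \<zero>\<^bsub>R\<^esub>, add = add R, ract = monoid.mult R\<rparr>"

definition simple_submodule ::
    "('r, 'x) ring_scheme \<Rightarrow> 'v set \<Rightarrow> ('v, 'r, 'y) right_mod_scheme \<Rightarrow> bool"
  where "simple_submodule R S V \<longleftrightarrow>
    right_submodule R S V \<and> S \<noteq> {\<zero>\<^bsub>V\<^esub>} \<and>
    (\<forall>N. right_submodule R N V \<and> N \<subseteq> S \<longrightarrow> N = {\<zero>\<^bsub>V\<^esub>} \<or> N = S)"

text \<open>A module is semisimple if it is the internal direct sum of a family of simple submodules;
  the sum of a family of submodules is the additive subgroup generated by their union.\<close>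

definition semisimple_module ::
    "('r, 'x) ring_scheme \<Rightarrow> ('v, 'r, 'y) right_mod_scheme \<Rightarrow> bool"
  where "semisimple_module R V \<longleftrightarrow>
    (\<exists>\<S>. (\<forall>S\<in>\<S>. simple_submodule R S V) \<and>
          generate (add_monoid V) (\<Union>\<S>) = carrier V \<and>
          (\<forall>S\<in>\<S>. S \<inter> generate (add_monoid V) (\<Union>(\<S> - {S})) = {\<zero>\<^bsub>V\<^esub>}))"

definition semisimple_ring :: "('r, 'x) ring_scheme \<Rightarrow> bool"
  where "semisimple_ring R \<longleftrightarrow> semisimple_module R (regular_module R)"

definition maximal_submodule ::
    "('r, 'x) ring_scheme \<Rightarrow> 'v set \<Rightarrow> ('v, 'r, 'y) right_mod_scheme \<Rightarrow> bool"
  where "maximal_submodule R N V \<longleftrightarrow>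
    right_submodule R N V \<and> N \<noteq> carrier V \<and>
    (\<forall>L. right_submodule R L V \<and> N \<subseteq> L \<longrightarrow> L = N \<or> L = carrier V)"

definition module_radical :: "('r, 'x) ring_scheme \<Rightarrow> ('v, 'r, 'y) right_mod_scheme \<Rightarrow> 'v set"
  where "module_radical R V = carrier V \<inter> \<Inter>{N. maximal_submodule R N V}"

text \<open>Projectivity is the lifting property against every epimorphism \<open>g : A \<rightarrow> B\<close>.
  A definition cannot quantify over the element types \<open>'a\<close> and \<open>'b\<close> of \<open>A\<close> and \<open>B\<close>, so they are
  parameters; a theorem that leaves them as free type variables asserts the lifting property for
  all modules \<open>A\<close> and \<open>B\<close>.\<close>

definition projective_module ::
    "'a itself \<Rightarrow> 'b itself \<Rightarrow> ('r, 'x) ring_scheme \<Rightarrow> ('p, 'r, 'y) right_mod_scheme \<Rightarrow> bool"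
  where "projective_module _ _ R P \<longleftrightarrow>
    right_module R P \<and>
    (\<forall>(A :: ('a, 'r) right_mod) (B :: ('b, 'r) right_mod) g f.
       right_module R A \<and> right_module R B \<and>
       g \<in> right_module_hom R A B \<and> g ` carrier A = carrier B \<and>
       f \<in> right_module_hom R P B \<longrightarrow>
       (\<exists>h \<in> right_module_hom R P A. \<forall>p\<in>carrier P. g (h p) = f p))"

definition projective_cover ::
    "'a itself \<Rightarrow> 'b itself \<Rightarrow> ('r, 'x) ring_scheme \<Rightarrow> ('p, 'r, 'y) right_mod_scheme \<Rightarrow>
     ('v, 'r, 'u) right_mod_scheme \<Rightarrow> ('p \<Rightarrow> 'v) \<Rightarrow> bool"
  where "projective_cover ta tb R P V \<pi> \<longleftrightarrow>
    right_module R V \<and> projective_module ta tb R P \<and>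
    \<pi> \<in> right_module_hom R P V \<and> \<pi> ` carrier P = carrier V \<and>
    a_kernel P V \<pi> \<subseteq> module_radical R P"


section \<open>Tensor products\<close>

text \<open>An \<open>S\<close>-\<open>R\<close>-bimodule has a right action of \<open>R\<close> (\<open>'r\<close>) and a left action of \<open>S\<close> (\<open>'s\<close>).\<close>

record ('l, 'r, 's) bimod = "('l, 'r) right_mod" +
  lact :: "'s \<Rightarrow> 'l \<Rightarrow> 'l" (infixr "\<triangleright>\<index>" 76)

definition tensor_relators ::
    "('s, 'x) ring_scheme \<Rightarrow> ('v, 's, 'y) right_mod_scheme \<Rightarrow> ('l, 'r, 's, 'u) bimod_scheme \<Rightarrow>
     ('v \<times> 'l \<Rightarrow>\<^sub>0 int) set"
  where "tensor_relators S V L =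
    {frag_of (v \<oplus>\<^bsub>V\<^esub> w, l) - frag_of (v, l) - frag_of (w, l) |v w l.
       v \<in> carrier V \<and> w \<in> carrier V \<and> l \<in> carrier L} \<union>
    {frag_of (v, k \<oplus>\<^bsub>L\<^esub> l) - frag_of (v, k) - frag_of (v, l) |v k l.
       v \<in> carrier V \<and> k \<in> carrier L \<and> l \<in> carrier L} \<union>
    {frag_of (v \<triangleleft>\<^bsub>V\<^esub> s, l) - frag_of (v, s \<triangleright>\<^bsub>L\<^esub> l) |v s l.
       v \<in> carrier V \<and> s \<in> carrier S \<and> l \<in> carrier L}"

definition tensor_free ::
    "('v, 's, 'y) right_mod_scheme \<Rightarrow> ('l, 'r, 's, 'u) bimod_scheme \<Rightarrow> ('v \<times> 'l \<Rightarrow>\<^sub>0 int) monoid"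
  where "tensor_free V L = free_Abelian_group (carrier V \<times> carrier L)"

definition tensor_kernel ::
    "('s, 'x) ring_scheme \<Rightarrow> ('v, 's, 'y) right_mod_scheme \<Rightarrow> ('l, 'r, 's, 'u) bimod_scheme \<Rightarrow>
     ('v \<times> 'l \<Rightarrow>\<^sub>0 int) set"
  where "tensor_kernel S V L = generate (tensor_free V L) (tensor_relators S V L)"

definition tensor ::
    "('s, 'x) ring_scheme \<Rightarrow> ('v, 's, 'y) right_mod_scheme \<Rightarrow> ('l, 'r, 's, 'u) bimod_scheme \<Rightarrow>
     'v \<Rightarrow> 'l \<Rightarrow> ('v \<times> 'l \<Rightarrow>\<^sub>0 int) set"
  where "tensor S V L v l = tensor_kernel S V L #>\<^bsub>tensor_free V L\<^esub> frag_of (v, l)"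

text \<open>The action of \<open>R\<close> is induced by \<open>(v \<otimes> l) r = v \<otimes> (l r)\<close>.\<close>

definition tensor_product ::
    "('s, 'x) ring_scheme \<Rightarrow> ('v, 's, 'y) right_mod_scheme \<Rightarrow> ('l, 'r, 's, 'u) bimod_scheme \<Rightarrow>
     (('v \<times> 'l \<Rightarrow>\<^sub>0 int) set, 'r) right_mod"
  where "tensor_product S V L =
    (let F = tensor_free V L; N = tensor_kernel S V L in
     \<lparr>carrier = carrier (F Mod N), monoid.mult = undefined, one = undefined,
      ring.zero = \<one>\<^bsub>F Mod N\<^esub>, add = monoid.mult (F Mod N),
      ract = (\<lambda>Y r. \<Union>c\<in>Y. N #>\<^bsub>F\<^esub> frag_extend (\<lambda>(v, l). frag_of (v, l \<triangleleft>\<^bsub>L\<^esub> r)) c)\<rparr>)"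

text \<open>The map on a tensor product induced by a balanced biadditive map \<open>f\<close> into \<open>W\<close>: the class of
  \<open>\<Sum> n (v, l)\<close> goes to \<open>\<Sum> n f(v, l)\<close>, which does not depend on the representative.\<close>

definition tensor_lift ::
    "('w, 'y) ring_scheme \<Rightarrow> ('v \<Rightarrow> 'l \<Rightarrow> 'w) \<Rightarrow> ('v \<times> 'l \<Rightarrow>\<^sub>0 int) set \<Rightarrow> 'w"
  where "tensor_lift W f Y =
    (THE w. \<forall>c\<in>Y. w =
       (\<Oplus>\<^bsub>W\<^esub>p\<in>Poly_Mapping.keys c. [Poly_Mapping.lookup c p] \<cdot>\<^bsub>W\<^esub> (case p of (v, l) \<Rightarrow> f v l)))"


section \<open>Monoids and monoid algebras\<close>

definition local_monoid :: "('g, 'x) monoid_scheme \<Rightarrow> 'g \<Rightarrow> 'g monoid"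
  where "local_monoid G e =
    \<lparr>carrier = {e \<otimes>\<^bsub>G\<^esub> m \<otimes>\<^bsub>G\<^esub> e |m. m \<in> carrier G}, monoid.mult = monoid.mult G, one = e\<rparr>"

definition maximal_subgroup :: "('g, 'x) monoid_scheme \<Rightarrow> 'g \<Rightarrow> 'g monoid"
  where "maximal_subgroup G e = units_of (local_monoid G e)"

definition ideal_avoiding :: "('g, 'x) monoid_scheme \<Rightarrow> 'g \<Rightarrow> 'g set"
  where "ideal_avoiding G e =
    {m \<in> carrier G. e \<notin> {a \<otimes>\<^bsub>G\<^esub> m \<otimes>\<^bsub>G\<^esub> b |a b. a \<in> carrier G \<and> b \<in> carrier G}}"

definition monoid_ideal :: "('g, 'x) monoid_scheme \<Rightarrow> 'g set \<Rightarrow> bool"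
  where "monoid_ideal G J \<longleftrightarrow>
    J \<noteq> {} \<and> J \<subseteq> carrier G \<and>
    (\<forall>x\<in>J. \<forall>m\<in>carrier G. m \<otimes>\<^bsub>G\<^esub> x \<in> J \<and> x \<otimes>\<^bsub>G\<^esub> m \<in> J)"

text \<open>Here \<open>\<theta>\<close> is the zero of the monoid.\<close>

definition zero_minimal_ideal :: "('g, 'x) monoid_scheme \<Rightarrow> 'g \<Rightarrow> 'g set \<Rightarrow> bool"
  where "zero_minimal_ideal G \<theta> I \<longleftrightarrow>
    monoid_ideal G I \<and> I \<noteq> {\<theta>} \<and>
    (\<forall>J. monoid_ideal G J \<and> J \<noteq> {\<theta>} \<and> J \<subseteq> I \<longrightarrow> J = I)"

text \<open>\<open>lin_span A\<close> is the vector space of formal \<open>'k\<close>-linear combinations of elements of \<open>A\<close>;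
  \<^term>\<open>Poly_Mapping.single x 1\<close> is the basis vector of \<open>x\<close>.\<close>

definition lin_span :: "'x set \<Rightarrow> ('x \<Rightarrow>\<^sub>0 'k::zero) set"
  where "lin_span A = {f. Poly_Mapping.keys f \<subseteq> A}"

definition monoid_algebra :: "('g, 'x) monoid_scheme \<Rightarrow> ('g \<Rightarrow>\<^sub>0 'k::field) ring"
  where "monoid_algebra G =
    \<lparr>carrier = lin_span (carrier G),
     monoid.mult = (\<lambda>f g. \<Sum>m\<in>Poly_Mapping.keys f. \<Sum>n\<in>Poly_Mapping.keys g.
       Poly_Mapping.single (m \<otimes>\<^bsub>G\<^esub> n) (Poly_Mapping.lookup f m * Poly_Mapping.lookup g n)),
     one = Poly_Mapping.single \<one>\<^bsub>G\<^esub> 1, ring.zero = 0, add = (+)\<rparr>"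


section \<open>Induced modules\<close>

text \<open>The \<open>KG\<^sub>e\<close>-\<open>KM\<close>-bimodule \<open>e(KM/KI\<^sub>e)\<close>. The algebra of the maximal subgroup at \<open>e\<close> is literally a
  subset of the algebra of the monoid; it acts on the left through its image in the quotient.\<close>

definition induction_bimodule ::
    "('g, 'x) monoid_scheme \<Rightarrow> 'g \<Rightarrow> (('g \<Rightarrow>\<^sub>0 'k::field) set, 'g \<Rightarrow>\<^sub>0 'k, 'g \<Rightarrow>\<^sub>0 'k) bimod"
  where "induction_bimodule G e =
    (let A = monoid_algebra G; J = lin_span (ideal_avoiding G e); Q = A Quot J in
     \<lparr>carrier = {(J +>\<^bsub>A\<^esub> Poly_Mapping.single e 1) \<otimes>\<^bsub>Q\<^esub> x |x. x \<in> carrier Q},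
      monoid.mult = undefined, one = undefined, ring.zero = \<zero>\<^bsub>Q\<^esub>, add = add Q,
      ract = (\<lambda>x a. x \<otimes>\<^bsub>Q\<^esub> (J +>\<^bsub>A\<^esub> a)),
      lact = (\<lambda>s x. (J +>\<^bsub>A\<^esub> s) \<otimes>\<^bsub>Q\<^esub> x)\<rparr>)"

definition induced_module ::
    "('g, 'x) monoid_scheme \<Rightarrow> 'g \<Rightarrow> ('v, 'g \<Rightarrow>\<^sub>0 'k::field, 'y) right_mod_scheme \<Rightarrow>
     (('v \<times> ('g \<Rightarrow>\<^sub>0 'k) set \<Rightarrow>\<^sub>0 int) set, 'g \<Rightarrow>\<^sub>0 'k) right_mod"
  where "induced_module G e V =
    tensor_product (monoid_algebra (maximal_subgroup G e)) V (induction_bimodule G e)"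

text \<open>For a right module \<open>V\<close> over the monoid algebra, \<open>Ve\<close> with the action of \<open>KG\<^sub>e\<close> obtained by
  restricting the action on \<open>V\<close>.\<close>

definition corner_module ::
    "('v, 'g \<Rightarrow>\<^sub>0 'k::field) right_mod \<Rightarrow> 'g \<Rightarrow> ('v, 'g \<Rightarrow>\<^sub>0 'k) right_mod"
  where "corner_module V e =
    V\<lparr>carrier := {v \<triangleleft>\<^bsub>V\<^esub> Poly_Mapping.single e 1 |v. v \<in> carrier V}\<rparr>"

text \<open>The natural map \<open>Ind\<^sub>e(Ve) \<rightarrow> V\<close>, \<open>v \<otimes> a \<mapsto> va\<close>. An element \<open>a\<close> of \<open>e(KM/KI\<^sub>e)\<close> is a coset, and
  \<open>va\<close> is the common value of \<open>v x\<close> for \<open>x \<in> a\<close>.\<close>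

definition induced_natural_map ::
    "('v, 'g \<Rightarrow>\<^sub>0 'k::field) right_mod \<Rightarrow> ('v \<times> ('g \<Rightarrow>\<^sub>0 'k) set \<Rightarrow>\<^sub>0 int) set \<Rightarrow> 'v"
  where "induced_natural_map V = tensor_lift V (\<lambda>v a. THE w. \<forall>x\<in>a. w = v \<triangleleft>\<^bsub>V\<^esub> x)"


section \<open>Transformation monoids\<close>

text \<open>Maps act on the right, so the product \<open>m n\<close> is \<open>m\<close> followed by \<open>n\<close>. The underlying set
  \<open>\<Omega>\<close> is the whole type \<open>'w\<close>.\<close>

definition full_transformation_monoid :: "('w \<Rightarrow> 'w) monoid"
  where "full_transformation_monoid = \<lparr>carrier = UNIV, monoid.mult = (\<lambda>m n. n \<circ> m), one = id\<rparr>"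

definition transformation_monoid :: "('w \<Rightarrow> 'w) set \<Rightarrow> ('w \<Rightarrow> 'w) monoid"
  where "transformation_monoid M = full_transformation_monoid\<lparr>carrier := M\<rparr>"

definition zero_transitive :: "('w \<Rightarrow> 'w) set \<Rightarrow> 'w \<Rightarrow> bool"
  where "zero_transitive M z \<longleftrightarrow>
    {m z |m. m \<in> M} = {z} \<and> (\<forall>\<alpha>. \<alpha> \<noteq> z \<longrightarrow> {m \<alpha> |m. m \<in> M} = UNIV)"

definition transformation_module :: "('w \<Rightarrow>\<^sub>0 'k::field, ('w \<Rightarrow> 'w) \<Rightarrow>\<^sub>0 'k) right_mod"
  where "transformation_module =
    \<lparr>carrier = UNIV, monoid.mult = undefined, one = undefined, ring.zero = 0, add = (+),
     ract = (\<lambda>v f. \<Sum>\<alpha>\<in>Poly_Mapping.keys v. \<Sum>m\<in>Poly_Mapping.keys f.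
       Poly_Mapping.single (m \<alpha>) (Poly_Mapping.lookup v \<alpha> * Poly_Mapping.lookup f m))\<rparr>"

text \<open>\<open>K\<^sub>0\<Omega>\<close>, where \<open>z\<close> is the distinguished element \<open>0\<close> of \<open>\<Omega>\<close>.\<close>

definition contracted_module ::
    "'w \<Rightarrow> (('w \<Rightarrow>\<^sub>0 'k::field) set, ('w \<Rightarrow> 'w) \<Rightarrow>\<^sub>0 'k) right_mod"
  where "contracted_module z = quotient_module transformation_module (lin_span {z})"

end

theory Submission
  imports Defs
begin

text \<open>Write \<open>A\<close> for the monoid algebra \<open>KM\<close>, \<open>H\<close> for the maximal subgroup \<open>G\<^sub>e\<close>, \<open>J\<close> for the span
  \<open>KI\<^sub>e\<close>, \<open>V\<close> for \<open>K\<^sub>0\<Omega>\<close> and \<open>P\<close> for \<open>Ind\<^sub>e(Ve)\<close>. Four observations prove the theorem.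

  Existence and surjectivity of \<open>\<phi>\<close>: since \<open>e\<close> lies in the \<open>0\<close>-minimal ideal, \<open>em\<close> is the zero map
  for every \<open>m \<in> I\<^sub>e\<close> (\<open>zero_minimal_ideal_kills_avoiding\<close>). The zero map annihilates \<open>V\<close>, hence so
  does \<open>eJ\<close>, and \<open>va\<close> is well defined for \<open>v \<in> Ve\<close> and a coset \<open>a\<close> modulo \<open>J\<close>. One non-zero point of
  \<open>\<Omega>e\<close> is carried by \<open>M\<close> to every point of \<open>\<Omega>\<close>, so \<open>Ve\<close> generates \<open>V\<close> and \<open>\<phi>\<close> is onto.

  The kernel \<open>N\<close> of \<open>\<phi>\<close> satisfies \<open>Ne = 0\<close>: for \<open>m \<in> M\<close> the element \<open>eme\<close> is either a unit of \<open>eMe\<close> or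
  lies in \<open>I\<^sub>e\<close>, because \<open>eMe\<close> is a finite monoid. Hence \<open>e(A/J)e\<close> is the image of \<open>KH\<close>, and every
  element of \<open>Pe\<close> has the form \<open>w \<otimes> e\<close> with \<open>w \<in> Ve\<close> (\<open>P_corner\<close>). The map \<open>\<phi>\<close> sends it to \<open>w\<close>, so \<open>\<phi>\<close>
  is injective on \<open>Pe\<close>. As \<open>Pe\<close> generates \<open>P\<close>, a submodule \<open>N\<close> with \<open>Ne = 0\<close> is contained in every
  maximal submodule: if \<open>N + Q = P\<close>, then \<open>Pe = Qe \<subseteq> Q\<close>, and so \<open>Q = P\<close>
  (\<open>killed_submodule_subset_radical\<close>).

  \<open>P\<close> is projective: a homomorphism from \<open>P\<close> to an \<open>A\<close>-module \<open>X\<close> is the same as a \<open>KH\<close>-homomorphism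
  \<open>h : Ve \<rightarrow> Xe\<close> whose values are killed by \<open>J\<close>. A \<open>K\<close>-linear lift \<open>Ve \<rightarrow> Xe\<close> exists because \<open>V\<close> has a
  basis, averaging over \<open>H\<close> as in Maschke's theorem makes it \<open>KH\<close>-linear
  (\<open>group_algebra_linear_lift_averaging\<close>), and multiplying its values by \<open>1 - \<theta>\<close>, where \<open>\<theta>\<close> is the
  zero map, makes them killed by \<open>J\<close> (\<open>induced_lift_through_hom\<close>).

  If \<open>A\<close> is semisimple, then a submodule \<open>N\<close> with \<open>Ne = 0\<close> vanishes: the annihilator of \<open>N\<close> is a
  two-sided ideal \<open>T\<close> that contains \<open>e\<close>, and it has an element \<open>f\<close> with \<open>tf = t\<close> for all \<open>t \<in> T\<close>. The
  vectors fixed by \<open>f\<close> form a submodule containing \<open>Pe\<close>, so they are all of \<open>P\<close>, whereas \<open>Nf = 0\<close>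
  (\<open>killed_submodule_trivial_if_semisimple\<close>). Therefore \<open>\<phi>\<close> is an isomorphism.\<close>

section \<open>Right modules\<close>

lemma right_moduleI:
  assumes "ring R" "abelian_group V"
    and "\<And>v a. \<lbrakk>v \<in> carrier V; a \<in> carrier R\<rbrakk> \<Longrightarrow> v \<triangleleft>\<^bsub>V\<^esub> a \<in> carrier V"
    and "\<And>v w a. \<lbrakk>v \<in> carrier V; w \<in> carrier V; a \<in> carrier R\<rbrakk>
          \<Longrightarrow> (v \<oplus>\<^bsub>V\<^esub> w) \<triangleleft>\<^bsub>V\<^esub> a = (v \<triangleleft>\<^bsub>V\<^esub> a) \<oplus>\<^bsub>V\<^esub> (w \<triangleleft>\<^bsub>V\<^esub> a)"
    and "\<And>v a b. \<lbrakk>v \<in> carrier V; a \<in> carrier R; b \<in> carrier R\<rbrakk>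
          \<Longrightarrow> v \<triangleleft>\<^bsub>V\<^esub> (a \<oplus>\<^bsub>R\<^esub> b) = (v \<triangleleft>\<^bsub>V\<^esub> a) \<oplus>\<^bsub>V\<^esub> (v \<triangleleft>\<^bsub>V\<^esub> b)"
    and "\<And>v a b. \<lbrakk>v \<in> carrier V; a \<in> carrier R; b \<in> carrier R\<rbrakk>
          \<Longrightarrow> v \<triangleleft>\<^bsub>V\<^esub> (a \<otimes>\<^bsub>R\<^esub> b) = (v \<triangleleft>\<^bsub>V\<^esub> a) \<triangleleft>\<^bsub>V\<^esub> b"
    and "\<And>v. v \<in> carrier V \<Longrightarrow> v \<triangleleft>\<^bsub>V\<^esub> \<one>\<^bsub>R\<^esub> = v"
  shows "right_module R V"
  unfolding right_module_def right_module_axioms_def using assms by blast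

context right_module
begin

lemma zero_ract [simp]: "a \<in> carrier R \<Longrightarrow> \<zero>\<^bsub>V\<^esub> \<triangleleft>\<^bsub>V\<^esub> a = \<zero>\<^bsub>V\<^esub>"
  by (metis V.add.l_cancel_one' V.zero_closed V.l_zero ract_add_left ract_closed)

lemma ract_zero [simp]: "v \<in> carrier V \<Longrightarrow> v \<triangleleft>\<^bsub>V\<^esub> \<zero>\<^bsub>R\<^esub> = \<zero>\<^bsub>V\<^esub>"
  by (metis V.add.l_cancel_one' R.zero_closed R.l_zero ract_add_right ract_closed)

lemma ract_neg: "\<lbrakk>v \<in> carrier V; a \<in> carrier R\<rbrakk> \<Longrightarrow> v \<triangleleft>\<^bsub>V\<^esub> (\<ominus>\<^bsub>R\<^esub> a) = \<ominus>\<^bsub>V\<^esub> (v \<triangleleft>\<^bsub>V\<^esub> a)"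
  by (metis V.minus_equality R.a_inv_closed R.l_neg ract_add_right ract_closed ract_zero)

lemma neg_ract: "\<lbrakk>v \<in> carrier V; a \<in> carrier R\<rbrakk> \<Longrightarrow> (\<ominus>\<^bsub>V\<^esub> v) \<triangleleft>\<^bsub>V\<^esub> a = \<ominus>\<^bsub>V\<^esub> (v \<triangleleft>\<^bsub>V\<^esub> a)"
  using ract_add_left[of "\<ominus>\<^bsub>V\<^esub> v" v a]
  by (intro V.minus_equality[symmetric]) (auto simp: V.l_neg ract_closed)

lemma ract_neg_one: "v \<in> carrier V \<Longrightarrow> v \<triangleleft>\<^bsub>V\<^esub> (\<ominus>\<^bsub>R\<^esub> \<one>\<^bsub>R\<^esub>) = \<ominus>\<^bsub>V\<^esub> v"
  by (simp add: ract_neg ract_one)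

lemma finsum_ract:
  assumes "f \<in> A \<rightarrow> carrier V" "a \<in> carrier R"
  shows "finsum V f A \<triangleleft>\<^bsub>V\<^esub> a = finsum V (\<lambda>i. f i \<triangleleft>\<^bsub>V\<^esub> a) A"
  using assms(1)
proof (induction A rule: infinite_finite_induct)
  case (insert x F)
  then show ?case
    using assms(2) by (simp add: ract_add_left ract_closed Pi_iff)
qed (use assms(2) in auto)

text \<open>Negatives come for free from the action of \<open>-1\<close>.\<close>

lemma right_submoduleI:
  assumes "N \<subseteq> carrier V" "\<zero>\<^bsub>V\<^esub> \<in> N"
    and "\<And>v w. \<lbrakk>v \<in> N; w \<in> N\<rbrakk> \<Longrightarrow> v \<oplus>\<^bsub>V\<^esub> w \<in> N"
    and act: "\<And>v a. \<lbrakk>v \<in> N; a \<in> carrier R\<rbrakk> \<Longrightarrow> v \<triangleleft>\<^bsub>V\<^esub> a \<in> N"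
  shows "right_submodule R N V"
proof -
  have "\<ominus>\<^bsub>V\<^esub> v \<in> N" if "v \<in> N" for v
    using act[OF that, of "\<ominus>\<^bsub>R\<^esub> \<one>\<^bsub>R\<^esub>"] ract_neg_one[of v] assms(1) that by auto
  then have "subgroup N (add_monoid V)"
    using assms by (intro V.add.subgroupI) (auto simp: V.add.subgroupI)
  then show ?thesis
    using act by (simp add: right_submodule_def additive_subgroup_def)
qed

lemma right_submoduleD:
  assumes "right_submodule R N V"
  shows "N \<subseteq> carrier V" "\<zero>\<^bsub>V\<^esub> \<in> N"
    and "\<And>v w. \<lbrakk>v \<in> N; w \<in> N\<rbrakk> \<Longrightarrow> v \<oplus>\<^bsub>V\<^esub> w \<in> N"
    and "\<And>v. v \<in> N \<Longrightarrow> \<ominus>\<^bsub>V\<^esub> v \<in> N"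
    and "\<And>v a. \<lbrakk>v \<in> N; a \<in> carrier R\<rbrakk> \<Longrightarrow> v \<triangleleft>\<^bsub>V\<^esub> a \<in> N"
proof -
  interpret N: additive_subgroup N V
    using assms by (simp add: right_submodule_def)
  show "N \<subseteq> carrier V" "\<zero>\<^bsub>V\<^esub> \<in> N"
    using N.a_subset by auto
  show "\<And>v w. \<lbrakk>v \<in> N; w \<in> N\<rbrakk> \<Longrightarrow> v \<oplus>\<^bsub>V\<^esub> w \<in> N"
    by simp
  show "\<And>v. v \<in> N \<Longrightarrow> \<ominus>\<^bsub>V\<^esub> v \<in> N"
    using N.a_subgroup subgroup.m_inv_closed[of N "add_monoid V"] by (simp add: a_inv_def)
  show "\<And>v a. \<lbrakk>v \<in> N; a \<in> carrier R\<rbrakk> \<Longrightarrow> v \<triangleleft>\<^bsub>V\<^esub> a \<in> N"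
    using assms by (simp add: right_submodule_def)
qed

lemma right_submodule_sum:
  assumes N: "right_submodule R N V" and L: "right_submodule R L V"
  shows "right_submodule R (N <+>\<^bsub>V\<^esub> L) V" "N \<subseteq> N <+>\<^bsub>V\<^esub> L" "L \<subseteq> N <+>\<^bsub>V\<^esub> L"
proof -
  note n = right_submoduleD[OF N] and l = right_submoduleD[OF L]
  note nc = subsetD[OF n(1)] and lc = subsetD[OF l(1)]
  show "right_submodule R (N <+>\<^bsub>V\<^esub> L) V"
  proof (rule right_submoduleI)
    show "N <+>\<^bsub>V\<^esub> L \<subseteq> carrier V"
      using nc lc by (auto simp: set_add_def')
    show "\<zero>\<^bsub>V\<^esub> \<in> N <+>\<^bsub>V\<^esub> L"
      using n(2) l(2) by (force simp: set_add_def')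
  next
    fix v w
    assume "v \<in> N <+>\<^bsub>V\<^esub> L" "w \<in> N <+>\<^bsub>V\<^esub> L"
    then obtain a b c d where "a \<in> N" "b \<in> L" "c \<in> N" "d \<in> L" and
      eq: "v = a \<oplus>\<^bsub>V\<^esub> b" "w = c \<oplus>\<^bsub>V\<^esub> d"
      by (auto simp: set_add_def')
    moreover from this have "v \<oplus>\<^bsub>V\<^esub> w = (a \<oplus>\<^bsub>V\<^esub> c) \<oplus>\<^bsub>V\<^esub> (b \<oplus>\<^bsub>V\<^esub> d)"
      by (simp add: V.a_ac nc lc)
    ultimately show "v \<oplus>\<^bsub>V\<^esub> w \<in> N <+>\<^bsub>V\<^esub> L"
      using n(3)[of a c] l(3)[of b d] unfolding set_add_def' by blast
  next
    fix v a
    assume "v \<in> N <+>\<^bsub>V\<^esub> L" "a \<in> carrier R"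
    then show "v \<triangleleft>\<^bsub>V\<^esub> a \<in> N <+>\<^bsub>V\<^esub> L"
      using n(5) l(5) nc lc by (force simp: set_add_def' ract_add_left)
  qed
  show "N \<subseteq> N <+>\<^bsub>V\<^esub> L"
  proof
    fix v assume "v \<in> N"
    then show "v \<in> N <+>\<^bsub>V\<^esub> L"
      using l(2) V.r_zero[of v] nc[of v] unfolding set_add_def' by (metis UN_I insertI1)
  qed
  show "L \<subseteq> N <+>\<^bsub>V\<^esub> L"
  proof
    fix v assume "v \<in> L"
    then show "v \<in> N <+>\<^bsub>V\<^esub> L"
      using n(2) V.l_zero[of v] lc[of v] unfolding set_add_def' by (metis UN_I insertI1)
  qed
qed

lemma right_submodule_Int:
  assumes "right_submodule R N V" "right_submodule R L V"
  shows "right_submodule R (N \<inter> L) V"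
  using right_submoduleD[OF assms(1)] right_submoduleD[OF assms(2)]
  by (intro right_submoduleI) auto

section \<open>Submodules killed by a generating element\<close>

text \<open>If \<open>N\<close> were not inside the maximal submodule \<open>Q\<close>, then \<open>N + Q\<close> would be the whole module \<open>V\<close>, and
  \<open>Ve = Ne + Qe = Qe \<subseteq> Q\<close> would force \<open>Q = V\<close>. That \<open>Ve\<close> generates \<open>V\<close> is expressed by the hypothesis
  that no proper submodule contains \<open>Ve\<close>.\<close>

lemma killed_submodule_subset_radical:
  assumes e: "e \<in> carrier R"
    and gen: "\<And>L. \<lbrakk>right_submodule R L V; \<And>v. v \<in> carrier V \<Longrightarrow> v \<triangleleft>\<^bsub>V\<^esub> e \<in> L\<rbrakk> \<Longrightarrow> L = carrier V"
    and N: "right_submodule R N V" and kill: "\<And>v. v \<in> N \<Longrightarrow> v \<triangleleft>\<^bsub>V\<^esub> e = \<zero>\<^bsub>V\<^esub>"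
  shows "N \<subseteq> module_radical R V"
proof -
  have "N \<subseteq> Q" if max: "maximal_submodule R Q V" for Q
  proof (rule ccontr)
    assume "\<not> N \<subseteq> Q"
    have Q: "right_submodule R Q V" and "Q \<noteq> carrier V"
      using max by (auto simp: maximal_submodule_def)
    note sum = right_submodule_sum[OF N Q]
    have "N <+>\<^bsub>V\<^esub> Q = carrier V"
      using max sum \<open>\<not> N \<subseteq> Q\<close> unfolding maximal_submodule_def by blast
    have "v \<triangleleft>\<^bsub>V\<^esub> e \<in> Q" if "v \<in> carrier V" for v
    proof -
      have "v \<in> N <+>\<^bsub>V\<^esub> Q"
        using that \<open>N <+>\<^bsub>V\<^esub> Q = carrier V\<close> by simp
      then obtain n q where "n \<in> N" "q \<in> Q" "v = n \<oplus>\<^bsub>V\<^esub> q"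
        by (auto simp: set_add_def')
      moreover have "n \<in> carrier V" "q \<in> carrier V"
        using \<open>n \<in> N\<close> \<open>q \<in> Q\<close> right_submoduleD(1)[OF N] right_submoduleD(1)[OF Q] by auto
      ultimately have "v \<triangleleft>\<^bsub>V\<^esub> e = q \<triangleleft>\<^bsub>V\<^esub> e"
        using e kill[of n] by (simp add: ract_add_left ract_closed)
      then show ?thesis
        using right_submoduleD(5)[OF Q \<open>q \<in> Q\<close> e] by simp
    qed
    then show False
      using gen[OF Q] \<open>Q \<noteq> carrier V\<close> by blast
  qed
  then show ?thesis
    using right_submoduleD(1)[OF N] by (auto simp: module_radical_def)
qed

section \<open>Semisimple rings\<close>

text \<open>The finite form of the existence of complements: adding one simple submodule \<open>S\<close> at a time, \<open>C\<close> is
  replaced by \<open>C + S\<close> whenever \<open>S\<close> is not yet contained in \<open>U + C\<close>; by simplicity \<open>S\<close> then meets \<open>U + C\<close>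
  trivially. Finitely many summands suffice in a ring, since they already account for \<open>1\<close>.\<close>

lemma relative_complement:
  assumes "finite F" "\<And>S. S \<in> F \<Longrightarrow> simple_submodule R S V" and U: "right_submodule R U V"
  shows "\<exists>C. right_submodule R C V \<and> U \<inter> C = {\<zero>\<^bsub>V\<^esub>} \<and> (\<forall>S\<in>F. S \<subseteq> U <+>\<^bsub>V\<^esub> C)"
  using assms(1,2)
proof (induction F rule: finite_induct)
  case empty
  have "right_submodule R {\<zero>\<^bsub>V\<^esub>} V"
    by (rule right_submoduleI) auto
  then show ?case
    using right_submoduleD(2)[OF U] by auto
next
  case (insert S F)
  then obtain C where C: "right_submodule R C V" and UC: "U \<inter> C = {\<zero>\<^bsub>V\<^esub>}"
    and F: "\<And>T. T \<in> F \<Longrightarrow> T \<subseteq> U <+>\<^bsub>V\<^esub> C"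
    by auto
  have S: "right_submodule R S V"
    and min: "\<And>N. \<lbrakk>right_submodule R N V; N \<subseteq> S\<rbrakk> \<Longrightarrow> N = {\<zero>\<^bsub>V\<^esub>} \<or> N = S"
    using insert.prems[of S] by (auto simp: simple_submodule_def)
  note u = right_submoduleD[OF U] and c = right_submoduleD[OF C] and s = right_submoduleD[OF S]
  note UCsub = right_submodule_sum[OF U C]
  show ?case
  proof (cases "S \<subseteq> U <+>\<^bsub>V\<^esub> C")
    case True
    then show ?thesis
      using C UC F by (intro exI[of _ C]) auto
  next
    case False
    then have S0: "S \<inter> (U <+>\<^bsub>V\<^esub> C) = {\<zero>\<^bsub>V\<^esub>}"
      using min[OF right_submodule_Int[OF S UCsub(1)]] by blast
    note CS = right_submodule_sum[OF C S]
    have "U \<inter> (C <+>\<^bsub>V\<^esub> S) \<subseteq> {\<zero>\<^bsub>V\<^esub>}"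
    proof
      fix x assume x: "x \<in> U \<inter> (C <+>\<^bsub>V\<^esub> S)"
      then obtain y t where y: "y \<in> C" and t: "t \<in> S" and xyt: "x = y \<oplus>\<^bsub>V\<^esub> t"
        by (auto simp: set_add_def')
      have carr: "x \<in> carrier V" "y \<in> carrier V" "t \<in> carrier V"
        using x y t u(1) c(1) s(1) by auto
      have "t = x \<oplus>\<^bsub>V\<^esub> (\<ominus>\<^bsub>V\<^esub> y)"
        using carr xyt by (metis V.a_comm V.a_inv_closed V.r_neg1)
      moreover have "\<ominus>\<^bsub>V\<^esub> y \<in> C"
        using c(4) y by auto
      ultimately have "t \<in> U <+>\<^bsub>V\<^esub> C"
        using x by (auto simp: set_add_def')
      then have "t = \<zero>\<^bsub>V\<^esub>"
        using S0 t by blast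
      then show "x \<in> {\<zero>\<^bsub>V\<^esub>}"
        using xyt carr x y UC by auto
    qed
    moreover have "\<zero>\<^bsub>V\<^esub> \<in> U \<inter> (C <+>\<^bsub>V\<^esub> S)"
      using u(2) right_submoduleD(2)[OF CS(1)] by auto
    moreover have "U <+>\<^bsub>V\<^esub> C \<subseteq> U <+>\<^bsub>V\<^esub> (C <+>\<^bsub>V\<^esub> S)"
      using CS(2) unfolding set_add_def'[of V U] by blast
    moreover have "S \<subseteq> U <+>\<^bsub>V\<^esub> (C <+>\<^bsub>V\<^esub> S)"
      using CS(3) right_submodule_sum(3)[OF U CS(1)] by blast
    ultimately show ?thesis
      using CS(1) F by (intro exI[of _ "C <+>\<^bsub>V\<^esub> S"]) blast
  qed
qed

end

lemma generate_finite_support: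
  assumes "x \<in> generate G (\<Union>\<S>)"
  shows "\<exists>F. finite F \<and> F \<subseteq> \<S> \<and> x \<in> generate G (\<Union>F)"
  using assms
proof (induction x rule: generate.induct)
  case one
  then show ?case
    by (intro exI[of _ "{}"]) (auto intro: generate.one)
next
  case (incl h)
  then obtain S where "S \<in> \<S>" "h \<in> S"
    by auto
  then show ?case
    by (intro exI[of _ "{S}"]) (auto intro: generate.incl)
next
  case (inv h)
  then obtain S where "S \<in> \<S>" "h \<in> S"
    by auto
  then show ?case
    by (intro exI[of _ "{S}"]) (auto intro: generate.inv)
next
  case (eng h1 h2)
  then obtain F1 F2 where F: "finite F1" "F1 \<subseteq> \<S>" "h1 \<in> generate G (\<Union>F1)"
     "finite F2" "F2 \<subseteq> \<S>" "h2 \<in> generate G (\<Union>F2)"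
    by auto
  have mono: "y \<in> generate G B" if "y \<in> generate G A" "A \<subseteq> B" for y A B
    using that by (induction rule: generate.induct) (auto intro: generate.intros)
  have "h1 \<in> generate G (\<Union>(F1 \<union> F2))" "h2 \<in> generate G (\<Union>(F1 \<union> F2))"
    using F by (auto intro!: mono[of h1 "\<Union>F1"] mono[of h2 "\<Union>F2"])
  then show ?case
    using F by (intro exI[of _ "F1 \<union> F2"]) (auto intro: generate.eng)
qed

lemma right_module_regular:
  assumes "ring R"
  shows "right_module R (regular_module R)"
proof -
  interpret ring R by fact
  have "abelian_group (regular_module R)"
    by (rule abelian_groupI) (auto simp: regular_module_def a_ac intro: a_inv_closed l_neg add.l_inv_ex)
  then show ?thesis
    by (intro right_moduleI assms) (auto simp: regular_module_def ring_simprules)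
qed

text \<open>Write \<open>1 = f + c\<close> with \<open>f \<in> U\<close> and \<open>c\<close> in a complement \<open>C\<close>. For \<open>u \<in> U\<close> the element
  \<open>cu = u - fu\<close> lies in both \<open>C\<close> and \<open>U\<close>, hence is zero.\<close>

lemma semisimple_right_ideal_left_unit:
  assumes R: "ring R" and ss: "semisimple_ring R" and U: "right_submodule R U (regular_module R)"
  obtains f where "f \<in> U" "\<And>u. u \<in> U \<Longrightarrow> f \<otimes>\<^bsub>R\<^esub> u = u"
proof -
  interpret right_module R "regular_module R"
    by (rule right_module_regular[OF R])
  have car: "carrier (regular_module R) = carrier R" and add: "add (regular_module R) = add R"
    and zero: "ring.zero (regular_module R) = \<zero>\<^bsub>R\<^esub>" and ract: "ract (regular_module R) = monoid.mult R"
    by (auto simp: regular_module_def)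
  obtain \<S> where simple: "\<And>S. S \<in> \<S> \<Longrightarrow> simple_submodule R S (regular_module R)"
    and gen: "generate (add_monoid (regular_module R)) (\<Union>\<S>) = carrier R"
    using ss by (auto simp: semisimple_ring_def semisimple_module_def car)
  obtain F where F: "finite F" "F \<subseteq> \<S>" "\<one>\<^bsub>R\<^esub> \<in> generate (add_monoid (regular_module R)) (\<Union>F)"
    using generate_finite_support[of "\<one>\<^bsub>R\<^esub>" "add_monoid (regular_module R)" \<S>] gen by auto
  obtain C where C: "right_submodule R C (regular_module R)" and UC: "U \<inter> C = {\<zero>\<^bsub>R\<^esub>}"
    and FC: "\<And>S. S \<in> F \<Longrightarrow> S \<subseteq> U <+>\<^bsub>regular_module R\<^esub> C"
    using relative_complement[OF F(1) _ U] simple F(2) by (metis subsetD zero)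
  have "generate (add_monoid (regular_module R)) (\<Union>F) \<subseteq> U <+>\<^bsub>regular_module R\<^esub> C"
    using FC right_submodule_sum(1)[OF U C]
    by (intro V.add.generate_subgroup_incl) (auto simp: right_submodule_def additive_subgroup_def)
  then obtain f c where f: "f \<in> U" and c: "c \<in> C" and fc: "\<one>\<^bsub>R\<^esub> = f \<oplus>\<^bsub>R\<^esub> c"
    using F(3) by (force simp: set_add_def' add)
  have "f \<otimes>\<^bsub>R\<^esub> u = u" if u: "u \<in> U" for u
  proof -
    have carr: "f \<in> carrier R" "c \<in> carrier R" "u \<in> carrier R"
      using f c u right_submoduleD(1)[OF U] right_submoduleD(1)[OF C] car by auto
    have fu: "f \<otimes>\<^bsub>R\<^esub> u \<in> U" and cu: "c \<otimes>\<^bsub>R\<^esub> u \<in> C"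
      using right_submoduleD(5)[OF U f] right_submoduleD(5)[OF C c] carr by (auto simp: ract)
    have split: "f \<otimes>\<^bsub>R\<^esub> u \<oplus>\<^bsub>R\<^esub> c \<otimes>\<^bsub>R\<^esub> u = u"
      using fc carr by (metis R.l_distr R.l_one)
    then have "c \<otimes>\<^bsub>R\<^esub> u = \<ominus>\<^bsub>R\<^esub> (f \<otimes>\<^bsub>R\<^esub> u) \<oplus>\<^bsub>R\<^esub> u"
      using carr fu cu R.r_neg1[of "f \<otimes>\<^bsub>R\<^esub> u" "c \<otimes>\<^bsub>R\<^esub> u"] by simp
    moreover have "\<ominus>\<^bsub>R\<^esub> (f \<otimes>\<^bsub>R\<^esub> u) \<oplus>\<^bsub>R\<^esub> u \<in> U"
    proof -
      have "\<ominus>\<^bsub>R\<^esub> (f \<otimes>\<^bsub>R\<^esub> u) = (f \<otimes>\<^bsub>R\<^esub> u) \<otimes>\<^bsub>R\<^esub> (\<ominus>\<^bsub>R\<^esub> \<one>\<^bsub>R\<^esub>)"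
        using carr by (simp add: R.r_minus)
      then show ?thesis
        using right_submoduleD(3)[OF U _ u] right_submoduleD(5)[OF U fu, of "\<ominus>\<^bsub>R\<^esub> \<one>\<^bsub>R\<^esub>"]
        by (simp add: ract add)
    qed
    ultimately have "c \<otimes>\<^bsub>R\<^esub> u = \<zero>\<^bsub>R\<^esub>"
      using cu UC by auto
    then show ?thesis
      using split carr by simp
  qed
  then show thesis
    using that f by blast
qed

text \<open>The left unit \<open>f\<close> of \<open>T\<close> is also a right unit. For \<open>u = t - tf\<close> one has \<open>uT = 0\<close>, in particular
  \<open>uRu = 0\<close>; but a left unit \<open>ur\<close> of the right ideal \<open>uR\<close> gives \<open>u = uru = 0\<close>.\<close>

lemma semisimple_ideal_right_unit:
  assumes R: "ring R" and ss: "semisimple_ring R" and T: "ideal T R"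
  obtains f where "f \<in> T" "\<And>t. t \<in> T \<Longrightarrow> t \<otimes>\<^bsub>R\<^esub> f = t"
proof -
  interpret ring R by fact
  interpret T: ideal T R by fact
  interpret reg: right_module R "regular_module R"
    by (rule right_module_regular[OF R])
  have "right_submodule R T (regular_module R)"
    by (rule reg.right_submoduleI) (auto simp: regular_module_def T.I_r_closed)
  then obtain f where f: "f \<in> T" and fl: "\<And>t. t \<in> T \<Longrightarrow> f \<otimes>\<^bsub>R\<^esub> t = t"
    using semisimple_right_ideal_left_unit[OF R ss] by blast
  have "t \<otimes>\<^bsub>R\<^esub> f = t" if t: "t \<in> T" for t
  proof -
    have fc: "f \<in> carrier R" and tc: "t \<in> carrier R"
      using f t by auto
    define u where "u = t \<ominus>\<^bsub>R\<^esub> t \<otimes>\<^bsub>R\<^esub> f"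
    have uc: "u \<in> carrier R"
      using fc tc by (simp add: u_def)
    have ut: "u \<otimes>\<^bsub>R\<^esub> s = \<zero>\<^bsub>R\<^esub>" if "s \<in> T" for s
    proof -
      have "s \<in> carrier R" using that by auto
      moreover from this have "u \<otimes>\<^bsub>R\<^esub> s = t \<otimes>\<^bsub>R\<^esub> s \<ominus>\<^bsub>R\<^esub> t \<otimes>\<^bsub>R\<^esub> (f \<otimes>\<^bsub>R\<^esub> s)"
        using fc tc by (simp add: u_def minus_eq l_distr l_minus m_assoc)
      ultimately show ?thesis
        using fl[OF that] tc by (simp add: minus_eq r_neg)
    qed
    have "right_submodule R {u \<otimes>\<^bsub>R\<^esub> r |r. r \<in> carrier R} (regular_module R)"
    proof (rule reg.right_submoduleI)
      show "\<zero>\<^bsub>regular_module R\<^esub> \<in> {u \<otimes>\<^bsub>R\<^esub> r |r. r \<in> carrier R}"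
        using uc by (auto simp: regular_module_def intro!: exI[of _ "\<zero>\<^bsub>R\<^esub>"])
    next
      fix v w assume "v \<in> {u \<otimes>\<^bsub>R\<^esub> r |r. r \<in> carrier R}" "w \<in> {u \<otimes>\<^bsub>R\<^esub> r |r. r \<in> carrier R}"
      then obtain r r' where "r \<in> carrier R" "r' \<in> carrier R" "v = u \<otimes>\<^bsub>R\<^esub> r" "w = u \<otimes>\<^bsub>R\<^esub> r'"
        by auto
      then show "v \<oplus>\<^bsub>regular_module R\<^esub> w \<in> {u \<otimes>\<^bsub>R\<^esub> r |r. r \<in> carrier R}"
        using uc by (auto simp: regular_module_def r_distr intro!: exI[of _ "r \<oplus>\<^bsub>R\<^esub> r'"])
    qed (use uc in \<open>auto simp: regular_module_def m_assoc\<close>)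
    then obtain g where "g \<in> {u \<otimes>\<^bsub>R\<^esub> r |r. r \<in> carrier R}"
      and gl: "\<And>w. w \<in> {u \<otimes>\<^bsub>R\<^esub> r |r. r \<in> carrier R} \<Longrightarrow> g \<otimes>\<^bsub>R\<^esub> w = w"
      using semisimple_right_ideal_left_unit[OF R ss] by blast
    then obtain r where r: "r \<in> carrier R" "g = u \<otimes>\<^bsub>R\<^esub> r"
      by blast
    have "g \<otimes>\<^bsub>R\<^esub> u = u"
      using gl[of u] uc by (force intro: exI[of _ "\<one>\<^bsub>R\<^esub>"])
    moreover have "u \<in> T"
      unfolding u_def minus_eq using t f fc by (intro T.a_closed T.a_inv_closed) (auto simp: T.I_r_closed)
    then have "g \<otimes>\<^bsub>R\<^esub> u = \<zero>\<^bsub>R\<^esub>"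
      using r uc ut[of "r \<otimes>\<^bsub>R\<^esub> u"] by (simp add: m_assoc T.I_l_closed)
    ultimately have "t \<ominus>\<^bsub>R\<^esub> t \<otimes>\<^bsub>R\<^esub> f = \<zero>\<^bsub>R\<^esub>"
      by (simp add: u_def)
    then show ?thesis
      using fc tc minus_equality[of t "\<ominus>\<^bsub>R\<^esub> (t \<otimes>\<^bsub>R\<^esub> f)"] by (simp add: minus_eq)
  qed
  then show thesis
    using that f by blast
qed

text \<open>The annihilator \<open>T\<close> of \<open>N\<close> is a two-sided ideal with a right unit \<open>f\<close>. As \<open>e \<in> T\<close>, the vectors
  fixed by \<open>f\<close> form a submodule that contains every \<open>ve\<close>, so \<open>f\<close> acts as the identity on the whole
  module, while it annihilates \<open>N\<close>.\<close>

lemma (in right_module) killed_submodule_trivial_if_semisimple: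
  assumes ss: "semisimple_ring R" and e: "e \<in> carrier R"
    and gen: "\<And>L. \<lbrakk>right_submodule R L V; \<And>v. v \<in> carrier V \<Longrightarrow> v \<triangleleft>\<^bsub>V\<^esub> e \<in> L\<rbrakk> \<Longrightarrow> L = carrier V"
    and N: "right_submodule R N V" and kill: "\<And>v. v \<in> N \<Longrightarrow> v \<triangleleft>\<^bsub>V\<^esub> e = \<zero>\<^bsub>V\<^esub>"
  shows "N = {\<zero>\<^bsub>V\<^esub>}"
proof -
  note n = right_submoduleD[OF N]
  \<comment> \<open>the annihilator of \<open>N\<close>; it is two-sided because \<open>N\<close> is a submodule\<close>
  define T where "T = {a \<in> carrier R. \<forall>v\<in>N. v \<triangleleft>\<^bsub>V\<^esub> a = \<zero>\<^bsub>V\<^esub>}"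
  have "ideal T R"
  proof (rule idealI)
    show "subgroup T (add_monoid R)"
    proof (rule R.add.subgroupI)
      show "T \<noteq> {}"
        using n(1) by (auto simp: T_def intro!: exI[of _ "\<zero>\<^bsub>R\<^esub>"])
    qed (use n(1) in \<open>auto simp: T_def ract_neg ract_add_right subset_iff a_inv_def[symmetric]\<close>)
  qed (use n(1) n(5) in \<open>auto simp: T_def ract_mult subset_iff R.ring_axioms\<close>)
  then interpret T: ideal T R .
  obtain f where f: "f \<in> T" and fr: "\<And>t. t \<in> T \<Longrightarrow> t \<otimes>\<^bsub>R\<^esub> f = t"
    using semisimple_ideal_right_unit[OF R.ring_axioms ss \<open>ideal T R\<close>] by blast
  have fc: "f \<in> carrier R"
    using f by (rule T.a_Hcarr)
  have "right_submodule R {v \<in> carrier V. v \<triangleleft>\<^bsub>V\<^esub> f = v} V"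
  proof (rule right_submoduleI)
    fix v a assume v: "v \<in> {v \<in> carrier V. v \<triangleleft>\<^bsub>V\<^esub> f = v}" and a: "a \<in> carrier R"
    have fa: "(f \<otimes>\<^bsub>R\<^esub> a) \<otimes>\<^bsub>R\<^esub> f = f \<otimes>\<^bsub>R\<^esub> a"
      using fr[of "f \<otimes>\<^bsub>R\<^esub> a"] f a by (simp add: T.I_r_closed)
    have "v \<triangleleft>\<^bsub>V\<^esub> a \<triangleleft>\<^bsub>V\<^esub> f = v \<triangleleft>\<^bsub>V\<^esub> ((f \<otimes>\<^bsub>R\<^esub> a) \<otimes>\<^bsub>R\<^esub> f)"
      using v a fc by (simp add: ract_mult ract_closed)
    also have "\<dots> = v \<triangleleft>\<^bsub>V\<^esub> a"
      unfolding fa using v a fc by (simp add: ract_mult)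
    finally show "v \<triangleleft>\<^bsub>V\<^esub> a \<in> {v \<in> carrier V. v \<triangleleft>\<^bsub>V\<^esub> f = v}"
      using v a by (simp add: ract_closed)
  qed (use fc in \<open>auto simp: ract_add_left\<close>)
  moreover have "v \<triangleleft>\<^bsub>V\<^esub> e \<in> {v \<in> carrier V. v \<triangleleft>\<^bsub>V\<^esub> f = v}" if "v \<in> carrier V" for v
  proof -
    have "e \<in> T"
      unfolding T_def using e kill by blast
    then show ?thesis
      using that e fc fr[of e] by (simp add: ract_closed ract_mult[symmetric])
  qed
  ultimately have all: "{v \<in> carrier V. v \<triangleleft>\<^bsub>V\<^esub> f = v} = carrier V"
    by (rule gen)
  have "v = \<zero>\<^bsub>V\<^esub>" if "v \<in> N" for v
  proof -
    have "v \<triangleleft>\<^bsub>V\<^esub> f = v"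
      using all n(1) that by blast
    then show ?thesis
      using f that unfolding T_def by auto
  qed
  then show ?thesis
    using n(2) by blast
qed


section \<open>Homomorphisms and quotients\<close>

lemma right_module_homI:
  assumes "\<And>v. v \<in> carrier V \<Longrightarrow> f v \<in> carrier W"
    and "\<And>v w. \<lbrakk>v \<in> carrier V; w \<in> carrier V\<rbrakk> \<Longrightarrow> f (v \<oplus>\<^bsub>V\<^esub> w) = f v \<oplus>\<^bsub>W\<^esub> f w"
    and "\<And>v a. \<lbrakk>v \<in> carrier V; a \<in> carrier R\<rbrakk> \<Longrightarrow> f (v \<triangleleft>\<^bsub>V\<^esub> a) = f v \<triangleleft>\<^bsub>W\<^esub> a"
  shows "f \<in> right_module_hom R V W"
  using assms by (simp add: right_module_hom_def)

lemma right_module_homD: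
  assumes "f \<in> right_module_hom R V W"
  shows "\<And>v. v \<in> carrier V \<Longrightarrow> f v \<in> carrier W"
    and "\<And>v w. \<lbrakk>v \<in> carrier V; w \<in> carrier V\<rbrakk> \<Longrightarrow> f (v \<oplus>\<^bsub>V\<^esub> w) = f v \<oplus>\<^bsub>W\<^esub> f w"
    and "\<And>v a. \<lbrakk>v \<in> carrier V; a \<in> carrier R\<rbrakk> \<Longrightarrow> f (v \<triangleleft>\<^bsub>V\<^esub> a) = f v \<triangleleft>\<^bsub>W\<^esub> a"
  using assms by (auto simp: right_module_hom_def)

lemma abelian_group_hom_additiveI:
  assumes "abelian_group V" "abelian_group W"
    and "\<And>v. v \<in> carrier V \<Longrightarrow> f v \<in> carrier W"
    and "\<And>v w. \<lbrakk>v \<in> carrier V; w \<in> carrier V\<rbrakk> \<Longrightarrow> f (v \<oplus>\<^bsub>V\<^esub> w) = f v \<oplus>\<^bsub>W\<^esub> f w"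
  shows "abelian_group_hom V W f"
  using assms
  by (intro abelian_group_homI group_hom.intro group_hom_axioms.intro)
     (auto simp: hom_def abelian_group.a_group)

lemma abelian_group_if_comm_group:
  assumes "comm_group G" "carrier V = carrier G" "add V = monoid.mult G" "\<zero>\<^bsub>V\<^esub> = \<one>\<^bsub>G\<^esub>"
  shows "abelian_group V"
proof -
  interpret G: comm_group G by fact
  show ?thesis
    by (rule abelian_groupI) (auto simp: assms G.m_ac intro: G.l_inv_ex)
qed

lemma abelian_group_hom_finsum:
  assumes "abelian_group_hom V W h" "f \<in> A \<rightarrow> carrier V"
  shows "h (finsum V f A) = finsum W (\<lambda>i. h (f i)) A"
proof -
  interpret abelian_group_hom V W h by fact
  show ?thesis
    using assms(2) by (induction A rule: infinite_finite_induct) (auto simp: Pi_iff)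
qed

lemma right_module_hom_zero:
  assumes "right_module R V" "right_module R W" "f \<in> right_module_hom R V W"
  shows "f \<zero>\<^bsub>V\<^esub> = \<zero>\<^bsub>W\<^esub>"
proof -
  interpret V: right_module R V by fact
  interpret W: right_module R W by fact
  interpret abelian_group_hom V W f
    by (rule abelian_group_hom_additiveI[OF V.V.abelian_group_axioms W.V.abelian_group_axioms
          right_module_homD(1,2)[OF assms(3)]])
  show ?thesis
    by (rule hom_zero)
qed

lemma right_module_kernel_submodule:
  assumes "right_module R V" "right_module R W" "f \<in> right_module_hom R V W"
  shows "right_submodule R (a_kernel V W f) V"
proof -
  interpret V: right_module R V by fact
  interpret W: right_module R W by fact
  note f = right_module_homD[OF assms(3)]
  interpret abelian_group_hom V W f
    by (rule abelian_group_hom_additiveI[OF V.V.abelian_group_axioms W.V.abelian_group_axioms f(1,2)])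
  show ?thesis
    unfolding a_kernel_def'
  proof (rule V.right_submoduleI)
    fix v a assume "v \<in> {x \<in> carrier V. f x = \<zero>\<^bsub>W\<^esub>}" "a \<in> carrier R"
    then show "v \<triangleleft>\<^bsub>V\<^esub> a \<in> {x \<in> carrier V. f x = \<zero>\<^bsub>W\<^esub>}"
      using f(3)[of v a] by (simp add: V.ract_closed)
  qed auto
qed

lemma right_module_iso_if_trivial_kernel:
  assumes "right_module R V" "right_module R W" "f \<in> right_module_hom R V W"
    and "f ` carrier V = carrier W" "a_kernel V W f = {\<zero>\<^bsub>V\<^esub>}"
  shows "right_module_iso R V W"
proof -
  interpret V: right_module R V by fact
  interpret W: right_module R W by fact
  note f = right_module_homD[OF assms(3)]
  interpret group_hom "add_monoid V" "add_monoid W" f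
    using f by (intro group_hom.intro group_hom_axioms.intro V.a_group W.a_group) (auto simp: hom_def)
  have "inj_on f (carrier V)"
    using inj_iff_trivial_ker assms(5) by (simp add: a_kernel_def)
  then show ?thesis
    using assms(3,4) by (auto simp: right_module_iso_def bij_betw_def)
qed

text \<open>The actions on quotient modules and on tensor products are both defined as a union of cosets over
  all representatives; this identifies the union with the coset of any one representative.\<close>

lemma (in group) coset_image_well_defined:
  assumes N: "subgroup N G" and E: "E \<in> hom G G" and EN: "E ` N \<subseteq> N" and x: "x \<in> carrier G"
  shows "(\<Union>c\<in>N #> x. N #> E c) = N #> E x"
proof -
  have "N #> E c = N #> E x" if c: "c \<in> N #> x" for c
  proof -
    obtain n where n: "n \<in> N" "c = n \<otimes> x"
      using c by (auto simp: r_coset_def)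
    have nc: "n \<in> carrier G"
      using subgroup.mem_carrier[OF N n(1)] .
    have "E c = E n \<otimes> E x"
      unfolding n(2) by (rule hom_mult[OF E nc x])
    moreover have "E n \<in> N" "E x \<in> carrier G"
      using n EN E x by (auto simp: hom_def)
    ultimately have "E c \<in> N #> E x"
      by (auto simp: r_coset_def)
    then show ?thesis
      using repr_independence[OF _ \<open>E x \<in> carrier G\<close> N] by simp
  qed
  moreover have "N #> x \<noteq> {}"
    using rcos_self[OF x N] by blast
  ultimately show ?thesis
    by (intro SUP_eq_const)
qed

lemma (in right_module) quotient_module_right_module:
  assumes N: "right_submodule R N V"
  shows "right_module R (quotient_module V N)"
    and "carrier (quotient_module V N) = (\<lambda>v. N +>\<^bsub>V\<^esub> v) ` carrier V"
    and "\<zero>\<^bsub>quotient_module V N\<^esub> = N"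
    and "\<And>v w. \<lbrakk>v \<in> carrier V; w \<in> carrier V\<rbrakk> \<Longrightarrow>
      (N +>\<^bsub>V\<^esub> v) \<oplus>\<^bsub>quotient_module V N\<^esub> (N +>\<^bsub>V\<^esub> w) = N +>\<^bsub>V\<^esub> (v \<oplus>\<^bsub>V\<^esub> w)"
    and "\<And>v a. \<lbrakk>v \<in> carrier V; a \<in> carrier R\<rbrakk> \<Longrightarrow>
      (N +>\<^bsub>V\<^esub> v) \<triangleleft>\<^bsub>quotient_module V N\<^esub> a = N +>\<^bsub>V\<^esub> (v \<triangleleft>\<^bsub>V\<^esub> a)"
proof -
  let ?Q = "quotient_module V N"
  note n = right_submoduleD[OF N]
  have "additive_subgroup N V"
    using N by (simp add: right_submodule_def)
  then interpret N: abelian_subgroup N V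
    by (intro abelian_subgroupI3 V.abelian_group_axioms)
  have Qgrp: "abelian_group ?Q"
    by (rule abelian_group_if_comm_group[OF N.a_factorgroup_is_comm_group])
       (auto simp: quotient_module_def A_FactGroup_def FactGroup_def A_RCOSETS_def set_add_def)
  show car: "carrier ?Q = (\<lambda>v. N +>\<^bsub>V\<^esub> v) ` carrier V"
    by (auto simp: quotient_module_def A_RCOSETS_def')
  show "\<zero>\<^bsub>?Q\<^esub> = N"
    by (simp add: quotient_module_def)
  show sum: "(N +>\<^bsub>V\<^esub> v) \<oplus>\<^bsub>?Q\<^esub> (N +>\<^bsub>V\<^esub> w) = N +>\<^bsub>V\<^esub> (v \<oplus>\<^bsub>V\<^esub> w)"
    if "v \<in> carrier V" "w \<in> carrier V" for v w
    using that N.a_rcos_sum by (simp add: quotient_module_def)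
  show act: "(N +>\<^bsub>V\<^esub> v) \<triangleleft>\<^bsub>?Q\<^esub> a = N +>\<^bsub>V\<^esub> (v \<triangleleft>\<^bsub>V\<^esub> a)"
    if "v \<in> carrier V" "a \<in> carrier R" for v a
  proof -
    have "(\<Union>c\<in>r_coset (add_monoid V) N v. r_coset (add_monoid V) N (c \<triangleleft>\<^bsub>V\<^esub> a)) =
        r_coset (add_monoid V) N (v \<triangleleft>\<^bsub>V\<^esub> a)"
      by (rule group.coset_image_well_defined[OF V.a_group N.a_subgroup])
         (use that n(5) in \<open>auto simp: hom_def ract_closed ract_add_left\<close>)
    then show ?thesis
      by (simp add: quotient_module_def a_r_coset_def)
  qed
  show "right_module R ?Q"
  proof (rule right_moduleI[OF R.ring_axioms Qgrp], unfold car, goal_cases)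
    case (1 Y a)
    then show ?case
      by (auto simp only: act ract_closed image_iff)
  next
    case (2 Y Z a)
    then show ?case
      by (auto simp only: sum act ract_closed ract_add_left V.a_closed)
  next
    case (3 Y a b)
    then show ?case
      by (auto simp only: sum act ract_closed ract_add_right R.a_closed)
  next
    case (4 Y a b)
    then show ?case
      by (auto simp only: act ract_closed ract_mult R.m_closed)
  next
    case (5 Y)
    then show ?case
      by (auto simp only: act ract_one R.one_closed)
  qed
qed

section \<open>Tensor products\<close>

text \<open>Connects the abstract universal property of free Abelian groups with the explicit formula by which
  \<^const>\<open>tensor_lift\<close> is defined.\<close>

lemma (in comm_group) hom_free_Abelian_group_expansion:
  assumes h: "h \<in> hom (free_Abelian_group X) G" and c: "Poly_Mapping.keys c \<subseteq> X"
  shows "h c = (\<Otimes>p\<in>Poly_Mapping.keys c. h (frag_of p) [^] poly_mapping.lookup c p)"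
proof -
  interpret F: group_hom "free_Abelian_group X" G h
    by (intro group_hom.intro group_hom_axioms.intro h) (auto simp: group_axioms)
  have "h (\<Sum>p\<in>A. frag_cmul (n p) (frag_of p)) = (\<Otimes>p\<in>A. h (frag_of p) [^] n p) \<and>
        (\<Sum>p\<in>A. frag_cmul (n p) (frag_of p)) \<in> carrier (free_Abelian_group X)"
    if "finite A" "A \<subseteq> X" for A and n :: "_ \<Rightarrow> int"
    using that
  proof (induction A rule: finite_induct)
    case empty
    show ?case
      using F.hom_one by simp
  next
    case (insert x A)
    have x: "frag_of x \<in> carrier (free_Abelian_group X)"
      using insert by simp
    have pow: "frag_cmul (n x) (frag_of x) = frag_of x [^]\<^bsub>free_Abelian_group X\<^esub> n x"
      using insert by simp
    have "frag_cmul (n x) (frag_of x) \<in> carrier (free_Abelian_group X)"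
      unfolding pow using x by (rule F.G.int_pow_closed)
    moreover have "h (frag_cmul (n x) (frag_of x)) = h (frag_of x) [^] n x"
      unfolding pow by (rule F.hom_int_pow[OF x])
    moreover have IH: "h (\<Sum>p\<in>A. frag_cmul (n p) (frag_of p)) = (\<Otimes>p\<in>A. h (frag_of p) [^] n p)"
      "(\<Sum>p\<in>A. frag_cmul (n p) (frag_of p)) \<in> carrier (free_Abelian_group X)"
      using insert by auto
    moreover have "(\<lambda>p. h (frag_of p) [^] n p) \<in> insert x A \<rightarrow> carrier G"
      using insert.prems by (auto intro!: int_pow_closed F.hom_closed)
    ultimately show ?case
      using insert F.hom_mult[of "frag_cmul (n x) (frag_of x)" "\<Sum>p\<in>A. frag_cmul (n p) (frag_of p)"]
        F.G.m_closed[of "frag_cmul (n x) (frag_of x)" "\<Sum>p\<in>A. frag_cmul (n p) (frag_of p)"]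
      by (simp add: Pi_iff)
  qed
  from this[of "Poly_Mapping.keys c" "poly_mapping.lookup c"] show ?thesis
    using c frag_expansion[of c] by (simp add: frag_extend_def)
qed

text \<open>What a tensor product over \<open>S\<close> needs in order to be a right \<open>R\<close>-module: \<open>S\<close> acts on the second
  factor by \<open>R\<close>-endomorphisms.\<close>

locale tensor_factors = V: right_module S V + L: right_module R L
  for S :: "('s, 'x) ring_scheme" and V :: "('v, 's, 'y) right_mod_scheme"
    and R :: "('r, 'z) ring_scheme" and L :: "('l, 'r, 's, 'u) bimod_scheme" +
  assumes lact_hom: "s \<in> carrier S \<Longrightarrow> lact L s \<in> right_module_hom R L L"
begin

abbreviation "F \<equiv> tensor_free V L"
abbreviation "N \<equiv> tensor_kernel S V L"
abbreviation "P \<equiv> tensor_product S V L"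
abbreviation "E r \<equiv> frag_extend (\<lambda>(v, l). frag_of (v, l \<triangleleft>\<^bsub>L\<^esub> r))"
abbreviation tens (infixl "\<otimes>\<otimes>" 70) where "v \<otimes>\<otimes> l \<equiv> tensor S V L v l"

sublocale F: comm_group F
  by (simp add: tensor_free_def abelian_free_Abelian_group)

lemma carrier_F: "c \<in> carrier F \<longleftrightarrow> Poly_Mapping.keys c \<subseteq> carrier V \<times> carrier L"
  and mult_F: "c \<otimes>\<^bsub>F\<^esub> d = c + d"
  and one_F: "\<one>\<^bsub>F\<^esub> = 0"
  by (auto simp: tensor_free_def)

lemma frag_of_F: "frag_of (v, l) \<in> carrier F \<longleftrightarrow> v \<in> carrier V \<and> l \<in> carrier L"
  by (simp add: carrier_F)

lemma inv_F: "c \<in> carrier F \<Longrightarrow> inv\<^bsub>F\<^esub> c = - c"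
  by (simp add: tensor_free_def)

lemma add_F: "c \<in> carrier F \<Longrightarrow> d \<in> carrier F \<Longrightarrow> c + d \<in> carrier F"
  using F.m_closed[of c d] by (simp add: mult_F)

lemma neg_F: "c \<in> carrier F \<Longrightarrow> - c \<in> carrier F"
  using F.inv_closed[of c] by (simp add: inv_F)

lemma diff_F: "c \<in> carrier F \<Longrightarrow> d \<in> carrier F \<Longrightarrow> c - d \<in> carrier F"
  using add_F[of c "- d"] neg_F by simp

lemma lact_closed: "s \<in> carrier S \<Longrightarrow> l \<in> carrier L \<Longrightarrow> s \<triangleright>\<^bsub>L\<^esub> l \<in> carrier L"
  using right_module_homD(1)[OF lact_hom] .

lemma relators_subset: "tensor_relators S V L \<subseteq> carrier F"
  by (auto simp: tensor_relators_def frag_of_F V.ract_closed lact_closed intro!: diff_F)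

lemma subgroup_N: "subgroup N F"
  unfolding tensor_kernel_def by (rule F.generate_is_subgroup[OF relators_subset])

sublocale N: normal N F
  using subgroup_N F.normal_iff_subgroup by blast

lemma coset_eqI:
  assumes "c \<in> carrier F" "d \<in> carrier F" "c - d \<in> N"
  shows "N #>\<^bsub>F\<^esub> c = N #>\<^bsub>F\<^esub> d"
proof -
  have "c \<in> N #>\<^bsub>F\<^esub> d"
    using assms by (auto simp: r_coset_def mult_F intro!: bexI[of _ "c - d"])
  then show ?thesis
    using F.repr_independence[OF _ assms(2) subgroup_N] by simp
qed

lemma carrier_P: "carrier P = (\<lambda>c. N #>\<^bsub>F\<^esub> c) ` carrier F"
  by (simp add: tensor_product_def Let_def carrier_FactGroup)

lemma zero_P: "\<zero>\<^bsub>P\<^esub> = N #>\<^bsub>F\<^esub> 0"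
  using F.coset_mult_one[OF N.subset] by (simp add: tensor_product_def Let_def one_F)

lemma add_P:
  "c \<in> carrier F \<Longrightarrow> d \<in> carrier F \<Longrightarrow> (N #>\<^bsub>F\<^esub> c) \<oplus>\<^bsub>P\<^esub> (N #>\<^bsub>F\<^esub> d) = N #>\<^bsub>F\<^esub> (c + d)"
  using N.rcos_sum by (simp add: tensor_product_def Let_def mult_F)

lemma abelian_group_P: "abelian_group P"
  by (rule abelian_group_if_comm_group[OF F.abelian_FactGroup[OF subgroup_N]])
     (auto simp: tensor_product_def Let_def)

sublocale P: abelian_group P
  by (rule abelian_group_P)

lemma tensor_closed [simp]: "v \<in> carrier V \<Longrightarrow> l \<in> carrier L \<Longrightarrow> v \<otimes>\<otimes> l \<in> carrier P"
  by (simp add: tensor_def carrier_P frag_of_F)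

lemma tensor_add_left:
  assumes "v \<in> carrier V" "w \<in> carrier V" "l \<in> carrier L"
  shows "(v \<oplus>\<^bsub>V\<^esub> w) \<otimes>\<otimes> l = v \<otimes>\<otimes> l \<oplus>\<^bsub>P\<^esub> w \<otimes>\<otimes> l"
proof -
  have "frag_of (v \<oplus>\<^bsub>V\<^esub> w, l) - (frag_of (v, l) + frag_of (w, l)) \<in> N"
    unfolding tensor_kernel_def diff_diff_eq[symmetric]
    by (rule generate.incl) (use assms in \<open>force simp: tensor_relators_def\<close>)
  then show ?thesis
    unfolding tensor_def using assms
    by (simp add: add_P frag_of_F) (intro coset_eqI add_F, auto simp: frag_of_F)
qed

lemma tensor_add_right:
  assumes "v \<in> carrier V" "k \<in> carrier L" "l \<in> carrier L"
  shows "v \<otimes>\<otimes> (k \<oplus>\<^bsub>L\<^esub> l) = v \<otimes>\<otimes> k \<oplus>\<^bsub>P\<^esub> v \<otimes>\<otimes> l"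
proof -
  have "frag_of (v, k \<oplus>\<^bsub>L\<^esub> l) - (frag_of (v, k) + frag_of (v, l)) \<in> N"
    unfolding tensor_kernel_def diff_diff_eq[symmetric]
    by (rule generate.incl) (use assms in \<open>force simp: tensor_relators_def\<close>)
  then show ?thesis
    unfolding tensor_def using assms
    by (simp add: add_P frag_of_F) (intro coset_eqI add_F, auto simp: frag_of_F)
qed

lemma tensor_balanced:
  assumes "v \<in> carrier V" "s \<in> carrier S" "l \<in> carrier L"
  shows "(v \<triangleleft>\<^bsub>V\<^esub> s) \<otimes>\<otimes> l = v \<otimes>\<otimes> (s \<triangleright>\<^bsub>L\<^esub> l)"
proof -
  have "frag_of (v \<triangleleft>\<^bsub>V\<^esub> s, l) - frag_of (v, s \<triangleright>\<^bsub>L\<^esub> l) \<in> N"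
    unfolding tensor_kernel_def
    by (rule generate.incl) (use assms in \<open>force simp: tensor_relators_def\<close>)
  then show ?thesis
    unfolding tensor_def using assms
    by (intro coset_eqI) (auto simp: frag_of_F V.ract_closed lact_closed)
qed

lemma tensor_zero_left: "l \<in> carrier L \<Longrightarrow> \<zero>\<^bsub>V\<^esub> \<otimes>\<otimes> l = \<zero>\<^bsub>P\<^esub>"
  using tensor_add_left[of "\<zero>\<^bsub>V\<^esub>" "\<zero>\<^bsub>V\<^esub>" l] by simp

lemma tensor_neg_left:
  assumes "v \<in> carrier V" "l \<in> carrier L"
  shows "(\<ominus>\<^bsub>V\<^esub> v) \<otimes>\<otimes> l = \<ominus>\<^bsub>P\<^esub> (v \<otimes>\<otimes> l)"
  using assms tensor_add_left[of "\<ominus>\<^bsub>V\<^esub> v" v l]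
  by (intro P.minus_equality[symmetric]) (auto simp: V.V.l_neg tensor_zero_left)

lemma neg_P: "c \<in> carrier F \<Longrightarrow> \<ominus>\<^bsub>P\<^esub> (N #>\<^bsub>F\<^esub> c) = N #>\<^bsub>F\<^esub> (- c)"
  by (rule P.minus_equality) (auto simp: add_P neg_F zero_P carrier_P)

text \<open>Negatives need no separate case, because \<open>-(v \<otimes> l) = (-v) \<otimes> l\<close>.\<close>

lemma tensor_induct [consumes 1, case_names zero add tensor]:
  assumes x: "x \<in> carrier P" and zero: "Q \<zero>\<^bsub>P\<^esub>"
    and add: "\<And>x y. \<lbrakk>x \<in> carrier P; y \<in> carrier P; Q x; Q y\<rbrakk> \<Longrightarrow> Q (x \<oplus>\<^bsub>P\<^esub> y)"
    and tensor: "\<And>v l. \<lbrakk>v \<in> carrier V; l \<in> carrier L\<rbrakk> \<Longrightarrow> Q (v \<otimes>\<otimes> l)"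
  shows "Q x"
proof -
  obtain c where c: "c \<in> carrier F" and xc: "x = N #>\<^bsub>F\<^esub> c"
    using x by (auto simp: carrier_P)
  have "Q (N #>\<^bsub>F\<^esub> c) \<and> Q (N #>\<^bsub>F\<^esub> (- c))"
    using c[unfolded carrier_F]
  proof (rule free_Abelian_group_induct)
    show "Q (N #>\<^bsub>F\<^esub> 0) \<and> Q (N #>\<^bsub>F\<^esub> (- 0))" 
      using zero by (simp add: zero_P)
  next
    fix c d :: "'v \<times> 'l \<Rightarrow>\<^sub>0 int"
    assume 2: "Poly_Mapping.keys c \<subseteq> carrier V \<times> carrier L" "Poly_Mapping.keys d \<subseteq> carrier V \<times> carrier L"
      "Q (N #>\<^bsub>F\<^esub> c) \<and> Q (N #>\<^bsub>F\<^esub> (- c))" "Q (N #>\<^bsub>F\<^esub> d) \<and> Q (N #>\<^bsub>F\<^esub> (- d))"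
    then have F: "c \<in> carrier F" "d \<in> carrier F" "- c \<in> carrier F" "- d \<in> carrier F"
      by (auto simp: carrier_F)
    then have P: "N #>\<^bsub>F\<^esub> c \<in> carrier P" "N #>\<^bsub>F\<^esub> d \<in> carrier P"
        "N #>\<^bsub>F\<^esub> (- c) \<in> carrier P" "N #>\<^bsub>F\<^esub> (- d) \<in> carrier P"
      by (auto simp: carrier_P)
    show "Q (N #>\<^bsub>F\<^esub> (c - d)) \<and> Q (N #>\<^bsub>F\<^esub> (- (c - d)))"
      using 2 add[OF P(1,4)] add[OF P(3,2)] F by (auto simp: add_P)
  next
    fix p assume 3: "p \<in> carrier V \<times> carrier L"
    obtain v l where p: "p = (v, l)" "v \<in> carrier V" "l \<in> carrier L"
      using 3 by auto
    have "Q (v \<otimes>\<otimes> l)" "Q ((\<ominus>\<^bsub>V\<^esub> v) \<otimes>\<otimes> l)"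
      using tensor p by auto
    moreover have "(\<ominus>\<^bsub>V\<^esub> v) \<otimes>\<otimes> l = N #>\<^bsub>F\<^esub> (- frag_of (v, l))"
      using p by (simp add: tensor_neg_left) (simp add: tensor_def neg_P frag_of_F)
    ultimately show "Q (N #>\<^bsub>F\<^esub> frag_of p) \<and> Q (N #>\<^bsub>F\<^esub> (- frag_of p))"
      by (simp add: p tensor_def)
  qed
  then show ?thesis
    by (simp add: xc)
qed

lemma E_hom: "r \<in> carrier R \<Longrightarrow> E r \<in> hom F F"
proof (rule homI)
  fix c assume "r \<in> carrier R" "c \<in> carrier F"
  then show "E r c \<in> carrier F"
    using keys_frag_extend[of "\<lambda>(v, l). frag_of (v, l \<triangleleft>\<^bsub>L\<^esub> r)" c]
    unfolding carrier_F by (fastforce simp: L.ract_closed)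
qed (simp add: mult_F frag_extend_add)

text \<open>The endomorphism \<open>E r\<close> of the free group sends each relator to the relator of the same kind with
  every \<open>l\<close> replaced by \<open>lr\<close>; this makes the action of \<open>r\<close> on the tensor product well
  defined.\<close>

lemma E_N:
  assumes r: "r \<in> carrier R"
  shows "E r ` N \<subseteq> N"
proof -
  interpret E: group_hom F F "E r"
    by (intro group_hom.intro group_hom_axioms.intro E_hom r F.group_axioms)
  have "E r ` N = generate F (E r ` tensor_relators S V L)"
    unfolding tensor_kernel_def using E.generate_img[OF relators_subset] by simp
  also have "\<dots> \<subseteq> N"
  proof -
    have "E r ` tensor_relators S V L \<subseteq> tensor_relators S V L"
    proof
      fix y assume "y \<in> E r ` tensor_relators S V L"
      then obtain x where x: "x \<in> tensor_relators S V L" and y: "y = E r x"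
        by auto
      consider (1) v w l where "x = frag_of (v \<oplus>\<^bsub>V\<^esub> w, l) - frag_of (v, l) - frag_of (w, l)"
          "v \<in> carrier V" "w \<in> carrier V" "l \<in> carrier L"
        | (2) v k l where "x = frag_of (v, k \<oplus>\<^bsub>L\<^esub> l) - frag_of (v, k) - frag_of (v, l)"
          "v \<in> carrier V" "k \<in> carrier L" "l \<in> carrier L"
        | (3) v s l where "x = frag_of (v \<triangleleft>\<^bsub>V\<^esub> s, l) - frag_of (v, s \<triangleright>\<^bsub>L\<^esub> l)"
          "v \<in> carrier V" "s \<in> carrier S" "l \<in> carrier L"
        using x unfolding tensor_relators_def by blast
      then show "y \<in> tensor_relators S V L"
      proof cases
        case 1
        then have "y = frag_of (v \<oplus>\<^bsub>V\<^esub> w, l \<triangleleft>\<^bsub>L\<^esub> r) - frag_of (v, l \<triangleleft>\<^bsub>L\<^esub> r) - frag_of (w, l \<triangleleft>\<^bsub>L\<^esub> r)"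
          by (simp add: y frag_extend_diff)
        then show ?thesis
          using 1 L.ract_closed[of l r] r unfolding tensor_relators_def by blast
      next
        case 2
        then have "y = frag_of (v, k \<triangleleft>\<^bsub>L\<^esub> r \<oplus>\<^bsub>L\<^esub> l \<triangleleft>\<^bsub>L\<^esub> r) - frag_of (v, k \<triangleleft>\<^bsub>L\<^esub> r) - frag_of (v, l \<triangleleft>\<^bsub>L\<^esub> r)"
          using r by (simp add: y frag_extend_diff L.ract_add_left)
        then show ?thesis
          using 2 L.ract_closed[of l r] L.ract_closed[of k r] r unfolding tensor_relators_def by blast
      next
        case 3
        then have "y = frag_of (v \<triangleleft>\<^bsub>V\<^esub> s, l \<triangleleft>\<^bsub>L\<^esub> r) - frag_of (v, s \<triangleright>\<^bsub>L\<^esub> (l \<triangleleft>\<^bsub>L\<^esub> r))"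
          using r right_module_homD(3)[OF lact_hom] by (simp add: y frag_extend_diff)
        then show ?thesis
          using 3 L.ract_closed[of l r] r unfolding tensor_relators_def by blast
      qed
    qed
    then show ?thesis
      unfolding tensor_kernel_def by (intro F.mono_generate)
  qed
  finally show ?thesis .
qed

lemma ract_P: "c \<in> carrier F \<Longrightarrow> r \<in> carrier R \<Longrightarrow> (N #>\<^bsub>F\<^esub> c) \<triangleleft>\<^bsub>P\<^esub> r = N #>\<^bsub>F\<^esub> E r c"
  using F.coset_image_well_defined[OF subgroup_N E_hom E_N]
  by (simp add: tensor_product_def Let_def)

lemma tensor_ract [simp]:
  assumes "v \<in> carrier V" "l \<in> carrier L" "r \<in> carrier R"
  shows "(v \<otimes>\<otimes> l) \<triangleleft>\<^bsub>P\<^esub> r = v \<otimes>\<otimes> (l \<triangleleft>\<^bsub>L\<^esub> r)"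
  using assms by (simp add: tensor_def ract_P frag_of_F)

lemma right_module_P: "right_module R P"
proof -
  have closed: "x \<triangleleft>\<^bsub>P\<^esub> r \<in> carrier P" if "x \<in> carrier P" "r \<in> carrier R" for x r
    using that hom_in_carrier[OF E_hom] by (auto simp: carrier_P ract_P)
  have add: "(x \<oplus>\<^bsub>P\<^esub> y) \<triangleleft>\<^bsub>P\<^esub> r = x \<triangleleft>\<^bsub>P\<^esub> r \<oplus>\<^bsub>P\<^esub> y \<triangleleft>\<^bsub>P\<^esub> r"
    if "x \<in> carrier P" "y \<in> carrier P" "r \<in> carrier R" for x y r
    using that hom_in_carrier[OF E_hom]
    by (auto simp: carrier_P ract_P add_P add_F frag_extend_add)
  have zero: "\<zero>\<^bsub>P\<^esub> \<triangleleft>\<^bsub>P\<^esub> r = \<zero>\<^bsub>P\<^esub>" if "r \<in> carrier R" for r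
    using that ract_P[of 0 r] by (simp add: carrier_F zero_P)
  show ?thesis
  proof (rule right_moduleI[OF L.R.ring_axioms abelian_group_P closed add])
    fix x a b assume x: "x \<in> carrier P" and ab: "a \<in> carrier R" "b \<in> carrier R"
    show "x \<triangleleft>\<^bsub>P\<^esub> (a \<oplus>\<^bsub>R\<^esub> b) = x \<triangleleft>\<^bsub>P\<^esub> a \<oplus>\<^bsub>P\<^esub> x \<triangleleft>\<^bsub>P\<^esub> b"
      using x
    proof (induction x rule: tensor_induct)
      case (add x y)
      then show ?case
        using ab by (simp add: \<open>\<And>x y r. _ \<Longrightarrow> _ \<Longrightarrow> _ \<Longrightarrow> (x \<oplus>\<^bsub>P\<^esub> y) \<triangleleft>\<^bsub>P\<^esub> r = _\<close> closed P.a_ac)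
    qed (use ab in \<open>auto simp: zero L.ract_closed L.ract_add_right tensor_add_right\<close>)
    show "x \<triangleleft>\<^bsub>P\<^esub> (a \<otimes>\<^bsub>R\<^esub> b) = x \<triangleleft>\<^bsub>P\<^esub> a \<triangleleft>\<^bsub>P\<^esub> b"
      using x
    proof (induction x rule: tensor_induct)
      case (add x y)
      then show ?case
        using ab by (simp add: \<open>\<And>x y r. _ \<Longrightarrow> _ \<Longrightarrow> _ \<Longrightarrow> (x \<oplus>\<^bsub>P\<^esub> y) \<triangleleft>\<^bsub>P\<^esub> r = _\<close> closed P.a_ac)
    qed (use ab in \<open>auto simp: zero L.ract_closed L.ract_mult\<close>)
  next
    fix x assume x: "x \<in> carrier P"
    then show "x \<triangleleft>\<^bsub>P\<^esub> \<one>\<^bsub>R\<^esub> = x"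
    proof (induction x rule: tensor_induct)
      case (add x y)
      then show ?case
        by (simp add: \<open>\<And>x y r. _ \<Longrightarrow> _ \<Longrightarrow> _ \<Longrightarrow> (x \<oplus>\<^bsub>P\<^esub> y) \<triangleleft>\<^bsub>P\<^esub> r = _\<close>)
    qed (auto simp: zero L.ract_one)
  qed
qed

text \<open>The homomorphism on the free group that extends \<open>f\<close> kills the relators, so it is constant on
  cosets; its value is the common value that \<^const>\<open>tensor_lift\<close> picks by definite description.\<close>

lemma tensor_lift:
  assumes W: "abelian_group W"
    and closed: "\<And>v l. \<lbrakk>v \<in> carrier V; l \<in> carrier L\<rbrakk> \<Longrightarrow> f v l \<in> carrier W"
    and add_left: "\<And>v w l. \<lbrakk>v \<in> carrier V; w \<in> carrier V; l \<in> carrier L\<rbrakk>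
          \<Longrightarrow> f (v \<oplus>\<^bsub>V\<^esub> w) l = f v l \<oplus>\<^bsub>W\<^esub> f w l"
    and add_right: "\<And>v k l. \<lbrakk>v \<in> carrier V; k \<in> carrier L; l \<in> carrier L\<rbrakk>
          \<Longrightarrow> f v (k \<oplus>\<^bsub>L\<^esub> l) = f v k \<oplus>\<^bsub>W\<^esub> f v l"
    and balanced: "\<And>v s l. \<lbrakk>v \<in> carrier V; s \<in> carrier S; l \<in> carrier L\<rbrakk>
          \<Longrightarrow> f (v \<triangleleft>\<^bsub>V\<^esub> s) l = f v (s \<triangleright>\<^bsub>L\<^esub> l)"
  shows "abelian_group_hom P W (tensor_lift W f)"
    and "\<And>v l. \<lbrakk>v \<in> carrier V; l \<in> carrier L\<rbrakk> \<Longrightarrow> tensor_lift W f (v \<otimes>\<otimes> l) = f v l"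
proof -
  interpret W: abelian_group W by fact
  obtain h where h: "h \<in> hom F (add_monoid W)"
    and hf: "\<And>p. p \<in> carrier V \<times> carrier L \<Longrightarrow> h (frag_of p) = (case p of (v, l) \<Rightarrow> f v l)"
  proof (rule comm_group.free_Abelian_group_universal[OF W.a_comm_group,
        of "\<lambda>(v, l). f v l" "carrier V \<times> carrier L"])
    show "(\<lambda>(v, l). f v l) ` (carrier V \<times> carrier L) \<subseteq> carrier (add_monoid W)"
      using closed by auto
  qed (auto simp: tensor_free_def)
  interpret h: group_hom F "add_monoid W" h
    by (intro group_hom.intro group_hom_axioms.intro h F.group_axioms W.a_group)
  have hadd: "h (c + d) = h c \<oplus>\<^bsub>W\<^esub> h d" if "c \<in> carrier F" "d \<in> carrier F" for c d
    using h.hom_mult[OF that] by (simp add: mult_F)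
  have hcl: "h c \<in> carrier W" if "c \<in> carrier F" for c
    using h.hom_closed[OF that] by simp
  have hdiff: "h (c - d) = h c \<ominus>\<^bsub>W\<^esub> h d" if "c \<in> carrier F" "d \<in> carrier F" for c d
  proof -
    have "h (- d) = \<ominus>\<^bsub>W\<^esub> h d"
      using h.hom_inv[OF that(2)] inv_F[OF that(2)] by (simp add: a_inv_def)
    then show ?thesis
      using hadd[of c "- d"] that by (simp add: neg_F W.minus_eq)
  qed
  have hfrag: "h (frag_of (v, l)) = f v l" if "v \<in> carrier V" "l \<in> carrier L" for v l
    using hf[of "(v, l)"] that by simp
  have cancel: "x \<oplus>\<^bsub>W\<^esub> (y \<oplus>\<^bsub>W\<^esub> (\<ominus>\<^bsub>W\<^esub> x \<oplus>\<^bsub>W\<^esub> \<ominus>\<^bsub>W\<^esub> y)) = \<zero>\<^bsub>W\<^esub>"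
    if "x \<in> carrier W" "y \<in> carrier W" for x y
    using that W.r_neg[of "x \<oplus>\<^bsub>W\<^esub> y"] by (simp add: W.minus_add W.a_assoc)
  have "tensor_relators S V L \<subseteq> kernel F (add_monoid W) h"
  proof
    fix x assume x: "x \<in> tensor_relators S V L"
    have "h x = \<zero>\<^bsub>W\<^esub>"
      using x unfolding tensor_relators_def
      by (auto simp: hdiff hfrag frag_of_F diff_F V.ract_closed lact_closed closed add_left add_right
          balanced W.minus_eq W.a_assoc W.r_neg cancel)
    then show "x \<in> kernel F (add_monoid W) h"
      using x relators_subset by (auto simp: kernel_def)
  qed
  then have "N \<subseteq> kernel F (add_monoid W) h"
    unfolding tensor_kernel_def by (rule F.generate_subgroup_incl[OF _ h.subgroup_kernel])
  then have hN: "h n = \<zero>\<^bsub>W\<^esub>" if "n \<in> N" for n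
    using that by (auto simp: kernel_def)
  have lift: "tensor_lift W f (N #>\<^bsub>F\<^esub> c) = h c" if c: "c \<in> carrier F" for c
    unfolding tensor_lift_def
  proof (rule the_equality)
    have sum: "h d = (\<Oplus>\<^bsub>W\<^esub>p\<in>Poly_Mapping.keys d. [poly_mapping.lookup d p] \<cdot>\<^bsub>W\<^esub> (case p of (v, l) \<Rightarrow> f v l))"
      if d: "d \<in> carrier F" for d
    proof -
      have pc: "p \<in> carrier V \<times> carrier L" if "p \<in> Poly_Mapping.keys d" for p
        using that d carrier_F by blast
      have "h d = finprod (add_monoid W) (\<lambda>p. pow (add_monoid W) (h (frag_of p)) (poly_mapping.lookup d p)) (Poly_Mapping.keys d)"
        using comm_group.hom_free_Abelian_group_expansion[OF W.a_comm_group, of h "carrier V \<times> carrier L" d] h d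
        by (simp add: tensor_free_def)
      also have "\<dots> = (\<Oplus>\<^bsub>W\<^esub>p\<in>Poly_Mapping.keys d. [poly_mapping.lookup d p] \<cdot>\<^bsub>W\<^esub> h (frag_of p))"
        by (simp add: finsum_def add_pow_def)
      also have "\<dots> = (\<Oplus>\<^bsub>W\<^esub>p\<in>Poly_Mapping.keys d. [poly_mapping.lookup d p] \<cdot>\<^bsub>W\<^esub> (case p of (v, l) \<Rightarrow> f v l))"
      proof (rule W.finsum_cong')
        show "(\<lambda>p. [poly_mapping.lookup d p] \<cdot>\<^bsub>W\<^esub> (case p of (v, l) \<Rightarrow> f v l)) \<in> Poly_Mapping.keys d \<rightarrow> carrier W"
          using pc closed by (auto intro!: W.add.int_pow_closed)
      qed (simp_all add: hf[OF pc])
      finally show ?thesis .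
    qed
    have eq: "h d = h c" and mem: "d \<in> carrier F" if dc: "d \<in> N #>\<^bsub>F\<^esub> c" for d
    proof -
      obtain n where n: "n \<in> N" "d = n + c"
        using dc by (auto simp: r_coset_def mult_F)
      have "n \<in> carrier F"
        using n N.subset by auto
      then show "h d = h c" "d \<in> carrier F"
        using n c hN hadd hcl[OF c] by (auto simp: add_F)
    qed
    show "\<forall>d\<in>N #>\<^bsub>F\<^esub> c. h c =
        (\<Oplus>\<^bsub>W\<^esub>p\<in>Poly_Mapping.keys d. [poly_mapping.lookup d p] \<cdot>\<^bsub>W\<^esub> (case p of (v, l) \<Rightarrow> f v l))"
      using sum eq mem by metis
    show "w = h c" if "\<forall>d\<in>N #>\<^bsub>F\<^esub> c. w =
        (\<Oplus>\<^bsub>W\<^esub>p\<in>Poly_Mapping.keys d. [poly_mapping.lookup d p] \<cdot>\<^bsub>W\<^esub> (case p of (v, l) \<Rightarrow> f v l))" for w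
      using that sum[OF c] F.rcos_self[OF c subgroup_N] by simp
  qed
  show "abelian_group_hom P W (tensor_lift W f)"
    by (rule abelian_group_hom_additiveI[OF abelian_group_P W]) (auto simp: carrier_P lift hcl add_P add_F hadd)
  show "tensor_lift W f (v \<otimes>\<otimes> l) = f v l" if "v \<in> carrier V" "l \<in> carrier L" for v l
    using that by (simp add: tensor_def lift frag_of_F hfrag)
qed

lemma tensor_lift_hom:
  assumes W: "right_module R W"
    and closed: "\<And>v l. \<lbrakk>v \<in> carrier V; l \<in> carrier L\<rbrakk> \<Longrightarrow> f v l \<in> carrier W"
    and add_left: "\<And>v w l. \<lbrakk>v \<in> carrier V; w \<in> carrier V; l \<in> carrier L\<rbrakk>
          \<Longrightarrow> f (v \<oplus>\<^bsub>V\<^esub> w) l = f v l \<oplus>\<^bsub>W\<^esub> f w l"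
    and linear: "\<And>v. v \<in> carrier V \<Longrightarrow> f v \<in> right_module_hom R L W"
    and balanced: "\<And>v s l. \<lbrakk>v \<in> carrier V; s \<in> carrier S; l \<in> carrier L\<rbrakk>
          \<Longrightarrow> f (v \<triangleleft>\<^bsub>V\<^esub> s) l = f v (s \<triangleright>\<^bsub>L\<^esub> l)"
  shows "tensor_lift W f \<in> right_module_hom R P W"
    and "\<And>v l. \<lbrakk>v \<in> carrier V; l \<in> carrier L\<rbrakk> \<Longrightarrow> tensor_lift W f (v \<otimes>\<otimes> l) = f v l"
proof -
  interpret W: right_module R W by fact
  interpret P: right_module R P by (rule right_module_P)
  note lin = right_module_homD[OF linear]
  note lift = tensor_lift[of W f, OF W.V.abelian_group_axioms closed add_left lin(2) balanced]
  interpret h: abelian_group_hom P W "tensor_lift W f"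
    by (rule lift(1))
  show tens: "tensor_lift W f (v \<otimes>\<otimes> l) = f v l" if "v \<in> carrier V" "l \<in> carrier L" for v l
    using lift(2) that by blast
  show "tensor_lift W f \<in> right_module_hom R P W"
  proof (rule right_module_homI)
    fix x r assume "x \<in> carrier P" and r: "r \<in> carrier R"
    then show "tensor_lift W f (x \<triangleleft>\<^bsub>P\<^esub> r) = tensor_lift W f x \<triangleleft>\<^bsub>W\<^esub> r"
    proof (induction x rule: tensor_induct)
      case (add x y)
      then show ?case
        using r by (simp add: P.ract_add_left P.ract_closed W.ract_add_left)
    qed (use r in \<open>auto simp: tens L.ract_closed lin(3)\<close>)
  qed auto
qed

end


section \<open>Monoid algebras\<close>

lemma lin_span_0 [simp]: "0 \<in> lin_span A"
  by (simp add: lin_span_def)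

lemma lin_span_single: "x \<in> A \<Longrightarrow> Poly_Mapping.single x c \<in> lin_span A"
  by (auto simp: lin_span_def)

lemma lin_span_add: "f \<in> lin_span A \<Longrightarrow> g \<in> lin_span A \<Longrightarrow> f + g \<in> lin_span A"
  for f g :: "'x \<Rightarrow>\<^sub>0 'k::monoid_add"
  using Poly_Mapping.keys_add[of f g] by (auto simp: lin_span_def)

lemma lin_span_induct [consumes 1, case_names zero single add]:
  assumes f: "f \<in> lin_span A" and zero: "Q 0" and single: "\<And>x c. x \<in> A \<Longrightarrow> Q (Poly_Mapping.single x c)"
    and add: "\<And>f g. \<lbrakk>f \<in> lin_span A; g \<in> lin_span A; Q f; Q g\<rbrakk> \<Longrightarrow> Q (f + g)"
  shows "Q (f :: 'x \<Rightarrow>\<^sub>0 'k::comm_monoid_add)"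
proof -
  have expand: "f = (\<Sum>x\<in>Poly_Mapping.keys f. Poly_Mapping.single x (poly_mapping.lookup f x))"
    by (rule poly_mapping_eqI)
       (auto simp: Poly_Mapping.lookup_sum lookup_single when_def in_keys_iff sum.delta)
  have "(\<Sum>x\<in>B. Poly_Mapping.single x (poly_mapping.lookup f x)) \<in> lin_span A \<and>
      Q (\<Sum>x\<in>B. Poly_Mapping.single x (poly_mapping.lookup f x))" if "finite B" "B \<subseteq> A" for B
    using that
  proof (induction B rule: finite_induct)
    case (insert x B)
    have "Poly_Mapping.single x (poly_mapping.lookup f x) \<in> lin_span A"
      using insert by (intro lin_span_single) auto
    then show ?case
      using insert single add by (simp add: lin_span_add)
  qed (auto simp: zero lin_span_def)
  from this[of "Poly_Mapping.keys f"] show ?thesis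
    using f expand by (simp add: lin_span_def)
qed

lemma lin_span_uminus: "f \<in> lin_span A \<Longrightarrow> - f \<in> lin_span A"
  for f :: "'x \<Rightarrow>\<^sub>0 'k::ab_group_add"
  by (auto simp: lin_span_def in_keys_iff)

text \<open>The multiplication of a monoid algebra and its action on the permutation-like module are both of
  this form, which allows their axioms to be derived from the same lemmas.\<close>

definition bilinear_extension ::
    "('x \<Rightarrow> 'y \<Rightarrow> 'z) \<Rightarrow> ('x \<Rightarrow>\<^sub>0 'k) \<Rightarrow> ('y \<Rightarrow>\<^sub>0 'k) \<Rightarrow> ('z \<Rightarrow>\<^sub>0 'k::comm_ring)"
  where "bilinear_extension op f g = (\<Sum>x\<in>Poly_Mapping.keys f. \<Sum>y\<in>Poly_Mapping.keys g.
    Poly_Mapping.single (op x y) (poly_mapping.lookup f x * poly_mapping.lookup g y))"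

lemma bilinear_extension_eq_sum:
  assumes "finite A" "Poly_Mapping.keys f \<subseteq> A" "finite B" "Poly_Mapping.keys g \<subseteq> B"
  shows "bilinear_extension op f g = (\<Sum>x\<in>A. \<Sum>y\<in>B.
    Poly_Mapping.single (op x y) (poly_mapping.lookup f x * poly_mapping.lookup g y))"
proof -
  have "(\<Sum>y\<in>Poly_Mapping.keys g.
      Poly_Mapping.single (op x y) (poly_mapping.lookup f x * poly_mapping.lookup g y)) =
      (\<Sum>y\<in>B. Poly_Mapping.single (op x y) (poly_mapping.lookup f x * poly_mapping.lookup g y))" for x
    by (rule sum.mono_neutral_left) (use assms in \<open>auto simp: in_keys_iff\<close>)
  moreover have "(\<Sum>x\<in>Poly_Mapping.keys f. \<Sum>y\<in>B.
      Poly_Mapping.single (op x y) (poly_mapping.lookup f x * poly_mapping.lookup g y)) =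
      (\<Sum>x\<in>A. \<Sum>y\<in>B. Poly_Mapping.single (op x y) (poly_mapping.lookup f x * poly_mapping.lookup g y))"
    by (rule sum.mono_neutral_left) (use assms in \<open>auto simp: in_keys_iff\<close>)
  ultimately show ?thesis
    by (simp add: bilinear_extension_def)
qed

lemma bilinear_extension_add_left:
  "bilinear_extension op (f + g) h = bilinear_extension op f h + bilinear_extension op g h"
proof -
  let ?A = "Poly_Mapping.keys f \<union> Poly_Mapping.keys g"
  have "Poly_Mapping.keys (f + g) \<subseteq> ?A"
    by (rule Poly_Mapping.keys_add)
  then show ?thesis
    by (simp add: bilinear_extension_eq_sum[of ?A _ "Poly_Mapping.keys h"] lookup_add
        distrib_right single_add sum.distrib)
qed

lemma bilinear_extension_add_right:
  "bilinear_extension op h (f + g) = bilinear_extension op h f + bilinear_extension op h g"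
proof -
  let ?A = "Poly_Mapping.keys f \<union> Poly_Mapping.keys g"
  have "Poly_Mapping.keys (f + g) \<subseteq> ?A"
    by (rule Poly_Mapping.keys_add)
  then show ?thesis
    by (simp add: bilinear_extension_eq_sum[of "Poly_Mapping.keys h" _ ?A] lookup_add
        distrib_left single_add sum.distrib)
qed

lemma bilinear_extension_zero_left [simp]: "bilinear_extension op 0 f = 0"
  and bilinear_extension_zero_right [simp]: "bilinear_extension op g 0 = 0"
  by (simp_all add: bilinear_extension_def)

lemma bilinear_extension_single [simp]:
  "bilinear_extension op (Poly_Mapping.single x a) (Poly_Mapping.single y b) =
    Poly_Mapping.single (op x y) (a * b)"
  by (simp add: bilinear_extension_eq_sum[of "{x}" _ "{y}"])

lemma bilinear_extension_closed:
  assumes "f \<in> lin_span A" "g \<in> lin_span B" "\<And>x y. x \<in> A \<Longrightarrow> y \<in> B \<Longrightarrow> op x y \<in> C"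
  shows "bilinear_extension op f g \<in> lin_span C"
  using assms(1)
proof (induction f rule: lin_span_induct)
  case (single x c)
  show ?case
    using assms(2)
  proof (induction g rule: lin_span_induct)
    case (add f g)
    then show ?case
      by (simp add: bilinear_extension_add_right lin_span_add)
  qed (use single assms(3) in \<open>auto intro: lin_span_single\<close>)
qed (auto simp: bilinear_extension_add_left lin_span_add)

lemma bilinear_extension_assoc:
  assumes "f \<in> lin_span A" "g \<in> lin_span B" "h \<in> lin_span C"
    and op: "\<And>x y z. \<lbrakk>x \<in> A; y \<in> B; z \<in> C\<rbrakk> \<Longrightarrow> op1 (op2 x y) z = op3 x (op4 y z)"
  shows "bilinear_extension op1 (bilinear_extension op2 f g) h =
    bilinear_extension op3 f (bilinear_extension op4 g h)"
  using assms(1)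
proof (induction f rule: lin_span_induct)
  case (single x a)
  show ?case
    using assms(2)
  proof (induction g rule: lin_span_induct)
    case (single y b)
    show ?case
      using assms(3)
    proof (induction h rule: lin_span_induct)
      case (single z c)
      then show ?case
        using \<open>x \<in> A\<close> \<open>y \<in> B\<close> op by (simp add: mult.assoc)
    qed (auto simp: bilinear_extension_add_right)
  qed (auto simp: bilinear_extension_add_left bilinear_extension_add_right)
qed (auto simp: bilinear_extension_add_left)

lemma bilinear_extension_single_left_id:
  assumes "f \<in> lin_span A" "\<And>x. x \<in> A \<Longrightarrow> op u x = x"
  shows "bilinear_extension op (Poly_Mapping.single u 1) f = (f :: _ \<Rightarrow>\<^sub>0 'k::comm_ring_1)"
  using assms(1)
  by (induction f rule: lin_span_induct) (auto simp: assms(2) bilinear_extension_add_right)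

lemma bilinear_extension_single_right_id:
  assumes "f \<in> lin_span A" "\<And>x. x \<in> A \<Longrightarrow> op x u = x"
  shows "bilinear_extension op f (Poly_Mapping.single u 1) = (f :: _ \<Rightarrow>\<^sub>0 'k::comm_ring_1)"
  using assms(1)
  by (induction f rule: lin_span_induct) (auto simp: assms(2) bilinear_extension_add_left)

lemma carrier_monoid_algebra: "carrier (monoid_algebra G) = lin_span (carrier G)"
  and mult_monoid_algebra: "monoid.mult (monoid_algebra G) = bilinear_extension (monoid.mult G)"
  and one_monoid_algebra: "\<one>\<^bsub>monoid_algebra G\<^esub> = Poly_Mapping.single \<one>\<^bsub>G\<^esub> 1"
  and zero_monoid_algebra: "\<zero>\<^bsub>monoid_algebra G\<^esub> = 0"
  and add_monoid_algebra: "add (monoid_algebra G) = (+)"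
  by (auto simp: monoid_algebra_def bilinear_extension_def fun_eq_iff)

lemmas monoid_algebra_simps =
  carrier_monoid_algebra mult_monoid_algebra one_monoid_algebra zero_monoid_algebra add_monoid_algebra

lemma abelian_group_lin_span:
  assumes "carrier V = lin_span A" "add V = (+)" "\<zero>\<^bsub>V\<^esub> = (0 :: 'x \<Rightarrow>\<^sub>0 'k::ab_group_add)"
  shows "abelian_group V"
proof (rule abelian_groupI)
  show "\<exists>y\<in>carrier V. y \<oplus>\<^bsub>V\<^esub> x = \<zero>\<^bsub>V\<^esub>" if "x \<in> carrier V" for x
    using that lin_span_uminus[of x A] by (auto simp: assms intro!: bexI[of _ "- x"])
qed (auto simp: assms lin_span_add add_ac)

lemma ring_monoid_algebra:
  assumes "monoid G"
  shows "ring (monoid_algebra G :: ('g \<Rightarrow>\<^sub>0 'k::field) ring)"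
proof -
  interpret monoid G by fact
  let ?A = "monoid_algebra G :: ('g \<Rightarrow>\<^sub>0 'k) ring"
  have "abelian_group ?A"
    by (rule abelian_group_lin_span) (auto simp: monoid_algebra_simps)
  moreover have "monoid ?A"
  proof (rule monoidI)
    fix f g h :: "'g \<Rightarrow>\<^sub>0 'k"
    assume fgh: "f \<in> carrier ?A" "g \<in> carrier ?A" "h \<in> carrier ?A"
    show "f \<otimes>\<^bsub>?A\<^esub> g \<in> carrier ?A"
      using fgh(1,2) unfolding monoid_algebra_simps by (rule bilinear_extension_closed) auto
    show "f \<otimes>\<^bsub>?A\<^esub> g \<otimes>\<^bsub>?A\<^esub> h = f \<otimes>\<^bsub>?A\<^esub> (g \<otimes>\<^bsub>?A\<^esub> h)"
      using fgh unfolding monoid_algebra_simps by (rule bilinear_extension_assoc) (auto simp: m_assoc)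
  next
    fix f :: "'g \<Rightarrow>\<^sub>0 'k" assume f: "f \<in> carrier ?A"
    show "\<one>\<^bsub>?A\<^esub> \<otimes>\<^bsub>?A\<^esub> f = f"
      using f unfolding monoid_algebra_simps by (rule bilinear_extension_single_left_id) auto
    show "f \<otimes>\<^bsub>?A\<^esub> \<one>\<^bsub>?A\<^esub> = f"
      using f unfolding monoid_algebra_simps by (rule bilinear_extension_single_right_id) auto
  qed (auto simp: monoid_algebra_simps lin_span_single)
  ultimately show ?thesis
    by (intro ringI) (auto simp: monoid_algebra_simps bilinear_extension_add_left
        bilinear_extension_add_right abelian_group.axioms)
qed

lemma monoid_transformation_monoid:
  assumes "submonoid M full_transformation_monoid"
  shows "monoid (transformation_monoid M)"
  using assms
  by (auto simp: submonoid_def full_transformation_monoid_def transformation_monoid_def intro!: monoidI)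

lemma transformation_monoid_simps:
  "carrier (transformation_monoid M) = M"
  "m \<otimes>\<^bsub>transformation_monoid M\<^esub> n = n \<circ> m"
  "\<one>\<^bsub>transformation_monoid M\<^esub> = id"
  by (auto simp: transformation_monoid_def full_transformation_monoid_def)

lemma transformation_module_simps:
  "carrier transformation_module = UNIV"
  "\<zero>\<^bsub>transformation_module\<^esub> = 0"
  "add transformation_module = (+)"
  "ract transformation_module = bilinear_extension (\<lambda>\<alpha> m. m \<alpha>)"
  by (auto simp: transformation_module_def bilinear_extension_def fun_eq_iff)

lemma right_module_transformation_module:
  assumes "submonoid M full_transformation_monoid"
  shows "right_module (monoid_algebra (transformation_monoid M))
    (transformation_module :: ('w \<Rightarrow>\<^sub>0 'k::field, ('w \<Rightarrow> 'w) \<Rightarrow>\<^sub>0 'k) right_mod)"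
proof (rule right_moduleI)
  have UNIV: "v \<in> lin_span UNIV" for v :: "'w \<Rightarrow>\<^sub>0 'k"
    by (simp add: lin_span_def)
  show "ring (monoid_algebra (transformation_monoid M) :: (('w \<Rightarrow> 'w) \<Rightarrow>\<^sub>0 'k) ring)"
    by (intro ring_monoid_algebra monoid_transformation_monoid assms)
  show "abelian_group (transformation_module :: ('w \<Rightarrow>\<^sub>0 'k, ('w \<Rightarrow> 'w) \<Rightarrow>\<^sub>0 'k) right_mod)"
    by (rule abelian_group_lin_span[of _ UNIV]) (auto simp: transformation_module_simps UNIV)
  show "v \<triangleleft>\<^bsub>transformation_module\<^esub> (a \<otimes>\<^bsub>monoid_algebra (transformation_monoid M)\<^esub> b) =
      v \<triangleleft>\<^bsub>transformation_module\<^esub> a \<triangleleft>\<^bsub>transformation_module\<^esub> b"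
    for v :: "'w \<Rightarrow>\<^sub>0 'k" and a b
    unfolding transformation_module_simps monoid_algebra_simps
    by (rule bilinear_extension_assoc[symmetric, of _ UNIV _ UNIV _ UNIV])
       (auto simp: lin_span_def transformation_monoid_simps)
  show "v \<triangleleft>\<^bsub>transformation_module\<^esub> \<one>\<^bsub>monoid_algebra (transformation_monoid M)\<^esub> = v"
    for v :: "'w \<Rightarrow>\<^sub>0 'k"
    unfolding transformation_module_simps monoid_algebra_simps
    by (rule bilinear_extension_single_right_id[OF UNIV]) (simp add: transformation_monoid_simps)
qed (auto simp: transformation_module_simps monoid_algebra_simps bilinear_extension_add_left
      bilinear_extension_add_right)


section \<open>The corner of an idempotent\<close>

text \<open>If \<open>ay = 1\<close>, then left multiplication by \<open>y\<close> is injective, hence surjective, and \<open>yt = 1\<close> for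
  some \<open>t\<close>; then \<open>t = (ay)t = a\<close>.\<close>

lemma (in monoid) finite_one_sided_inverse:
  assumes fin: "finite (carrier G)" and a: "a \<in> carrier G" and y: "y \<in> carrier G" and "a \<otimes> y = \<one>"
  shows "y \<otimes> a = \<one>"
proof -
  have "inj_on (\<lambda>t. y \<otimes> t) (carrier G)"
  proof (rule inj_onI)
    fix s t assume "s \<in> carrier G" "t \<in> carrier G" "y \<otimes> s = y \<otimes> t"
    then show "s = t"
      using assms by (metis m_assoc l_one)
  qed
  then have "(\<lambda>t. y \<otimes> t) ` carrier G = carrier G"
    using y by (intro endo_inj_surj fin) auto
  then obtain t where t: "t \<in> carrier G" "y \<otimes> t = \<one>"
    using one_closed by (metis imageE)
  have "t = a \<otimes> y \<otimes> t"
    using assms t by simp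
  also have "\<dots> = a"
    using a y t by (simp add: m_assoc)
  finally show ?thesis
    using t by simp
qed

lemma (in monoid) finite_middle_factor_of_one_unit:
  assumes fin: "finite (carrier G)"
    and carr: "a \<in> carrier G" "x \<in> carrier G" "b \<in> carrier G" and axb: "a \<otimes> x \<otimes> b = \<one>"
  shows "x \<in> Units G"
proof -
  have "(x \<otimes> b) \<otimes> a = \<one>"
    using carr axb by (intro finite_one_sided_inverse[OF fin, of a]) (simp_all add: m_assoc)
  then have "x \<otimes> (b \<otimes> a) = \<one>"
    using carr by (simp add: m_assoc)
  moreover from this have "(b \<otimes> a) \<otimes> x = \<one>"
    using carr by (intro finite_one_sided_inverse[OF fin, of x]) simp_all
  ultimately show ?thesis
    using carr unfolding Units_def by blast
qed

text \<open>The parameter \<open>K\<close> only fixes the type of the coefficient field.\<close>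

locale monoid_idempotent = monoid G for G :: "'g monoid" (structure) +
  fixes e :: 'g and K :: "'k::field itself"
  assumes finite_G: "finite (carrier G)" and e_closed [simp]: "e \<in> carrier G"
    and e_idem [simp]: "e \<otimes> e = e"
begin

abbreviation A :: "('g \<Rightarrow>\<^sub>0 'k) ring" where "A \<equiv> monoid_algebra G"
abbreviation H :: "'g monoid" where "H \<equiv> maximal_subgroup G e"
abbreviation KH :: "('g \<Rightarrow>\<^sub>0 'k) ring" where "KH \<equiv> monoid_algebra H"
abbreviation J :: "('g \<Rightarrow>\<^sub>0 'k) set" where "J \<equiv> lin_span (ideal_avoiding G e)"
abbreviation \<epsilon> :: "'g \<Rightarrow>\<^sub>0 'k" where "\<epsilon> \<equiv> Poly_Mapping.single e 1"
abbreviation L :: "(('g \<Rightarrow>\<^sub>0 'k) set, 'g \<Rightarrow>\<^sub>0 'k, 'g \<Rightarrow>\<^sub>0 'k) bimod" where "L \<equiv> induction_bimodule G e"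
abbreviation cls :: "('g \<Rightarrow>\<^sub>0 'k) \<Rightarrow> ('g \<Rightarrow>\<^sub>0 'k) set" where "cls x \<equiv> J +>\<^bsub>A\<^esub> x"

sublocale A: ring A
  by (rule ring_monoid_algebra) (rule monoid_axioms)

lemma carrier_local_monoid:
  "x \<in> carrier (local_monoid G e) \<longleftrightarrow> x \<in> carrier G \<and> e \<otimes> x = x \<and> x \<otimes> e = x"
proof
  assume "x \<in> carrier (local_monoid G e)"
  then obtain m where m: "m \<in> carrier G" "x = e \<otimes> m \<otimes> e"
    by (auto simp: local_monoid_def)
  have "e \<otimes> (e \<otimes> y) = e \<otimes> y" if "y \<in> carrier G" for y
    using that by (simp add: m_assoc[symmetric])
  then show "x \<in> carrier G \<and> e \<otimes> x = x \<and> x \<otimes> e = x"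
    using m by (simp add: m_assoc)
next
  assume "x \<in> carrier G \<and> e \<otimes> x = x \<and> x \<otimes> e = x"
  then show "x \<in> carrier (local_monoid G e)"
    by (auto simp: local_monoid_def intro!: exI[of _ x])
qed

lemma local_monoid_simps: "monoid.mult (local_monoid G e) = monoid.mult G" "\<one>\<^bsub>local_monoid G e\<^esub> = e"
  by (auto simp: local_monoid_def)

lemma monoid_local_monoid: "monoid (local_monoid G e)"
proof (rule monoidI, unfold local_monoid_simps carrier_local_monoid)
  fix x y assume "x \<in> carrier G \<and> e \<otimes> x = x \<and> x \<otimes> e = x" "y \<in> carrier G \<and> e \<otimes> y = y \<and> y \<otimes> e = y"
  then show "x \<otimes> y \<in> carrier G \<and> e \<otimes> (x \<otimes> y) = x \<otimes> y \<and> x \<otimes> y \<otimes> e = x \<otimes> y"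
    by (metis m_assoc m_closed e_closed)
qed (auto simp: m_assoc)

lemma mult_H: "monoid.mult H = monoid.mult G" and one_H: "\<one>\<^bsub>H\<^esub> = e"
  by (auto simp: maximal_subgroup_def units_of_def local_monoid_simps)

lemma carrier_H: "carrier H = Units (local_monoid G e)"
  by (simp add: maximal_subgroup_def units_of_def)

sublocale H: group H
  unfolding maximal_subgroup_def by (rule monoid.units_group[OF monoid_local_monoid])

lemma H_D:
  assumes "g \<in> carrier H"
  shows "g \<in> carrier G" "e \<otimes> g = g" "g \<otimes> e = g"
  using assms carrier_local_monoid unfolding carrier_H Units_def by blast+

lemma finite_H: "finite (carrier H)"
  using finite_G H_D(1) by (meson finite_subset subsetI)

text \<open>If \<open>eme\<close> is outside \<open>I\<^sub>e\<close>, then \<open>e\<close> factors through it, and after multiplying the outer factors by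
  \<open>e\<close> on both sides this is a factorization of the identity in the finite monoid \<open>eMe\<close>, where the
  middle factor must be a unit.\<close>

lemma corner_unit_or_avoiding:
  assumes m: "m \<in> carrier G"
  shows "e \<otimes> m \<otimes> e \<in> carrier H \<or> e \<otimes> m \<otimes> e \<in> ideal_avoiding G e"
proof (rule disjCI)
  assume "e \<otimes> m \<otimes> e \<notin> ideal_avoiding G e"
  then obtain a b where ab: "a \<in> carrier G" "b \<in> carrier G" and eq: "e = a \<otimes> (e \<otimes> m \<otimes> e) \<otimes> b"
    using m by (auto simp: ideal_avoiding_def)
  interpret E: monoid "local_monoid G e" by (rule monoid_local_monoid)
  have ee: "e \<otimes> (e \<otimes> x) = e \<otimes> x" if "x \<in> carrier G" for x
    using that by (simp add: m_assoc[symmetric])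
  have carr: "e \<otimes> x \<otimes> e \<in> carrier (local_monoid G e)" if "x \<in> carrier G" for x
    using that by (auto simp: local_monoid_def)
  have "finite (carrier (local_monoid G e))"
    using finite_G carrier_local_monoid by (meson finite_subset subsetI)
  moreover have "(e \<otimes> a \<otimes> e) \<otimes> (e \<otimes> m \<otimes> e) \<otimes> (e \<otimes> b \<otimes> e) = e \<otimes> (a \<otimes> (e \<otimes> m \<otimes> e) \<otimes> b) \<otimes> e"
    using m ab by (simp add: m_assoc ee)
  then have "(e \<otimes> a \<otimes> e) \<otimes> (e \<otimes> m \<otimes> e) \<otimes> (e \<otimes> b \<otimes> e) = e"
    using eq by simp
  ultimately show "e \<otimes> m \<otimes> e \<in> carrier H"
    unfolding carrier_H using m ab
    by (intro E.finite_middle_factor_of_one_unit[of "e \<otimes> a \<otimes> e" _ "e \<otimes> b \<otimes> e"])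
       (auto simp: local_monoid_simps intro!: carr)
qed

lemma ideal_avoiding_absorbs:
  assumes x: "x \<in> ideal_avoiding G e" and m: "m \<in> carrier G"
  shows "m \<otimes> x \<in> ideal_avoiding G e" "x \<otimes> m \<in> ideal_avoiding G e"
proof -
  have xc: "x \<in> carrier G" and no: "\<And>a b. \<lbrakk>a \<in> carrier G; b \<in> carrier G\<rbrakk> \<Longrightarrow> e \<noteq> a \<otimes> x \<otimes> b"
    using x by (auto simp: ideal_avoiding_def)
  have "e \<noteq> a \<otimes> (m \<otimes> x) \<otimes> b" "e \<noteq> a \<otimes> (x \<otimes> m) \<otimes> b" if "a \<in> carrier G" "b \<in> carrier G" for a b
    using no[of "a \<otimes> m" b] no[of a "m \<otimes> b"] that xc m by (auto simp: m_assoc)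
  then show "m \<otimes> x \<in> ideal_avoiding G e" "x \<otimes> m \<in> ideal_avoiding G e"
    using xc m by (auto simp: ideal_avoiding_def)
qed

lemma J_subset: "J \<subseteq> carrier A"
  by (auto simp: monoid_algebra_simps lin_span_def ideal_avoiding_def)

lemma ideal_J: "ideal J A"
proof (rule idealI[OF A.ring_axioms])
  show "subgroup J (add_monoid A)"
  proof (rule A.add.subgroupI)
    show "J \<noteq> {}"
      using lin_span_0 by blast
    show "\<ominus>\<^bsub>A\<^esub> a \<in> J" if "a \<in> J" for a
    proof -
      have "\<ominus>\<^bsub>A\<^esub> a = - a"
        using that J_subset lin_span_uminus[OF that]
        by (intro A.minus_equality) (auto simp: monoid_algebra_simps)
      then show ?thesis
        using lin_span_uminus[OF that] by simp
    qed
  qed (use J_subset in \<open>auto simp: monoid_algebra_simps lin_span_add\<close>)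
next
  fix a x assume ax: "a \<in> J" "x \<in> carrier A"
  show "x \<otimes>\<^bsub>A\<^esub> a \<in> J"
    using ax(2,1) unfolding monoid_algebra_simps
    by (rule bilinear_extension_closed) (rule ideal_avoiding_absorbs)
  show "a \<otimes>\<^bsub>A\<^esub> x \<in> J"
    using ax unfolding monoid_algebra_simps
    by (rule bilinear_extension_closed) (rule ideal_avoiding_absorbs)
qed

sublocale J: ideal J A
  by (rule ideal_J)

lemma KH_subset: "s \<in> carrier KH \<Longrightarrow> s \<in> carrier A"
  using H_D(1) by (auto simp: monoid_algebra_simps lin_span_def)

lemma KH_ops: "monoid.mult KH = monoid.mult A" "add KH = add A" "\<one>\<^bsub>KH\<^esub> = \<epsilon>" "\<zero>\<^bsub>KH\<^esub> = \<zero>\<^bsub>A\<^esub>"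
  by (auto simp: monoid_algebra_simps mult_H one_H)

sublocale KH: ring KH
  by (rule ring_monoid_algebra) (rule H.monoid_axioms)

lemma \<epsilon>_KH [simp]: "\<epsilon> \<in> carrier KH"
  using KH.one_closed by (simp add: KH_ops)

lemma \<epsilon>_closed [simp]: "\<epsilon> \<in> carrier A"
  by (simp add: KH_subset)

lemma \<epsilon>_KH_mult: "s \<in> carrier KH \<Longrightarrow> \<epsilon> \<otimes>\<^bsub>A\<^esub> s = s" "s \<in> carrier KH \<Longrightarrow> s \<otimes>\<^bsub>A\<^esub> \<epsilon> = s"
  using KH.l_one KH.r_one by (auto simp: KH_ops)

lemma \<epsilon>_idem [simp]: "\<epsilon> \<otimes>\<^bsub>A\<^esub> \<epsilon> = \<epsilon>"
  by (simp add: \<epsilon>_KH_mult)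

lemma cls_add: "x \<in> carrier A \<Longrightarrow> y \<in> carrier A \<Longrightarrow> cls x \<oplus>\<^bsub>L\<^esub> cls y = cls (x \<oplus>\<^bsub>A\<^esub> y)"
  using J.a_rcos_sum by (simp add: induction_bimodule_def Let_def FactRing_def)

lemma cls_zero: "\<zero>\<^bsub>L\<^esub> = cls \<zero>\<^bsub>A\<^esub>"
  using J.a_subset by (simp add: induction_bimodule_def Let_def FactRing_def)

lemma cls_ract: "x \<in> carrier A \<Longrightarrow> a \<in> carrier A \<Longrightarrow> cls x \<triangleleft>\<^bsub>L\<^esub> a = cls (x \<otimes>\<^bsub>A\<^esub> a)"
  using J.rcoset_mult_add by (simp add: induction_bimodule_def Let_def FactRing_def)

lemma cls_lact: "x \<in> carrier A \<Longrightarrow> s \<in> carrier KH \<Longrightarrow> s \<triangleright>\<^bsub>L\<^esub> cls x = cls (s \<otimes>\<^bsub>A\<^esub> x)"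
  using J.rcoset_mult_add by (simp add: induction_bimodule_def Let_def FactRing_def KH_subset)

lemma carrier_L: "carrier L = {cls x |x. x \<in> carrier A \<and> \<epsilon> \<otimes>\<^bsub>A\<^esub> x = x}"
proof -
  have "carrier L = {cls (\<epsilon> \<otimes>\<^bsub>A\<^esub> x) |x. x \<in> carrier A}"
    using J.rcoset_mult_add[OF \<epsilon>_closed]
    by (force simp: induction_bimodule_def Let_def FactRing_def A_RCOSETS_def')
  also have "\<dots> = {cls x |x. x \<in> carrier A \<and> \<epsilon> \<otimes>\<^bsub>A\<^esub> x = x}"
  proof safe
    fix x assume "x \<in> carrier A"
    then show "\<exists>y. cls (\<epsilon> \<otimes>\<^bsub>A\<^esub> x) = cls y \<and> y \<in> carrier A \<and> \<epsilon> \<otimes>\<^bsub>A\<^esub> y = y"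
      by (intro exI[of _ "\<epsilon> \<otimes>\<^bsub>A\<^esub> x"]) (simp add: A.m_assoc[symmetric])
  next
    fix x assume "x \<in> carrier A" "\<epsilon> \<otimes>\<^bsub>A\<^esub> x = x"
    then show "\<exists>y. cls x = cls (\<epsilon> \<otimes>\<^bsub>A\<^esub> y) \<and> y \<in> carrier A"
      by (intro exI[of _ x]) simp
  qed
  finally show ?thesis .
qed

lemma cls_L: "x \<in> carrier A \<Longrightarrow> \<epsilon> \<otimes>\<^bsub>A\<^esub> x = x \<Longrightarrow> cls x \<in> carrier L"
  by (auto simp: carrier_L)

lemma cls_\<epsilon>_L [simp]: "cls \<epsilon> \<in> carrier L"
  by (simp add: cls_L)

lemma L_cases:
  assumes "l \<in> carrier L"
  obtains x where "x \<in> carrier A" "\<epsilon> \<otimes>\<^bsub>A\<^esub> x = x" "l = cls x"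
  using assms by (auto simp: carrier_L)

lemma cls_self: "x \<in> carrier A \<Longrightarrow> x \<in> cls x"
  by (rule J.a_rcos_self)

lemma cls_eqI: "x \<in> carrier A \<Longrightarrow> y \<in> cls x \<Longrightarrow> cls y = cls x"
  using J.a_repr_independence'[of y x] by simp

lemma L_mem:
  assumes "l \<in> carrier L" "y \<in> l"
  shows "y \<in> carrier A" "l = cls y"
proof -
  obtain x where x: "x \<in> carrier A" "l = cls x"
    using assms(1) by (rule L_cases)
  show "y \<in> carrier A"
    using x assms(2) J.a_elemrcos_carrier by blast
  show "l = cls y"
    using cls_eqI[of x y] x assms(2) by simp
qed

lemma right_module_L: "right_module A L"
proof -
  have \<epsilon>m: "\<epsilon> \<otimes>\<^bsub>A\<^esub> (x \<otimes>\<^bsub>A\<^esub> a) = x \<otimes>\<^bsub>A\<^esub> a"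
    if "x \<in> carrier A" "\<epsilon> \<otimes>\<^bsub>A\<^esub> x = x" "a \<in> carrier A" for x a
    using that A.m_assoc[of \<epsilon> x a] by simp
  have \<epsilon>a: "\<epsilon> \<otimes>\<^bsub>A\<^esub> (x \<oplus>\<^bsub>A\<^esub> y) = x \<oplus>\<^bsub>A\<^esub> y"
    if "x \<in> carrier A" "\<epsilon> \<otimes>\<^bsub>A\<^esub> x = x" "y \<in> carrier A" "\<epsilon> \<otimes>\<^bsub>A\<^esub> y = y" for x y
    using that A.r_distr[of x y \<epsilon>] by simp
  show ?thesis
  proof (rule right_moduleI[OF A.ring_axioms])
  show "abelian_group L"
  proof (rule abelian_groupI)
    fix l assume "l \<in> carrier L"
    then obtain x where x: "x \<in> carrier A" "\<epsilon> \<otimes>\<^bsub>A\<^esub> x = x" "l = cls x"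
      by (rule L_cases)
    have "cls (\<ominus>\<^bsub>A\<^esub> x) \<in> carrier L"
      using x by (intro cls_L) (auto simp: A.r_minus)
    moreover have "cls (\<ominus>\<^bsub>A\<^esub> x) \<oplus>\<^bsub>L\<^esub> l = \<zero>\<^bsub>L\<^esub>"
      using x by (simp add: cls_add cls_zero A.l_neg)
    ultimately show "\<exists>y\<in>carrier L. y \<oplus>\<^bsub>L\<^esub> l = \<zero>\<^bsub>L\<^esub>"
      by blast
  qed (auto elim!: L_cases simp: cls_add cls_zero A.a_ac intro!: cls_L \<epsilon>a)
qed (auto elim!: L_cases simp: cls_add cls_ract A.l_distr A.r_distr A.m_assoc intro!: cls_L \<epsilon>m)
qed

lemma lact_hom_L: "s \<in> carrier KH \<Longrightarrow> lact L s \<in> right_module_hom A L L"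
proof (rule right_module_homI)
  have "\<epsilon> \<otimes>\<^bsub>A\<^esub> (s \<otimes>\<^bsub>A\<^esub> x) = s \<otimes>\<^bsub>A\<^esub> x" if "s \<in> carrier KH" "x \<in> carrier A" for x
    using that A.m_assoc[of \<epsilon> s x] by (simp add: \<epsilon>_KH_mult KH_subset)
  then show "s \<triangleright>\<^bsub>L\<^esub> l \<in> carrier L" if "s \<in> carrier KH" "l \<in> carrier L" for l
    using that by (auto elim!: L_cases simp: cls_lact KH_subset intro!: cls_L)
qed (auto elim!: L_cases simp: cls_lact cls_add cls_ract KH_subset A.r_distr A.m_assoc)

text \<open>This is the surjectivity of \<open>KG\<^sub>e \<rightarrow> e(KM/KI\<^sub>e)e\<close>.\<close>

lemma L_corner:
  assumes l: "l \<in> carrier L"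
  shows "\<exists>s\<in>carrier KH. l \<triangleleft>\<^bsub>L\<^esub> \<epsilon> = s \<triangleright>\<^bsub>L\<^esub> cls \<epsilon>"
proof -
  have main: "\<exists>s\<in>carrier KH. cls (\<epsilon> \<otimes>\<^bsub>A\<^esub> x \<otimes>\<^bsub>A\<^esub> \<epsilon>) = cls s" if "x \<in> lin_span (carrier G)" for x :: "'g \<Rightarrow>\<^sub>0 'k"
    using that
  proof (induction x rule: lin_span_induct)
    case zero
    show ?case
      using KH.zero_closed A.zero_closed
      by (intro bexI[of _ "\<zero>\<^bsub>KH\<^esub>"]) (auto simp: monoid_algebra_simps)
  next
    case (single m c)
    have eq: "\<epsilon> \<otimes>\<^bsub>A\<^esub> Poly_Mapping.single m c \<otimes>\<^bsub>A\<^esub> \<epsilon> = Poly_Mapping.single (e \<otimes> m \<otimes> e) c"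
      by (simp add: monoid_algebra_simps)
    show ?case
    proof (cases "e \<otimes> m \<otimes> e \<in> carrier H")
      case True
      then show ?thesis
        unfolding eq by (intro bexI[of _ "Poly_Mapping.single (e \<otimes> m \<otimes> e) c"])
          (auto simp: monoid_algebra_simps lin_span_single)
    next
      case False
      then have "Poly_Mapping.single (e \<otimes> m \<otimes> e) c \<in> J"
        using corner_unit_or_avoiding[OF single] by (auto intro: lin_span_single)
      then have "Poly_Mapping.single (e \<otimes> m \<otimes> e) c \<in> cls \<zero>\<^bsub>A\<^esub>"
        using J.a_subset by (simp add: A.a_coset_add_zero)
      then have "cls (Poly_Mapping.single (e \<otimes> m \<otimes> e) c) = cls \<zero>\<^bsub>A\<^esub>"
        by (intro cls_eqI) auto
      then show ?thesis
        unfolding eq using KH.zero_closed by (auto simp: KH_ops)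
    qed
  next
    case (add x y)
    then obtain s t where st: "s \<in> carrier KH" "t \<in> carrier KH"
      "cls (\<epsilon> \<otimes>\<^bsub>A\<^esub> x \<otimes>\<^bsub>A\<^esub> \<epsilon>) = cls s" "cls (\<epsilon> \<otimes>\<^bsub>A\<^esub> y \<otimes>\<^bsub>A\<^esub> \<epsilon>) = cls t"
      by auto
    have xy: "x \<in> carrier A" "y \<in> carrier A"
      using add by (auto simp: monoid_algebra_simps)
    have "cls (\<epsilon> \<otimes>\<^bsub>A\<^esub> (x \<oplus>\<^bsub>A\<^esub> y) \<otimes>\<^bsub>A\<^esub> \<epsilon>) =
        cls (\<epsilon> \<otimes>\<^bsub>A\<^esub> x \<otimes>\<^bsub>A\<^esub> \<epsilon>) \<oplus>\<^bsub>L\<^esub> cls (\<epsilon> \<otimes>\<^bsub>A\<^esub> y \<otimes>\<^bsub>A\<^esub> \<epsilon>)"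
      using xy by (simp add: cls_add A.l_distr A.r_distr)
    also have "\<dots> = cls (s \<oplus>\<^bsub>A\<^esub> t)"
      using st by (simp add: cls_add KH_subset)
    finally show ?case
      using st KH.a_closed[OF st(1,2)]
      by (intro bexI[of _ "s \<oplus>\<^bsub>A\<^esub> t"]) (auto simp: KH_ops monoid_algebra_simps)
  qed
  obtain x where x: "x \<in> carrier A" "\<epsilon> \<otimes>\<^bsub>A\<^esub> x = x" "l = cls x"
    using l by (rule L_cases)
  obtain s where s: "s \<in> carrier KH" "cls (\<epsilon> \<otimes>\<^bsub>A\<^esub> x \<otimes>\<^bsub>A\<^esub> \<epsilon>) = cls s"
    using main[of x] x by (auto simp: monoid_algebra_simps)
  then have "l \<triangleleft>\<^bsub>L\<^esub> \<epsilon> = s \<triangleright>\<^bsub>L\<^esub> cls \<epsilon>"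
    using x by (simp add: cls_ract cls_lact \<epsilon>_KH_mult)
  then show ?thesis
    using s by blast
qed

lemma corner_module_simps:
  "add (corner_module W e) = add W" "\<zero>\<^bsub>corner_module W e\<^esub> = \<zero>\<^bsub>W\<^esub>"
  "ract (corner_module W e) = ract W"
  by (auto simp: corner_module_def)

lemma carrier_corner_module:
  fixes W :: "('w, 'g \<Rightarrow>\<^sub>0 'k) right_mod"
  assumes "right_module A W"
  shows "v \<in> carrier (corner_module W e) \<longleftrightarrow> v \<in> carrier W \<and> v \<triangleleft>\<^bsub>W\<^esub> \<epsilon> = v"
proof -
  interpret W: right_module A W by fact
  show ?thesis
  proof
    assume "v \<in> carrier (corner_module W e)"
    then obtain u where u: "u \<in> carrier W" "v = u \<triangleleft>\<^bsub>W\<^esub> \<epsilon>"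
      by (auto simp: corner_module_def)
    then show "v \<in> carrier W \<and> v \<triangleleft>\<^bsub>W\<^esub> \<epsilon> = v"
      by (simp add: W.ract_closed W.ract_mult[symmetric])
  next
    assume "v \<in> carrier W \<and> v \<triangleleft>\<^bsub>W\<^esub> \<epsilon> = v"
    then show "v \<in> carrier (corner_module W e)"
      by (auto simp: corner_module_def intro!: exI[of _ v])
  qed
qed

lemma right_module_corner:
  fixes W :: "('w, 'g \<Rightarrow>\<^sub>0 'k) right_mod"
  assumes W: "right_module A W"
  shows "right_module KH (corner_module W e)"
proof -
  interpret W: right_module A W by fact
  note car = carrier_corner_module[OF W]
  show ?thesis
  proof (rule right_moduleI[OF KH.ring_axioms], unfold car corner_module_simps KH_ops)
    show "abelian_group (corner_module W e)"
    proof (rule abelian_groupI, unfold car corner_module_simps)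
      fix v assume v: "v \<in> carrier W \<and> v \<triangleleft>\<^bsub>W\<^esub> \<epsilon> = v"
      have "(\<ominus>\<^bsub>W\<^esub> v) \<triangleleft>\<^bsub>W\<^esub> \<epsilon> = \<ominus>\<^bsub>W\<^esub> v"
        using v W.ract_add_left[of "\<ominus>\<^bsub>W\<^esub> v" v \<epsilon>]
        by (intro W.minus_equality[symmetric]) (auto simp: W.V.l_neg W.ract_closed)
      then show "\<exists>y\<in>carrier (corner_module W e). y \<oplus>\<^bsub>W\<^esub> v = \<zero>\<^bsub>W\<^esub>"
        using v by (intro bexI[of _ "\<ominus>\<^bsub>W\<^esub> v"]) (auto simp: car W.V.l_neg)
    qed (auto simp: W.ract_add_left W.V.a_ac)
  next
    fix v s assume "v \<in> carrier W \<and> v \<triangleleft>\<^bsub>W\<^esub> \<epsilon> = v" "s \<in> carrier KH"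
    then show "v \<triangleleft>\<^bsub>W\<^esub> s \<in> carrier W \<and> v \<triangleleft>\<^bsub>W\<^esub> s \<triangleleft>\<^bsub>W\<^esub> \<epsilon> = v \<triangleleft>\<^bsub>W\<^esub> s"
      by (simp add: KH_subset W.ract_closed W.ract_mult[symmetric] \<epsilon>_KH_mult)
  qed (auto simp: KH_subset W.ract_add_left W.ract_add_right W.ract_mult)
qed

end


section \<open>Lifting over group algebras\<close>

lemma sum_of_scalar_copies:
  fixes V :: "('v, 'g \<Rightarrow>\<^sub>0 'k::field, 'u) right_mod_scheme"
  assumes V: "right_module (monoid_algebra H) V" and one: "\<one>\<^bsub>H\<^esub> \<in> carrier H"
    and v: "v \<in> carrier V" and "finite B"
  shows "(\<Oplus>\<^bsub>V\<^esub>t\<in>B. v \<triangleleft>\<^bsub>V\<^esub> Poly_Mapping.single \<one>\<^bsub>H\<^esub> c) =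
    v \<triangleleft>\<^bsub>V\<^esub> Poly_Mapping.single \<one>\<^bsub>H\<^esub> (of_nat (card B) * c)"
proof -
  let ?R = "monoid_algebra H :: ('g \<Rightarrow>\<^sub>0 'k) ring"
  interpret right_module ?R V by fact
  have sc: "Poly_Mapping.single \<one>\<^bsub>H\<^esub> d \<in> carrier ?R" for d
    using one by (simp add: monoid_algebra_simps lin_span_single)
  show ?thesis
    using \<open>finite B\<close>
  proof (induction B rule: finite_induct)
    case empty
    show ?case
      using v ract_zero[OF v] by (simp add: monoid_algebra_simps)
  next
    case (insert t B)
    have "v \<triangleleft>\<^bsub>V\<^esub> Poly_Mapping.single \<one>\<^bsub>H\<^esub> (of_nat (card (insert t B)) * c) =
        v \<triangleleft>\<^bsub>V\<^esub> (Poly_Mapping.single \<one>\<^bsub>H\<^esub> c \<oplus>\<^bsub>?R\<^esub> Poly_Mapping.single \<one>\<^bsub>H\<^esub> (of_nat (card B) * c))"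
      using insert by (simp add: monoid_algebra_simps single_add[symmetric] distrib_right)
    then show ?case
      using insert v sc by (simp add: ract_add_right ract_closed)
  qed
qed

text \<open>Maschke's averaging argument: \<open>h x = \<Sum>\<^sub>t h\<^sub>0(x t/n) t\<^sup>-\<^sup>1\<close>, where \<open>t\<close> runs through the group \<open>H\<close> of
  order \<open>n\<close>. Each summand is mapped to \<open>(f x)/n\<close> by \<open>k\<close>.\<close>

lemma group_algebra_linear_lift_averaging:
  fixes H :: "('g, 'z) monoid_scheme"
    and X :: "('x, 'g \<Rightarrow>\<^sub>0 'k::field, 'u) right_mod_scheme"
    and Y :: "('y, 'g \<Rightarrow>\<^sub>0 'k, 'v) right_mod_scheme"
    and Z :: "('w, 'g \<Rightarrow>\<^sub>0 'k, 't) right_mod_scheme"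
  assumes H: "group H" and fin: "finite (carrier H)" and char: "of_nat (card (carrier H)) \<noteq> (0 :: 'k)"
    and X: "right_module (monoid_algebra H) X" and Y: "right_module (monoid_algebra H) Y"
    and Z: "right_module (monoid_algebra H) Z"
    and k: "k \<in> right_module_hom (monoid_algebra H) Y Z" and f: "f \<in> right_module_hom (monoid_algebra H) X Z"
    and h0: "\<And>x. x \<in> carrier X \<Longrightarrow> h0 x \<in> carrier Y"
    and h0_add: "\<And>x y. \<lbrakk>x \<in> carrier X; y \<in> carrier X\<rbrakk> \<Longrightarrow> h0 (x \<oplus>\<^bsub>X\<^esub> y) = h0 x \<oplus>\<^bsub>Y\<^esub> h0 y"
    and h0_scale: "\<And>x c. x \<in> carrier X \<Longrightarrow>
      h0 (x \<triangleleft>\<^bsub>X\<^esub> Poly_Mapping.single \<one>\<^bsub>H\<^esub> c) = h0 x \<triangleleft>\<^bsub>Y\<^esub> Poly_Mapping.single \<one>\<^bsub>H\<^esub> c"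
    and h0_lift: "\<And>x. x \<in> carrier X \<Longrightarrow> k (h0 x) = f x"
  obtains h where "h \<in> right_module_hom (monoid_algebra H) X Y" "\<And>x. x \<in> carrier X \<Longrightarrow> k (h x) = f x"
proof -
  interpret H: group H by fact
  let ?KH = "monoid_algebra H :: ('g \<Rightarrow>\<^sub>0 'k) ring"
  interpret X: right_module ?KH X by fact
  interpret Y: right_module ?KH Y by fact
  interpret Z: right_module ?KH Z by fact
  note kD = right_module_homD[OF k] and fD = right_module_homD[OF f]
  let ?n = "of_nat (card (carrier H)) :: 'k"
  let ?s = "Poly_Mapping.single :: 'g \<Rightarrow> 'k \<Rightarrow> 'g \<Rightarrow>\<^sub>0 'k"
  have s: "?s g c \<in> carrier ?KH" if "g \<in> carrier H" for g c
    using that by (simp add: monoid_algebra_simps lin_span_single)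
  have ss: "?s g c \<otimes>\<^bsub>?KH\<^esub> ?s t d = ?s (g \<otimes>\<^bsub>H\<^esub> t) (c * d)" for g t c d
    by (simp add: monoid_algebra_simps)
  define summand where "summand x t = h0 (x \<triangleleft>\<^bsub>X\<^esub> ?s t (1 / ?n)) \<triangleleft>\<^bsub>Y\<^esub> ?s (inv\<^bsub>H\<^esub> t) 1" for x t
  define h where "h x = (\<Oplus>\<^bsub>Y\<^esub>t\<in>carrier H. summand x t)" for x
  have summand_closed: "summand x t \<in> carrier Y" if "x \<in> carrier X" "t \<in> carrier H" for x t
    using that by (simp add: summand_def h0 s X.ract_closed Y.ract_closed)
  have summand_add: "summand (x \<oplus>\<^bsub>X\<^esub> y) t = summand x t \<oplus>\<^bsub>Y\<^esub> summand y t"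
    if "x \<in> carrier X" "y \<in> carrier X" "t \<in> carrier H" for x y t
    using that by (simp add: summand_def X.ract_add_left X.ract_closed h0_add h0 s Y.ract_add_left)
  have h_closed: "h x \<in> carrier Y" if "x \<in> carrier X" for x
    using that summand_closed by (auto simp: h_def intro!: Y.V.finsum_closed)
  have h_add: "h (x \<oplus>\<^bsub>X\<^esub> y) = h x \<oplus>\<^bsub>Y\<^esub> h y" if "x \<in> carrier X" "y \<in> carrier X" for x y
  proof -
    have "h (x \<oplus>\<^bsub>X\<^esub> y) = (\<Oplus>\<^bsub>Y\<^esub>t\<in>carrier H. summand x t \<oplus>\<^bsub>Y\<^esub> summand y t)"
      unfolding h_def using that summand_closed summand_add by (intro Y.V.finsum_cong') auto
    also have "\<dots> = h x \<oplus>\<^bsub>Y\<^esub> h y"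
      unfolding h_def using that summand_closed by (intro Y.V.finsum_addf) auto
    finally show ?thesis .
  qed
  have h_single: "h (x \<triangleleft>\<^bsub>X\<^esub> ?s g c) = h x \<triangleleft>\<^bsub>Y\<^esub> ?s g c"
    if x: "x \<in> carrier X" and g: "g \<in> carrier H" for x g c
  proof -
    \<comment> \<open>Substituting \<open>t = g\<^sup>-\<^sup>1 u\<close> moves the factor \<open>g\<close> past the average.\<close>
    have shift: "summand (x \<triangleleft>\<^bsub>X\<^esub> ?s g c) (inv\<^bsub>H\<^esub> g \<otimes>\<^bsub>H\<^esub> u) = summand x u \<triangleleft>\<^bsub>Y\<^esub> ?s g c" if u: "u \<in> carrier H" for u
    proof -
      have "x \<triangleleft>\<^bsub>X\<^esub> ?s g c \<triangleleft>\<^bsub>X\<^esub> ?s (inv\<^bsub>H\<^esub> g \<otimes>\<^bsub>H\<^esub> u) (1 / ?n) = x \<triangleleft>\<^bsub>X\<^esub> ?s u (1 / ?n) \<triangleleft>\<^bsub>X\<^esub> ?s \<one>\<^bsub>H\<^esub> c"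
        using x g u by (simp add: X.ract_mult[symmetric] s ss H.m_assoc[symmetric] mult.commute)
      then have "summand (x \<triangleleft>\<^bsub>X\<^esub> ?s g c) (inv\<^bsub>H\<^esub> g \<otimes>\<^bsub>H\<^esub> u) =
          h0 (x \<triangleleft>\<^bsub>X\<^esub> ?s u (1 / ?n)) \<triangleleft>\<^bsub>Y\<^esub> ?s \<one>\<^bsub>H\<^esub> c \<triangleleft>\<^bsub>Y\<^esub> ?s (inv\<^bsub>H\<^esub> u \<otimes>\<^bsub>H\<^esub> g) 1"
        using x g u by (simp add: summand_def h0_scale X.ract_closed s H.inv_mult_group)
      also have "\<dots> = summand x u \<triangleleft>\<^bsub>Y\<^esub> ?s g c"
        using x g u by (simp add: summand_def h0 X.ract_closed Y.ract_mult[symmetric] s ss)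
      finally show ?thesis .
    qed
    have bij: "(\<lambda>u. inv\<^bsub>H\<^esub> g \<otimes>\<^bsub>H\<^esub> u) ` carrier H = carrier H" "inj_on (\<lambda>u. inv\<^bsub>H\<^esub> g \<otimes>\<^bsub>H\<^esub> u) (carrier H)"
      using g by (auto simp: H.surj_const_mult H.inj_on_cmult)
    have xg: "x \<triangleleft>\<^bsub>X\<^esub> ?s g c \<in> carrier X"
      using x g by (simp add: X.ract_closed s)
    have "h (x \<triangleleft>\<^bsub>X\<^esub> ?s g c) = (\<Oplus>\<^bsub>Y\<^esub>u\<in>carrier H. summand (x \<triangleleft>\<^bsub>X\<^esub> ?s g c) (inv\<^bsub>H\<^esub> g \<otimes>\<^bsub>H\<^esub> u))"
      using Y.V.finsum_reindex[OF _ bij(2), of "summand (x \<triangleleft>\<^bsub>X\<^esub> ?s g c)"] summand_closed[OF xg]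
      by (simp add: h_def bij(1) Pi_iff)
    also have "\<dots> = (\<Oplus>\<^bsub>Y\<^esub>u\<in>carrier H. summand x u \<triangleleft>\<^bsub>Y\<^esub> ?s g c)"
      using x g summand_closed s shift by (intro Y.V.finsum_cong') (auto simp: Y.ract_closed)
    also have "\<dots> = h x \<triangleleft>\<^bsub>Y\<^esub> ?s g c"
      unfolding h_def using x g summand_closed s by (intro Y.finsum_ract[symmetric]) auto
    finally show ?thesis .
  qed
  have h_act: "h (x \<triangleleft>\<^bsub>X\<^esub> a) = h x \<triangleleft>\<^bsub>Y\<^esub> a" if x: "x \<in> carrier X" and a: "a \<in> lin_span (carrier H)" for x a
    using a
  proof (induction a rule: lin_span_induct)
    case zero
    have "h0 \<zero>\<^bsub>X\<^esub> = \<zero>\<^bsub>Y\<^esub>"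
      using h0_add[of "\<zero>\<^bsub>X\<^esub>" "\<zero>\<^bsub>X\<^esub>"] h0[of "\<zero>\<^bsub>X\<^esub>"] by simp
    then have "summand \<zero>\<^bsub>X\<^esub> t = \<zero>\<^bsub>Y\<^esub>" if "t \<in> carrier H" for t
      using that by (simp add: summand_def s)
    then have "h \<zero>\<^bsub>X\<^esub> = (\<Oplus>\<^bsub>Y\<^esub>t\<in>carrier H. \<zero>\<^bsub>Y\<^esub>)"
      unfolding h_def by (intro Y.V.finsum_cong') auto
    then show ?case
      using x X.ract_zero[OF x] Y.ract_zero[OF h_closed[OF x]]
      by (simp add: zero_monoid_algebra)
  next
    case (add a b)
    then have "a \<in> carrier ?KH" "b \<in> carrier ?KH"
      by (auto simp: monoid_algebra_simps)
    then show ?case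
      using add x X.ract_add_right[OF x, of a b] Y.ract_add_right[OF h_closed[OF x], of a b]
      by (simp add: add_monoid_algebra h_add X.ract_closed)
  qed (use x h_single in auto)
  have "k (h x) = f x" if x: "x \<in> carrier X" for x
  proof -
    interpret k: abelian_group_hom Y Z k
      by (rule abelian_group_hom_additiveI[OF Y.V.abelian_group_axioms Z.V.abelian_group_axioms kD(1,2)])
    have "k (summand x t) = f x \<triangleleft>\<^bsub>Z\<^esub> ?s \<one>\<^bsub>H\<^esub> (1 / ?n)" if t: "t \<in> carrier H" for t
    proof -
      have "k (summand x t) = f (x \<triangleleft>\<^bsub>X\<^esub> ?s t (1 / ?n)) \<triangleleft>\<^bsub>Z\<^esub> ?s (inv\<^bsub>H\<^esub> t) 1"
        using x t by (simp add: summand_def kD(3) h0 s X.ract_closed h0_lift)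
      also have "\<dots> = f x \<triangleleft>\<^bsub>Z\<^esub> ?s \<one>\<^bsub>H\<^esub> (1 / ?n)"
        using x t by (simp add: fD s Z.ract_mult[symmetric] ss)
      finally show ?thesis .
    qed
    then have "k (h x) = (\<Oplus>\<^bsub>Z\<^esub>t\<in>carrier H. f x \<triangleleft>\<^bsub>Z\<^esub> ?s \<one>\<^bsub>H\<^esub> (1 / ?n))"
      unfolding h_def using x summand_closed s fD(1) Z.ract_closed
      by (subst abelian_group_hom_finsum[OF k.abelian_group_hom_axioms]) (auto intro!: Z.V.finsum_cong')
    also have "\<dots> = f x \<triangleleft>\<^bsub>Z\<^esub> ?s \<one>\<^bsub>H\<^esub> (?n * (1 / ?n))"
      using fD(1)[OF x] by (intro sum_of_scalar_copies[OF Z] fin) auto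
    also have "\<dots> = f x"
      using char Z.ract_one[OF fD(1)[OF x]] by (simp add: one_monoid_algebra)
    finally show ?thesis .
  qed
  moreover have "h \<in> right_module_hom ?KH X Y"
    using h_closed h_add h_act by (intro right_module_homI) (auto simp: carrier_monoid_algebra)
  ultimately show thesis
    using that by blast
qed

section \<open>Induced modules\<close>

text \<open>The module \<open>P\<close> below is \<open>Ind\<^sub>e(Ve)\<close>. The map \<open>induced_map W h\<close> sends \<open>v \<otimes> a\<close> to \<open>h(v) a\<close>; for the
  inclusion \<open>h : Ve \<rightarrow> V\<close> it is the natural map.\<close>

locale corner_induction = monoid_idempotent G e K
  for G :: "'g monoid" (structure) and e and K :: "'k::field itself" +
  fixes V :: "('v, 'g \<Rightarrow>\<^sub>0 'k) right_mod"
  assumes module_V: "right_module A V"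
begin

abbreviation Ve where "Ve \<equiv> corner_module V e"
abbreviation P where "P \<equiv> induced_module G e Ve"
abbreviation tens (infixl "\<otimes>\<otimes>" 70) where "v \<otimes>\<otimes> l \<equiv> tensor KH Ve L v l"
abbreviation induced_map where
  "induced_map W h \<equiv> tensor_lift W (\<lambda>v a. THE w. \<forall>x\<in>a. w = h v \<triangleleft>\<^bsub>W\<^esub> x)"

sublocale V: right_module A V
  by (rule module_V)

sublocale Ve: right_module KH Ve
  by (rule right_module_corner[OF module_V])

sublocale L: right_module A L
  by (rule right_module_L)

sublocale T: tensor_factors KH Ve A L
  by unfold_locales (rule lact_hom_L)

lemma P_eq: "P = tensor_product KH Ve L"
  by (simp add: induced_module_def)

sublocale P: right_module A P
  unfolding P_eq by (rule T.right_module_P)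

lemmas carrier_Ve = carrier_corner_module[OF module_V]

lemma Ve_V: "v \<in> carrier Ve \<Longrightarrow> v \<in> carrier V"
  by (simp add: carrier_Ve)

text \<open>Since \<open>L = e(KM/KI\<^sub>e)\<close> is a quotient by \<open>J\<close>, the hypothesis that \<open>J\<close> kills the values of \<open>h\<close> is
  exactly what makes \<open>h(v) a\<close> independent of the representative of the coset \<open>a\<close>.\<close>

lemma
  fixes W :: "('w, 'g \<Rightarrow>\<^sub>0 'k) right_mod"
  assumes W: "right_module A W"
    and closed: "\<And>v. v \<in> carrier Ve \<Longrightarrow> h v \<in> carrier W"
    and add: "\<And>v w. \<lbrakk>v \<in> carrier Ve; w \<in> carrier Ve\<rbrakk> \<Longrightarrow> h (v \<oplus>\<^bsub>V\<^esub> w) = h v \<oplus>\<^bsub>W\<^esub> h w"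
    and act: "\<And>v s. \<lbrakk>v \<in> carrier Ve; s \<in> carrier KH\<rbrakk> \<Longrightarrow> h (v \<triangleleft>\<^bsub>V\<^esub> s) = h v \<triangleleft>\<^bsub>W\<^esub> s"
    and kill: "\<And>v x. \<lbrakk>v \<in> carrier Ve; x \<in> J\<rbrakk> \<Longrightarrow> h v \<triangleleft>\<^bsub>W\<^esub> x = \<zero>\<^bsub>W\<^esub>"
  shows induced_map_hom: "induced_map W h \<in> right_module_hom A P W"
    and induced_map_tensor:
      "\<And>v a x. \<lbrakk>v \<in> carrier Ve; a \<in> carrier L; x \<in> a\<rbrakk> \<Longrightarrow> induced_map W h (v \<otimes>\<otimes> a) = h v \<triangleleft>\<^bsub>W\<^esub> x"
proof -
  interpret W: right_module A W by fact
  let ?f = "\<lambda>v a. THE w. \<forall>x\<in>a. w = h v \<triangleleft>\<^bsub>W\<^esub> x"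
  have f_cls: "?f v (cls x) = h v \<triangleleft>\<^bsub>W\<^esub> x" if v: "v \<in> carrier Ve" and x: "x \<in> carrier A" for v x
  proof (rule the_equality)
    have "h v \<triangleleft>\<^bsub>W\<^esub> x = h v \<triangleleft>\<^bsub>W\<^esub> y" if y: "y \<in> cls x" for y
    proof -
      obtain j where j: "j \<in> J" "y = j \<oplus>\<^bsub>A\<^esub> x"
        using y by (auto simp: a_r_coset_def')
      then show ?thesis
        using v x kill[OF v j(1)] closed[OF v] J_subset by (auto simp: W.ract_add_right W.ract_closed)
    qed
    then show "\<forall>y\<in>cls x. h v \<triangleleft>\<^bsub>W\<^esub> x = h v \<triangleleft>\<^bsub>W\<^esub> y"
      by blast
    show "w = h v \<triangleleft>\<^bsub>W\<^esub> x" if "\<forall>y\<in>cls x. w = h v \<triangleleft>\<^bsub>W\<^esub> y" for w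
      using that cls_self[OF x] by blast
  qed
  have prem: "v \<in> carrier Ve \<Longrightarrow> l \<in> carrier L \<Longrightarrow> ?f v l \<in> carrier W"
    "\<lbrakk>v \<in> carrier Ve; w \<in> carrier Ve; l \<in> carrier L\<rbrakk> \<Longrightarrow> ?f (v \<oplus>\<^bsub>Ve\<^esub> w) l = ?f v l \<oplus>\<^bsub>W\<^esub> ?f w l"
    "v \<in> carrier Ve \<Longrightarrow> ?f v \<in> right_module_hom A L W"
    "\<lbrakk>v \<in> carrier Ve; s \<in> carrier KH; l \<in> carrier L\<rbrakk> \<Longrightarrow> ?f (v \<triangleleft>\<^bsub>Ve\<^esub> s) l = ?f v (s \<triangleright>\<^bsub>L\<^esub> l)"
    for v w s l
  proof -
    show "?f v l \<in> carrier W" if v: "v \<in> carrier Ve" and l: "l \<in> carrier L"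
    proof -
      obtain x where "x \<in> carrier A" "l = cls x"
        using l by (rule L_cases)
      then show ?thesis
        using v closed by (simp add: f_cls W.ract_closed)
    qed
    show "?f (v \<oplus>\<^bsub>Ve\<^esub> w) l = ?f v l \<oplus>\<^bsub>W\<^esub> ?f w l"
      if v: "v \<in> carrier Ve" "w \<in> carrier Ve" and l: "l \<in> carrier L"
    proof -
      obtain x where x: "x \<in> carrier A" "l = cls x"
        using l by (rule L_cases)
      show ?thesis
        unfolding x(2) f_cls[OF Ve.V.a_closed[OF v] x(1)] f_cls[OF v(1) x(1)] f_cls[OF v(2) x(1)]
        using v x(1) closed by (simp add: add W.ract_add_left corner_module_simps)
    qed
    show "?f v \<in> right_module_hom A L W" if v: "v \<in> carrier Ve"
      using v closed[OF v]
      by (intro right_module_homI)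
         (auto elim!: L_cases simp: cls_add cls_ract f_cls W.ract_closed W.ract_add_right W.ract_mult)
    show "?f (v \<triangleleft>\<^bsub>Ve\<^esub> s) l = ?f v (s \<triangleright>\<^bsub>L\<^esub> l)"
      if v: "v \<in> carrier Ve" and s: "s \<in> carrier KH" and l: "l \<in> carrier L"
    proof -
      obtain x where x: "x \<in> carrier A" "l = cls x"
        using l by (rule L_cases)
      have sx: "s \<otimes>\<^bsub>A\<^esub> x \<in> carrier A"
        using s x(1) by (simp add: KH_subset)
      show ?thesis
        unfolding x(2) cls_lact[OF x(1) s] f_cls[OF Ve.ract_closed[OF v s] x(1)] f_cls[OF v sx]
        using v s x(1) closed by (simp add: act KH_subset W.ract_mult corner_module_simps)
    qed
  qed
  have lift: "tensor_lift W ?f \<in> right_module_hom A (tensor_product KH Ve L) W"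
    "\<lbrakk>v \<in> carrier Ve; l \<in> carrier L\<rbrakk> \<Longrightarrow> tensor_lift W ?f (v \<otimes>\<otimes> l) = ?f v l" for v l
    using T.tensor_lift_hom[OF W, of ?f] prem by blast+
  show "induced_map W h \<in> right_module_hom A P W"
    unfolding P_eq by (rule lift(1))
  show "induced_map W h (v \<otimes>\<otimes> a) = h v \<triangleleft>\<^bsub>W\<^esub> x" if "v \<in> carrier Ve" "a \<in> carrier L" "x \<in> a" for v a x
    using lift(2)[OF that(1,2)] f_cls[OF that(1), of x] L_mem[OF that(2,3)] by simp
qed

text \<open>\<open>(v \<otimes> l)e = v \<otimes> le = v \<otimes> se = vs \<otimes> e\<close>, where \<open>s \<in> KG\<^sub>e\<close> represents \<open>le\<close>.\<close>

lemma P_corner: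
  assumes "p \<in> carrier P"
  shows "\<exists>w\<in>carrier Ve. p \<triangleleft>\<^bsub>P\<^esub> \<epsilon> = w \<otimes>\<otimes> cls \<epsilon>"
  using assms unfolding P_eq
proof (induction p rule: T.tensor_induct)
  case zero
  have "\<zero>\<^bsub>tensor_product KH Ve L\<^esub> \<triangleleft>\<^bsub>tensor_product KH Ve L\<^esub> \<epsilon> = \<zero>\<^bsub>tensor_product KH Ve L\<^esub>"
    using P.zero_ract[of \<epsilon>] by (simp add: P_eq)
  then show ?case
    using T.tensor_zero_left[of "cls \<epsilon>"] by (intro bexI[of _ "\<zero>\<^bsub>Ve\<^esub>"]) auto
next
  case (add x y)
  then obtain v w where vw: "v \<in> carrier Ve" "w \<in> carrier Ve" "x \<triangleleft>\<^bsub>P\<^esub> \<epsilon> = v \<otimes>\<otimes> cls \<epsilon>" "y \<triangleleft>\<^bsub>P\<^esub> \<epsilon> = w \<otimes>\<otimes> cls \<epsilon>"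
    by (auto simp: P_eq)
  then show ?case
    using add P.ract_add_left[of x y \<epsilon>] T.tensor_add_left[of v w "cls \<epsilon>"] Ve.V.a_closed[of v w]
    by (intro bexI[of _ "v \<oplus>\<^bsub>Ve\<^esub> w"]) (auto simp: P_eq)
next
  case (tensor v l)
  obtain s where s: "s \<in> carrier KH" "l \<triangleleft>\<^bsub>L\<^esub> \<epsilon> = s \<triangleright>\<^bsub>L\<^esub> cls \<epsilon>"
    using L_corner[OF tensor(2)] by blast
  then show ?case
    using tensor T.tensor_balanced[of v s "cls \<epsilon>"] Ve.ract_closed[of v s]
    by (intro bexI[of _ "v \<triangleleft>\<^bsub>Ve\<^esub> s"]) auto
qed

lemma tensor_cls:
  assumes "v \<in> carrier Ve" "x \<in> carrier A" "\<epsilon> \<otimes>\<^bsub>A\<^esub> x = x"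
  shows "v \<otimes>\<otimes> cls x = (v \<otimes>\<otimes> cls \<epsilon>) \<triangleleft>\<^bsub>P\<^esub> x"
  using assms by (simp add: P_eq cls_ract)

lemma P_generated:
  assumes N: "right_submodule A N P" and gen: "\<And>p. p \<in> carrier P \<Longrightarrow> p \<triangleleft>\<^bsub>P\<^esub> \<epsilon> \<in> N"
  shows "N = carrier P"
proof -
  note n = P.right_submoduleD[OF N]
  have "p \<in> N" if "p \<in> carrier P" for p
    using that unfolding P_eq
  proof (induction p rule: T.tensor_induct)
    case (tensor v l)
    obtain x where x: "x \<in> carrier A" "\<epsilon> \<otimes>\<^bsub>A\<^esub> x = x" "l = cls x"
      using tensor(2) by (rule L_cases)
    have "v \<otimes>\<otimes> cls \<epsilon> = (v \<otimes>\<otimes> cls \<epsilon>) \<triangleleft>\<^bsub>P\<^esub> \<epsilon>"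
      using tensor(1) by (intro tensor_cls) auto
    moreover have "v \<otimes>\<otimes> cls \<epsilon> \<in> carrier P"
      using tensor(1) by (simp add: P_eq)
    ultimately have "v \<otimes>\<otimes> cls \<epsilon> \<in> N"
      using gen by metis
    then show ?case
      using x tensor_cls[OF tensor(1) x(1,2)] n(5) by simp
  qed (use n(2,3) in \<open>simp_all add: P_eq\<close>)
  then show ?thesis
    using n(1) by blast
qed

end

text \<open>The product \<open>va\<close> of \<open>v \<in> Ve\<close> and a coset \<open>a\<close> modulo \<open>J\<close>, and with it the natural map
  \<open>Ind\<^sub>e(Ve) \<rightarrow> V\<close>, is meaningful precisely if \<open>(Ve)J = 0\<close>.\<close>

locale corner_induction_natural = corner_induction +
  assumes kill_V: "\<And>v x. \<lbrakk>v \<in> carrier Ve; x \<in> J\<rbrakk> \<Longrightarrow> v \<triangleleft>\<^bsub>V\<^esub> x = \<zero>\<^bsub>V\<^esub>"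
begin

abbreviation \<phi> where "\<phi> \<equiv> induced_natural_map V"

lemma natural_map_hom: "\<phi> \<in> right_module_hom A P V"
  and natural_map_tensor: "\<lbrakk>v \<in> carrier Ve; a \<in> carrier L; x \<in> a\<rbrakk> \<Longrightarrow> \<phi> (v \<otimes>\<otimes> a) = v \<triangleleft>\<^bsub>V\<^esub> x"
  unfolding induced_natural_map_def
  using induced_map_hom[OF module_V, of "\<lambda>v. v"] induced_map_tensor[OF module_V, of "\<lambda>v. v"] kill_V Ve_V
  by blast+

text \<open>By \<open>P_corner\<close> the natural map restricted to \<open>Pe\<close> is \<open>w \<otimes> e \<mapsto> w\<close>, which is injective.\<close>

lemma kernel_killed:
  assumes "p \<in> a_kernel P V \<phi>"
  shows "p \<triangleleft>\<^bsub>P\<^esub> \<epsilon> = \<zero>\<^bsub>P\<^esub>"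
proof -
  note \<phi> = right_module_homD[OF natural_map_hom]
  have p: "p \<in> carrier P" "\<phi> p = \<zero>\<^bsub>V\<^esub>"
    using assms by (auto simp: a_kernel_def')
  obtain w where w: "w \<in> carrier Ve" "p \<triangleleft>\<^bsub>P\<^esub> \<epsilon> = w \<otimes>\<otimes> cls \<epsilon>"
    using P_corner[OF p(1)] by blast
  have "w = w \<triangleleft>\<^bsub>V\<^esub> \<epsilon>"
    using w(1) by (simp add: carrier_Ve)
  also have "\<dots> = \<phi> (p \<triangleleft>\<^bsub>P\<^esub> \<epsilon>)"
    unfolding w(2) using w(1) cls_self[OF \<epsilon>_closed] by (intro natural_map_tensor[symmetric]) auto
  also have "\<dots> = \<zero>\<^bsub>Ve\<^esub>"
    using p \<phi>(3)[OF p(1) \<epsilon>_closed] by (simp add: corner_module_simps)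
  finally show ?thesis
    using w(2) T.tensor_zero_left[of "cls \<epsilon>"] by (simp add: P_eq)
qed

lemma kernel_subset_radical: "a_kernel P V \<phi> \<subseteq> module_radical A P"
  by (rule P.killed_submodule_subset_radical[OF \<epsilon>_closed P_generated
        right_module_kernel_submodule[OF P.right_module_axioms module_V natural_map_hom] kernel_killed])

lemma kernel_trivial_if_semisimple:
  assumes "semisimple_ring A"
  shows "a_kernel P V \<phi> = {\<zero>\<^bsub>P\<^esub>}"
  by (rule P.killed_submodule_trivial_if_semisimple[OF assms \<epsilon>_closed P_generated
        right_module_kernel_submodule[OF P.right_module_axioms module_V natural_map_hom] kernel_killed])

lemma natural_map_surj:
  assumes gen: "\<And>N. \<lbrakk>right_submodule A N V; carrier Ve \<subseteq> N\<rbrakk> \<Longrightarrow> N = carrier V"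
  shows "\<phi> ` carrier P = carrier V"
proof (rule gen)
  note \<phi> = right_module_homD[OF natural_map_hom]
  show "carrier Ve \<subseteq> \<phi> ` carrier P"
  proof
    fix v assume v: "v \<in> carrier Ve"
    then have "\<phi> (v \<otimes>\<otimes> cls \<epsilon>) = v"
      using natural_map_tensor[OF v cls_\<epsilon>_L cls_self[OF \<epsilon>_closed]] by (simp add: carrier_Ve)
    moreover have "v \<otimes>\<otimes> cls \<epsilon> \<in> carrier P"
      using v by (simp add: P_eq)
    ultimately show "v \<in> \<phi> ` carrier P"
      by (metis imageI)
  qed
  show "right_submodule A (\<phi> ` carrier P) V"
  proof (rule V.right_submoduleI)
    show "\<phi> ` carrier P \<subseteq> carrier V"
      using \<phi>(1) by blast
    have "\<phi> \<zero>\<^bsub>P\<^esub> = \<zero>\<^bsub>V\<^esub>"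
      using \<phi>(2)[of "\<zero>\<^bsub>P\<^esub>" "\<zero>\<^bsub>P\<^esub>"] \<phi>(1)[of "\<zero>\<^bsub>P\<^esub>"] by simp
    then show "\<zero>\<^bsub>V\<^esub> \<in> \<phi> ` carrier P"
      using P.V.zero_closed by (intro image_eqI[of _ _ "\<zero>\<^bsub>P\<^esub>"]) simp_all
  next
    fix v w assume "v \<in> \<phi> ` carrier P" "w \<in> \<phi> ` carrier P"
    then obtain p q where "p \<in> carrier P" "q \<in> carrier P" "v = \<phi> p" "w = \<phi> q"
      by blast
    then show "v \<oplus>\<^bsub>V\<^esub> w \<in> \<phi> ` carrier P"
      using \<phi>(2)[of p q] P.V.a_closed[of p q] by (intro image_eqI[of _ _ "p \<oplus>\<^bsub>P\<^esub> q"]) simp_all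
  next
    fix v a assume "v \<in> \<phi> ` carrier P" and a: "a \<in> carrier A"
    then obtain p where "p \<in> carrier P" "v = \<phi> p"
      by blast
    then show "v \<triangleleft>\<^bsub>V\<^esub> a \<in> \<phi> ` carrier P"
      using \<phi>(3)[OF _ a, of p] P.ract_closed[OF _ a, of p]
      by (intro image_eqI[of _ _ "p \<triangleleft>\<^bsub>P\<^esub> a"]) simp_all
  qed
qed

end


section \<open>Lifting homomorphisms from an induced module\<close>

text \<open>The situation of an idempotent \<open>e \<noteq> \<theta>\<close> with \<open>eI\<^sub>e = {\<theta>}\<close>, where \<open>\<theta>\<close> is the zero of the monoid.
  Then \<open>\<theta>\<close>, written \<open>\<tau>\<close> as an element of the algebra, is a central idempotent and \<open>(e - \<theta>)J = 0\<close>. So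
  \<open>e(KM/KI\<^sub>e)\<close> is isomorphic to the projective right ideal \<open>(e - \<theta>)KM\<close>.\<close>

locale corner_induction_zero = corner_induction G e K V
  for G :: "'g monoid" (structure) and e and K :: "'k::field itself"
    and V :: "('v, 'g \<Rightarrow>\<^sub>0 'k) right_mod" +
  fixes \<theta> :: 'g
  assumes \<theta>_closed [simp]: "\<theta> \<in> carrier G"
    and \<theta>_zero: "m \<in> carrier G \<Longrightarrow> m \<otimes> \<theta> = \<theta>" "m \<in> carrier G \<Longrightarrow> \<theta> \<otimes> m = \<theta>"
    and e_not_\<theta>: "e \<noteq> \<theta>"
    and e_avoiding: "m \<in> ideal_avoiding G e \<Longrightarrow> e \<otimes> m = \<theta>"
    and V_\<theta>: "v \<in> carrier V \<Longrightarrow> v \<triangleleft>\<^bsub>V\<^esub> Poly_Mapping.single \<theta> 1 = \<zero>\<^bsub>V\<^esub>"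
begin

abbreviation \<tau> :: "'g \<Rightarrow>\<^sub>0 'k" where "\<tau> \<equiv> Poly_Mapping.single \<theta> 1"

lemma single_closed: "m \<in> carrier G \<Longrightarrow> Poly_Mapping.single m c \<in> carrier A"
  by (simp add: monoid_algebra_simps lin_span_single)

lemma single_mult: "Poly_Mapping.single m c \<otimes>\<^bsub>A\<^esub> Poly_Mapping.single n d = Poly_Mapping.single (m \<otimes> n) (c * d)"
  by (simp add: monoid_algebra_simps)

lemma \<tau>_closed [simp]: "\<tau> \<in> carrier A"
  by (simp add: single_closed)

lemma \<tau>_central:
  assumes "x \<in> carrier A"
  shows "x \<otimes>\<^bsub>A\<^esub> \<tau> = \<tau> \<otimes>\<^bsub>A\<^esub> x"
  using assms unfolding monoid_algebra_simps
  by (induction x rule: lin_span_induct)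
     (auto simp: \<theta>_zero bilinear_extension_add_left bilinear_extension_add_right)

text \<open>This is \<open>w(1 - \<theta>)J = 0\<close>: for \<open>m \<in> I\<^sub>e\<close> both \<open>wm = wem\<close> and \<open>w\<theta>m\<close> equal \<open>w\<theta>\<close>.\<close>

lemma reduced_killed:
  fixes W :: "('w, 'g \<Rightarrow>\<^sub>0 'k) right_mod"
  assumes W: "right_module A W" and w: "w \<in> carrier W" "w \<triangleleft>\<^bsub>W\<^esub> \<epsilon> = w" and x: "x \<in> J"
  shows "w \<triangleleft>\<^bsub>W\<^esub> x = w \<triangleleft>\<^bsub>W\<^esub> \<tau> \<triangleleft>\<^bsub>W\<^esub> x"
proof -
  interpret W: right_module A W by fact
  show ?thesis
    using x
  proof (induction x rule: lin_span_induct)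
    case zero
    then show ?case
      using w(1) W.ract_zero[OF w(1)] W.ract_zero[of "w \<triangleleft>\<^bsub>W\<^esub> \<tau>"]
      by (simp add: zero_monoid_algebra W.ract_closed)
  next
    case (single m c)
    have m: "m \<in> carrier G"
      using single by (simp add: ideal_avoiding_def)
    have "w \<triangleleft>\<^bsub>W\<^esub> Poly_Mapping.single m c = w \<triangleleft>\<^bsub>W\<^esub> \<epsilon> \<triangleleft>\<^bsub>W\<^esub> Poly_Mapping.single m c"
      using w(2) by simp
    also have "\<dots> = w \<triangleleft>\<^bsub>W\<^esub> Poly_Mapping.single \<theta> c"
      using w(1) m single_closed[OF m, of c] W.ract_mult[OF w(1) \<epsilon>_closed, symmetric]
      by (simp add: single_mult e_avoiding[OF single])
    also have "\<dots> = w \<triangleleft>\<^bsub>W\<^esub> \<tau> \<triangleleft>\<^bsub>W\<^esub> Poly_Mapping.single m c"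
      using w(1) m single_closed[OF m, of c] W.ract_mult[OF w(1) \<tau>_closed, symmetric]
      by (simp add: single_mult \<theta>_zero)
    finally show ?case .
  next
    case (add f g)
    then have fg: "f \<in> carrier A" "g \<in> carrier A"
      using J_subset by auto
    have "f + g = f \<oplus>\<^bsub>A\<^esub> g"
      by (simp add: add_monoid_algebra)
    then show ?case
      using add w(1) fg by (simp add: W.ract_add_right W.ract_closed)
  qed
qed

sublocale corner_induction_natural
proof
  fix v x assume v: "v \<in> carrier Ve" and x: "x \<in> J"
  have xA: "x \<in> carrier A"
    using x J_subset by auto
  have "v \<triangleleft>\<^bsub>V\<^esub> x = v \<triangleleft>\<^bsub>V\<^esub> \<tau> \<triangleleft>\<^bsub>V\<^esub> x"
    using v x by (intro reduced_killed[OF module_V]) (auto simp: carrier_Ve)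
  then show "v \<triangleleft>\<^bsub>V\<^esub> x = \<zero>\<^bsub>V\<^esub>"
    using v xA by (simp add: V_\<theta> Ve_V)
qed

lemma \<tau>_J: "\<tau> \<in> J"
proof -
  have "e \<noteq> a \<otimes> \<theta> \<otimes> b" if "a \<in> carrier G" "b \<in> carrier G" for a b
    using that e_not_\<theta> by (simp add: \<theta>_zero)
  then have "\<theta> \<in> ideal_avoiding G e"
    by (auto simp: ideal_avoiding_def)
  then show ?thesis
    by (rule lin_span_single)
qed

lemma tensor_\<tau>:
  assumes v: "v \<in> carrier Ve"
  shows "(v \<otimes>\<otimes> cls \<epsilon>) \<triangleleft>\<^bsub>P\<^esub> \<tau> = \<zero>\<^bsub>P\<^esub>"
proof -
  have "\<epsilon> \<otimes>\<^bsub>A\<^esub> \<tau> = \<tau>"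
    by (simp add: single_mult \<theta>_zero)
  moreover have "cls \<tau> = cls \<zero>\<^bsub>A\<^esub>"
    using \<tau>_J J.a_subset by (intro cls_eqI) (auto simp: A.a_coset_add_zero)
  ultimately have "cls \<epsilon> \<triangleleft>\<^bsub>L\<^esub> \<tau> = \<zero>\<^bsub>L\<^esub>"
    by (simp add: cls_ract cls_zero)
  then have "(v \<otimes>\<otimes> cls \<epsilon>) \<triangleleft>\<^bsub>P\<^esub> \<tau> = v \<otimes>\<otimes> \<zero>\<^bsub>L\<^esub>"
    using v by (simp add: P_eq)
  also have "\<dots> = \<zero>\<^bsub>P\<^esub>"
    using T.tensor_add_right[of v "\<zero>\<^bsub>L\<^esub>" "\<zero>\<^bsub>L\<^esub>"] v T.tensor_closed[of v "\<zero>\<^bsub>L\<^esub>"]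
    by (simp add: P_eq)
  finally show ?thesis .
qed

text \<open>A lift of \<open>f\<close> along \<open>g\<close> is determined by a \<open>KG\<^sub>e\<close>-linear lift \<open>h\<^sub>1\<close> of \<open>v \<mapsto> f(v \<otimes> e)\<close>, which averaging
  produces from the linear lift \<open>h\<^sub>0\<close>. Its values need not be killed by \<open>J\<close>, because \<open>X\<close> need not be
  killed by \<open>\<theta>\<close>; therefore \<open>h\<^sub>1\<close> is replaced by \<open>h\<^sub>1(v)(1 - \<theta>)\<close>. This is still a lift, since \<open>(v \<otimes> e)\<theta>\<close>
  is zero in the induced module.\<close>

lemma induced_lift_through_hom:
  fixes X :: "('x, 'g \<Rightarrow>\<^sub>0 'k) right_mod" and Y :: "('y, 'g \<Rightarrow>\<^sub>0 'k) right_mod"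
  assumes char: "of_nat (card (carrier H)) \<noteq> (0 :: 'k)"
    and X: "right_module A X" and Y: "right_module A Y"
    and g: "g \<in> right_module_hom A X Y" and f: "f \<in> right_module_hom A P Y"
    and h0: "\<And>v. v \<in> carrier Ve \<Longrightarrow> h0 v \<in> carrier (corner_module X e)"
    and h0_add: "\<And>v w. \<lbrakk>v \<in> carrier Ve; w \<in> carrier Ve\<rbrakk> \<Longrightarrow> h0 (v \<oplus>\<^bsub>V\<^esub> w) = h0 v \<oplus>\<^bsub>X\<^esub> h0 w"
    and h0_scale: "\<And>v c. v \<in> carrier Ve \<Longrightarrow>
      h0 (v \<triangleleft>\<^bsub>V\<^esub> Poly_Mapping.single e c) = h0 v \<triangleleft>\<^bsub>X\<^esub> Poly_Mapping.single e c"
    and h0_lift: "\<And>v. v \<in> carrier Ve \<Longrightarrow> g (h0 v) = f (v \<otimes>\<otimes> cls \<epsilon>)"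
  shows "\<exists>h \<in> right_module_hom A P X. \<forall>p\<in>carrier P. g (h p) = f p"
proof -
  interpret X: right_module A X by fact
  interpret Y: right_module A Y by fact
  note gD = right_module_homD[OF g] and fD = right_module_homD[OF f]
  note carX = carrier_corner_module[OF X] and carY = carrier_corner_module[OF Y]
  have v\<epsilon>: "v \<otimes>\<otimes> cls \<epsilon> \<in> carrier P" if "v \<in> carrier Ve" for v
    using that by (simp add: P_eq)
  have g': "g \<in> right_module_hom KH (corner_module X e) (corner_module Y e)"
  proof (rule right_module_homI)
    fix x assume "x \<in> carrier (corner_module X e)"
    then show "g x \<in> carrier (corner_module Y e)"
      using gD(1)[of x] gD(3)[of x \<epsilon>] by (simp add: carX carY)
  qed (auto simp: carX corner_module_simps gD KH_subset)
  have f': "(\<lambda>v. f (v \<otimes>\<otimes> cls \<epsilon>)) \<in> right_module_hom KH Ve (corner_module Y e)"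
  proof (rule right_module_homI)
    fix v assume v: "v \<in> carrier Ve"
    show "f (v \<otimes>\<otimes> cls \<epsilon>) \<in> carrier (corner_module Y e)"
      using fD(1)[OF v\<epsilon>[OF v]] fD(3)[OF v\<epsilon>[OF v] \<epsilon>_closed] tensor_cls[OF v \<epsilon>_closed \<epsilon>_idem]
      by (simp add: carY)
  next
    fix v w assume "v \<in> carrier Ve" "w \<in> carrier Ve"
    then show "f ((v \<oplus>\<^bsub>Ve\<^esub> w) \<otimes>\<otimes> cls \<epsilon>) = f (v \<otimes>\<otimes> cls \<epsilon>) \<oplus>\<^bsub>corner_module Y e\<^esub> f (w \<otimes>\<otimes> cls \<epsilon>)"
      using fD(2)[OF v\<epsilon> v\<epsilon>] T.tensor_add_left[of v w "cls \<epsilon>"] by (simp add: corner_module_simps P_eq)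
  next
    fix v s assume v: "v \<in> carrier Ve" and s: "s \<in> carrier KH"
    have "(v \<triangleleft>\<^bsub>Ve\<^esub> s) \<otimes>\<otimes> cls \<epsilon> = v \<otimes>\<otimes> cls s"
      using v s T.tensor_balanced[of v s "cls \<epsilon>"] by (simp add: cls_lact \<epsilon>_KH_mult)
    also have "\<dots> = (v \<otimes>\<otimes> cls \<epsilon>) \<triangleleft>\<^bsub>P\<^esub> s"
      using s by (intro tensor_cls v) (auto simp: KH_subset \<epsilon>_KH_mult)
    finally show "f ((v \<triangleleft>\<^bsub>Ve\<^esub> s) \<otimes>\<otimes> cls \<epsilon>) = f (v \<otimes>\<otimes> cls \<epsilon>) \<triangleleft>\<^bsub>corner_module Y e\<^esub> s"
      using fD(3)[OF v\<epsilon>[OF v] KH_subset[OF s]] by (simp add: corner_module_simps)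
  qed
  have h0_add': "h0 (v \<oplus>\<^bsub>Ve\<^esub> w) = h0 v \<oplus>\<^bsub>corner_module X e\<^esub> h0 w"
    if "v \<in> carrier Ve" "w \<in> carrier Ve" for v w
    using h0_add[OF that] by (simp add: corner_module_simps)
  have h0_scale': "h0 (v \<triangleleft>\<^bsub>Ve\<^esub> Poly_Mapping.single \<one>\<^bsub>H\<^esub> c) = h0 v \<triangleleft>\<^bsub>corner_module X e\<^esub> Poly_Mapping.single \<one>\<^bsub>H\<^esub> c"
    if "v \<in> carrier Ve" for v c
    using h0_scale[OF that] by (simp add: corner_module_simps one_H)
  obtain h1 where h1: "h1 \<in> right_module_hom KH Ve (corner_module X e)"
    and h1_lift: "\<And>v. v \<in> carrier Ve \<Longrightarrow> g (h1 v) = f (v \<otimes>\<otimes> cls \<epsilon>)"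
    using group_algebra_linear_lift_averaging[OF H.group_axioms finite_H char Ve.right_module_axioms
      right_module_corner[OF X] right_module_corner[OF Y] g' f' h0 h0_add' h0_scale' h0_lift] by blast
  note h1D = right_module_homD[OF h1]
  have h1X: "h1 v \<in> carrier X" "h1 v \<triangleleft>\<^bsub>X\<^esub> \<epsilon> = h1 v" if "v \<in> carrier Ve" for v
    using h1D(1)[OF that] by (simp_all add: carX)
  define h2 where "h2 v = h1 v \<ominus>\<^bsub>X\<^esub> h1 v \<triangleleft>\<^bsub>X\<^esub> \<tau>" for v
  have h2X: "h2 v \<in> carrier X" if "v \<in> carrier Ve" for v
    using h1X[OF that] by (simp add: h2_def X.ract_closed)
  have h2_add: "h2 (v \<oplus>\<^bsub>V\<^esub> w) = h2 v \<oplus>\<^bsub>X\<^esub> h2 w" if "v \<in> carrier Ve" "w \<in> carrier Ve" for v w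
    using h1D(2)[OF that] h1X[OF that(1)] h1X[OF that(2)]
    by (simp add: h2_def corner_module_simps X.ract_add_left X.ract_closed X.V.minus_eq X.V.minus_add X.V.a_ac)
  have h2_act: "h2 (v \<triangleleft>\<^bsub>V\<^esub> s) = h2 v \<triangleleft>\<^bsub>X\<^esub> s" if v: "v \<in> carrier Ve" and s: "s \<in> carrier KH" for v s
  proof -
    have "h1 v \<triangleleft>\<^bsub>X\<^esub> s \<triangleleft>\<^bsub>X\<^esub> \<tau> = h1 v \<triangleleft>\<^bsub>X\<^esub> \<tau> \<triangleleft>\<^bsub>X\<^esub> s"
      using h1X[OF v] KH_subset[OF s] \<tau>_central[of s] by (simp add: X.ract_mult[symmetric])
    then show ?thesis
      using h1D(3)[OF v s] h1X[OF v] KH_subset[OF s]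
      by (simp add: h2_def corner_module_simps X.V.minus_eq X.ract_add_left X.ract_closed X.neg_ract)
  qed
  have h2_kill: "h2 v \<triangleleft>\<^bsub>X\<^esub> x = \<zero>\<^bsub>X\<^esub>" if v: "v \<in> carrier Ve" and x: "x \<in> J" for v x
  proof -
    have "x \<in> carrier A"
      using x J_subset by auto
    then show ?thesis
      using h1X[OF v] reduced_killed[OF X h1X[OF v] x]
      by (simp add: h2_def X.V.minus_eq X.ract_add_left X.ract_closed X.neg_ract X.V.r_neg)
  qed
  let ?h = "induced_map X h2"
  have hom: "?h \<in> right_module_hom A P X"
    by (rule induced_map_hom[OF X h2X h2_add h2_act h2_kill])
  note hD = right_module_homD[OF hom]
  have "g (?h p) = f p" if "p \<in> carrier P" for p
    using that unfolding P_eq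
  proof (induction p rule: T.tensor_induct)
    case zero
    show ?case
      using right_module_hom_zero[OF P.right_module_axioms X hom] right_module_hom_zero[OF X Y g]
        right_module_hom_zero[OF P.right_module_axioms Y f]
      by (simp add: P_eq)
  next
    case (add p q)
    then show ?case
      using hD(1,2)[of p] hD(1)[of q] hD(2)[of p q] fD(2)[of p q] gD(2)[of "?h p" "?h q"]
      by (simp add: P_eq)
  next
    case (tensor v l)
    obtain x where x: "x \<in> carrier A" "\<epsilon> \<otimes>\<^bsub>A\<^esub> x = x" "l = cls x"
      using tensor(2) by (rule L_cases)
    note v = tensor(1)
    have "?h (v \<otimes>\<otimes> l) = h2 v \<triangleleft>\<^bsub>X\<^esub> x"
      unfolding x(3) using x cls_self[OF x(1)]
      by (intro induced_map_tensor[OF X h2X h2_add h2_act h2_kill v]) (auto simp: cls_L)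
    moreover have "g (h2 v) = f (v \<otimes>\<otimes> cls \<epsilon>)"
    proof -
      have g_add: "g (a \<ominus>\<^bsub>X\<^esub> b) \<oplus>\<^bsub>Y\<^esub> g b = g a" if "a \<in> carrier X" "b \<in> carrier X" for a b
        using that gD(2)[of "a \<ominus>\<^bsub>X\<^esub> b" b] by (simp add: X.V.minus_eq X.V.a_assoc X.V.l_neg)
      have "g (h1 v \<triangleleft>\<^bsub>X\<^esub> \<tau>) = f ((v \<otimes>\<otimes> cls \<epsilon>) \<triangleleft>\<^bsub>P\<^esub> \<tau>)"
        using h1X[OF v] v\<epsilon>[OF v] h1_lift[OF v] by (simp add: gD(3) fD(3))
      also have "\<dots> = \<zero>\<^bsub>Y\<^esub>"
        using tensor_\<tau>[OF v] right_module_hom_zero[OF P.right_module_axioms Y f] by simp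
      finally show ?thesis
        using g_add[of "h1 v" "h1 v \<triangleleft>\<^bsub>X\<^esub> \<tau>"] h1X[OF v] h1_lift[OF v] gD(1)[OF h2X[OF v]]
        by (simp add: h2_def X.ract_closed)
    qed
    ultimately have "g (?h (v \<otimes>\<otimes> l)) = f (v \<otimes>\<otimes> cls \<epsilon>) \<triangleleft>\<^bsub>Y\<^esub> x"
      using gD(3)[OF h2X[OF v] x(1)] by simp
    also have "\<dots> = f (v \<otimes>\<otimes> l)"
      unfolding x(3) using tensor_cls[OF v x(1,2)] fD(3)[OF v\<epsilon>[OF v] x(1)] by simp
    finally show ?case .
  qed
  then show ?thesis
    using hom by blast
qed

end


section \<open>The contracted module of a pointed transformation monoid\<close>

locale pointed_transformation_monoid =
  fixes M :: "('w::finite \<Rightarrow> 'w) set" and z :: 'w and K :: "'k::field itself"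
  assumes submonoid_M: "submonoid M full_transformation_monoid"
    and fixes_z: "m \<in> M \<Longrightarrow> m z = z"
begin

abbreviation G :: "('w \<Rightarrow> 'w) monoid" where "G \<equiv> transformation_monoid M"
abbreviation A :: "(('w \<Rightarrow> 'w) \<Rightarrow>\<^sub>0 'k) ring" where "A \<equiv> monoid_algebra G"
abbreviation U :: "('w \<Rightarrow>\<^sub>0 'k, ('w \<Rightarrow> 'w) \<Rightarrow>\<^sub>0 'k) right_mod" where "U \<equiv> transformation_module"
abbreviation N :: "('w \<Rightarrow>\<^sub>0 'k) set" where "N \<equiv> lin_span {z}"
abbreviation V :: "(('w \<Rightarrow>\<^sub>0 'k) set, ('w \<Rightarrow> 'w) \<Rightarrow>\<^sub>0 'k) right_mod" where "V \<equiv> contracted_module z"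
abbreviation point :: "'w \<Rightarrow> ('w \<Rightarrow>\<^sub>0 'k) set" where "point \<omega> \<equiv> N +>\<^bsub>U\<^esub> Poly_Mapping.single \<omega> 1"
abbreviation scalar :: "'k \<Rightarrow> ('w \<Rightarrow> 'w) \<Rightarrow>\<^sub>0 'k" where "scalar c \<equiv> Poly_Mapping.single id c"

sublocale G: monoid G
  by (rule monoid_transformation_monoid[OF submonoid_M])

sublocale A: ring A
  by (rule ring_monoid_algebra) (rule G.monoid_axioms)

sublocale U: right_module A U
  by (rule right_module_transformation_module[OF submonoid_M])

lemma id_M: "id \<in> M"
  using G.one_closed by (simp add: transformation_monoid_simps)

lemma single_A: "m \<in> M \<Longrightarrow> Poly_Mapping.single m c \<in> carrier A"
  by (simp add: monoid_algebra_simps transformation_monoid_simps lin_span_single)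

lemma scalar_A [simp]: "scalar c \<in> carrier A"
  by (simp add: single_A id_M)

lemma submodule_N: "right_submodule A N U"
proof (rule U.right_submoduleI)
  show "v \<triangleleft>\<^bsub>U\<^esub> a \<in> N" if "v \<in> N" "a \<in> carrier A" for v a
    using that unfolding transformation_module_simps monoid_algebra_simps transformation_monoid_simps
    by (rule bilinear_extension_closed) (simp add: fixes_z)
qed (auto simp: transformation_module_simps lin_span_add)

lemma V_eq: "V = quotient_module U N"
  by (simp add: contracted_module_def)

sublocale V: right_module A V
  unfolding V_eq by (rule U.quotient_module_right_module[OF submodule_N])

lemma carrier_V: "carrier V = (\<lambda>u. N +>\<^bsub>U\<^esub> u) ` UNIV"
  using U.quotient_module_right_module(2)[OF submodule_N] by (simp add: V_eq transformation_module_simps)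

lemma zero_V: "\<zero>\<^bsub>V\<^esub> = N"
  using U.quotient_module_right_module(3)[OF submodule_N] by (simp add: V_eq)

lemma add_V: "(N +>\<^bsub>U\<^esub> u) \<oplus>\<^bsub>V\<^esub> (N +>\<^bsub>U\<^esub> v) = N +>\<^bsub>U\<^esub> (u + v)"
  using U.quotient_module_right_module(4)[OF submodule_N, of u v]
  by (simp add: V_eq transformation_module_simps)

lemma act_V: "a \<in> carrier A \<Longrightarrow> (N +>\<^bsub>U\<^esub> u) \<triangleleft>\<^bsub>V\<^esub> a = N +>\<^bsub>U\<^esub> (u \<triangleleft>\<^bsub>U\<^esub> a)"
  using U.quotient_module_right_module(5)[OF submodule_N, of u a]
  by (simp add: V_eq transformation_module_simps)

lemma single_act: "Poly_Mapping.single \<omega> c \<triangleleft>\<^bsub>U\<^esub> Poly_Mapping.single m d = Poly_Mapping.single (m \<omega>) (c * d)"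
  by (simp add: transformation_module_simps)

lemma point_V [simp]: "point \<omega> \<in> carrier V"
  by (simp add: carrier_V)

lemma point_act: "m \<in> M \<Longrightarrow> point \<omega> \<triangleleft>\<^bsub>V\<^esub> Poly_Mapping.single m 1 = point (m \<omega>)"
  by (simp add: act_V single_A single_act)

lemma coset_N: "u \<in> N \<Longrightarrow> N +>\<^bsub>U\<^esub> u = \<zero>\<^bsub>V\<^esub>"
  using U.a_coset_join2[of u N] submodule_N
  by (simp add: zero_V transformation_module_simps right_submodule_def additive_subgroup_def)

lemma point_z: "point z = \<zero>\<^bsub>V\<^esub>"
  by (rule coset_N) (simp add: lin_span_single)

lemma V_induct [consumes 1, case_names zero point add]:
  assumes v: "v \<in> carrier V" and zero: "Q \<zero>\<^bsub>V\<^esub>" and point: "\<And>\<omega> c. Q (point \<omega> \<triangleleft>\<^bsub>V\<^esub> scalar c)"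
    and add: "\<And>v w. \<lbrakk>v \<in> carrier V; w \<in> carrier V; Q v; Q w\<rbrakk> \<Longrightarrow> Q (v \<oplus>\<^bsub>V\<^esub> w)"
  shows "Q v"
proof -
  obtain u where u: "v = N +>\<^bsub>U\<^esub> u"
    using v by (auto simp: carrier_V)
  have "u \<in> lin_span UNIV"
    by (simp add: lin_span_def)
  then have "Q (N +>\<^bsub>U\<^esub> u)"
  proof (induction u rule: lin_span_induct)
    case zero
    then show ?case
      using \<open>Q \<zero>\<^bsub>V\<^esub>\<close> by (simp add: coset_N)
  next
    case (single \<omega> c)
    then show ?case
      using point[of \<omega> c] by (simp add: act_V single_act)
  next
    case (add f g)
    then show ?case
      using assms(4)[of "N +>\<^bsub>U\<^esub> f" "N +>\<^bsub>U\<^esub> g"] by (simp add: add_V carrier_V)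
  qed
  then show ?thesis
    by (simp add: u)
qed

lemma linear_maps_eqI:
  fixes W :: "('x, ('w \<Rightarrow> 'w) \<Rightarrow>\<^sub>0 'k) right_mod"
  assumes W: "right_module A W"
    and p: "\<And>v. v \<in> carrier V \<Longrightarrow> p v \<in> carrier W"
      "\<And>v w. \<lbrakk>v \<in> carrier V; w \<in> carrier V\<rbrakk> \<Longrightarrow> p (v \<oplus>\<^bsub>V\<^esub> w) = p v \<oplus>\<^bsub>W\<^esub> p w"
      "\<And>v c. v \<in> carrier V \<Longrightarrow> p (v \<triangleleft>\<^bsub>V\<^esub> scalar c) = p v \<triangleleft>\<^bsub>W\<^esub> scalar c"
    and q: "\<And>v. v \<in> carrier V \<Longrightarrow> q v \<in> carrier W"
      "\<And>v w. \<lbrakk>v \<in> carrier V; w \<in> carrier V\<rbrakk> \<Longrightarrow> q (v \<oplus>\<^bsub>V\<^esub> w) = q v \<oplus>\<^bsub>W\<^esub> q w"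
      "\<And>v c. v \<in> carrier V \<Longrightarrow> q (v \<triangleleft>\<^bsub>V\<^esub> scalar c) = q v \<triangleleft>\<^bsub>W\<^esub> scalar c"
    and eq: "\<And>\<omega>. p (point \<omega>) = q (point \<omega>)" and v: "v \<in> carrier V"
  shows "p v = q v"
  using v
proof (induction v rule: V_induct)
  case zero
  interpret W: right_module A W by fact
  have "p \<zero>\<^bsub>V\<^esub> = \<zero>\<^bsub>W\<^esub>" "q \<zero>\<^bsub>V\<^esub> = \<zero>\<^bsub>W\<^esub>"
    using p(2)[of "\<zero>\<^bsub>V\<^esub>" "\<zero>\<^bsub>V\<^esub>"] p(1)[of "\<zero>\<^bsub>V\<^esub>"] q(2)[of "\<zero>\<^bsub>V\<^esub>" "\<zero>\<^bsub>V\<^esub>"] q(1)[of "\<zero>\<^bsub>V\<^esub>"] by simp_all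
  then show ?case by simp
qed (simp_all add: p(2,3) q(2,3) eq)

text \<open>The points \<open>\<omega> \<noteq> z\<close> form a basis of \<open>K\<^sub>0\<Omega>\<close>: a map on \<open>\<Omega>\<close> that sends \<open>z\<close> to \<open>0\<close> extends linearly. The
  scalar \<open>c\<close> acts on any module as \<open>c\<close> times the identity of the monoid.\<close>

lemma linear_extension:
  fixes W :: "('x, ('w \<Rightarrow> 'w) \<Rightarrow>\<^sub>0 'k) right_mod"
  assumes W: "right_module A W" and b: "\<And>\<omega>. b \<omega> \<in> carrier W" and bz: "b z = \<zero>\<^bsub>W\<^esub>"
  obtains p where "\<And>v. v \<in> carrier V \<Longrightarrow> p v \<in> carrier W"
    and "\<And>v w. \<lbrakk>v \<in> carrier V; w \<in> carrier V\<rbrakk> \<Longrightarrow> p (v \<oplus>\<^bsub>V\<^esub> w) = p v \<oplus>\<^bsub>W\<^esub> p w"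
    and "\<And>v c. v \<in> carrier V \<Longrightarrow> p (v \<triangleleft>\<^bsub>V\<^esub> scalar c) = p v \<triangleleft>\<^bsub>W\<^esub> scalar c"
    and "\<And>\<omega>. p (point \<omega>) = b \<omega>"
proof -
  interpret W: right_module A W by fact
  define lin where "lin u = (\<Oplus>\<^bsub>W\<^esub>\<omega>\<in>UNIV. b \<omega> \<triangleleft>\<^bsub>W\<^esub> scalar (poly_mapping.lookup u \<omega>))" for u
  have bs: "b \<omega> \<triangleleft>\<^bsub>W\<^esub> scalar c \<in> carrier W" for \<omega> c
    by (simp add: b W.ract_closed)
  have scalar_add: "scalar (c + d) = scalar c \<oplus>\<^bsub>A\<^esub> scalar d" for c d :: 'k
    by (simp add: add_monoid_algebra single_add)
  have scalar_mult: "scalar (c * d) = scalar c \<otimes>\<^bsub>A\<^esub> scalar d" for c d :: 'k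
    by (simp add: mult_monoid_algebra transformation_monoid_simps)
  have scalar_zero: "w \<triangleleft>\<^bsub>W\<^esub> 0 = \<zero>\<^bsub>W\<^esub>" if "w \<in> carrier W" for w
    using W.ract_zero[OF that] by (simp add: zero_monoid_algebra)
  have scalar_one: "w \<triangleleft>\<^bsub>W\<^esub> scalar 1 = w" if "w \<in> carrier W" for w
    using W.ract_one[OF that] by (simp add: one_monoid_algebra transformation_monoid_simps)
  have lin_closed: "lin u \<in> carrier W" for u
    unfolding lin_def using bs by (intro W.V.finsum_closed) auto
  have lin_add: "lin (u + v) = lin u \<oplus>\<^bsub>W\<^esub> lin v" for u v
    unfolding lin_def lookup_add scalar_add
    by (subst W.V.finsum_addf[symmetric]) (auto simp: bs b W.ract_add_right intro!: W.V.finsum_cong')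
  have lin_single: "lin (Poly_Mapping.single \<omega> c) = b \<omega> \<triangleleft>\<^bsub>W\<^esub> scalar c" for \<omega> c
  proof -
    have "lin (Poly_Mapping.single \<omega> c) =
        (\<Oplus>\<^bsub>W\<^esub>\<alpha>\<in>UNIV. if \<omega> = \<alpha> then b \<alpha> \<triangleleft>\<^bsub>W\<^esub> scalar c else \<zero>\<^bsub>W\<^esub>)"
      unfolding lin_def by (intro W.V.finsum_cong') (auto simp: lookup_single when_def b bs scalar_zero)
    also have "\<dots> = b \<omega> \<triangleleft>\<^bsub>W\<^esub> scalar c"
      by (rule W.V.finsum_singleton) (auto simp: bs)
    finally show ?thesis .
  qed
  have lin_N: "lin n = \<zero>\<^bsub>W\<^esub>" if "n \<in> N" for n
    using that
  proof (induction n rule: lin_span_induct)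
    case zero
    then show ?case
      using lin_add[of 0 0] lin_closed[of 0] by simp
  qed (auto simp: lin_single bz lin_add)
  define p where "p v = lin (SOME u. v = N +>\<^bsub>U\<^esub> u)" for v
  have p_coset: "p (N +>\<^bsub>U\<^esub> u) = lin u" for u
  proof -
    define u' where "u' = (SOME u'. N +>\<^bsub>U\<^esub> u = N +>\<^bsub>U\<^esub> u')"
    have "N +>\<^bsub>U\<^esub> u = N +>\<^bsub>U\<^esub> u'"
      unfolding u'_def by (rule someI[of _ u]) (rule refl)
    moreover have "u' \<in> N +>\<^bsub>U\<^esub> u'"
      by (auto simp: a_r_coset_def' transformation_module_simps intro!: bexI[of _ 0])
    ultimately have "u' \<in> N +>\<^bsub>U\<^esub> u"
      by simp
    then obtain n where "n \<in> N" "u' = n + u"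
      by (auto simp: a_r_coset_def' transformation_module_simps)
    then show ?thesis
      by (simp add: p_def u'_def[symmetric] lin_add lin_N lin_closed)
  qed
  have p_closed: "p v \<in> carrier W" if "v \<in> carrier V" for v
    using that by (auto simp: carrier_V p_coset lin_closed)
  have p_add: "p (v \<oplus>\<^bsub>V\<^esub> w) = p v \<oplus>\<^bsub>W\<^esub> p w" if "v \<in> carrier V" "w \<in> carrier V" for v w
    using that by (auto simp: carrier_V add_V p_coset lin_add)
  have p_point: "p (point \<omega>) = b \<omega>" for \<omega>
    by (simp add: p_coset lin_single scalar_one b)
  have "p (v \<triangleleft>\<^bsub>V\<^esub> scalar c) = p v \<triangleleft>\<^bsub>W\<^esub> scalar c" if "v \<in> carrier V" for v c
    using that
  proof (induction v rule: V_induct)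
    case zero
    have "p \<zero>\<^bsub>V\<^esub> = \<zero>\<^bsub>W\<^esub>"
      using p_coset[of 0] lin_N[of 0] by (simp add: coset_N)
    then show ?case
      by (simp only: V.zero_ract[OF scalar_A] W.zero_ract[OF scalar_A])
  next
    case (point \<omega> d)
    have p_scaled: "p (point \<omega> \<triangleleft>\<^bsub>V\<^esub> scalar e) = b \<omega> \<triangleleft>\<^bsub>W\<^esub> scalar e" for e
      by (simp add: act_V single_act p_coset lin_single)
    have "point \<omega> \<triangleleft>\<^bsub>V\<^esub> scalar d \<triangleleft>\<^bsub>V\<^esub> scalar c = point \<omega> \<triangleleft>\<^bsub>V\<^esub> scalar (d * c)"
      unfolding scalar_mult by (rule V.ract_mult[OF point_V scalar_A scalar_A, symmetric])
    moreover have "b \<omega> \<triangleleft>\<^bsub>W\<^esub> scalar d \<triangleleft>\<^bsub>W\<^esub> scalar c = b \<omega> \<triangleleft>\<^bsub>W\<^esub> scalar (d * c)"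
      unfolding scalar_mult by (rule W.ract_mult[OF b scalar_A scalar_A, symmetric])
    ultimately show ?case
      by (simp only: p_scaled)
  next
    case (add v w)
    then show ?case
      by (simp only: V.ract_add_left[OF _ _ scalar_A] V.ract_closed[OF _ scalar_A] p_add
          W.ract_add_left[OF _ _ scalar_A] p_closed)
  qed
  then show thesis
    using that p_closed p_add p_point by blast
qed

end

section \<open>The zero-minimal ideal of a zero-transitive monoid\<close>

lemma zero_transitiveD:
  assumes "zero_transitive M z"
  shows "m \<in> M \<Longrightarrow> m z = z" and "\<alpha> \<noteq> z \<Longrightarrow> \<exists>m\<in>M. m \<alpha> = \<omega>"
proof -
  show "m z = z" if "m \<in> M"
    using assms that unfolding zero_transitive_def by blast
  show "\<exists>m\<in>M. m \<alpha> = \<omega>" if "\<alpha> \<noteq> z"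
  proof -
    have "{m \<alpha> |m. m \<in> M} = UNIV"
      using assms that by (simp add: zero_transitive_def)
    then have "\<omega> \<in> {m \<alpha> |m. m \<in> M}"
      by simp
    then show ?thesis
      by blast
  qed
qed

text \<open>An element \<open>m\<close> of minimal rank is the zero map: \<open>z\<close> is in its range, and if the range contained
  another point \<open>\<alpha>\<close>, following \<open>m\<close> by a map that sends \<open>\<alpha>\<close> to \<open>z\<close> would identify \<open>\<alpha>\<close> with \<open>z\<close> and lower
  the rank.\<close>

lemma zero_map_mem:
  fixes M :: "('w::finite \<Rightarrow> 'w) set"
  assumes M: "submonoid M full_transformation_monoid" and zt: "zero_transitive M z"
  shows "(\<lambda>_. z) \<in> M"
proof -
  have id: "id \<in> M" and comp: "\<And>m n. \<lbrakk>m \<in> M; n \<in> M\<rbrakk> \<Longrightarrow> n \<circ> m \<in> M"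
    using M by (auto simp: submonoid_def full_transformation_monoid_def)
  note z = zero_transitiveD(1)[OF zt]
  obtain m where m: "m \<in> M" and min: "\<And>n. n \<in> M \<Longrightarrow> card (range m) \<le> card (range n)"
    using ex_has_least_nat[of "\<lambda>m. m \<in> M" id "\<lambda>m. card (range m)"] id by blast
  have zm: "z \<in> range m"
    using z[OF m] by (metis rangeI)
  have "\<alpha> = z" if "\<alpha> \<in> range m" for \<alpha>
  proof (rule ccontr)
    assume "\<alpha> \<noteq> z"
    then obtain n where n: "n \<in> M" "n \<alpha> = z"
      using zero_transitiveD(2)[OF zt] by blast
    have "range (n \<circ> m) = n ` (range m - {\<alpha>})"
    proof
      show "range (n \<circ> m) \<subseteq> n ` (range m - {\<alpha>})"
      proof
        fix \<omega> assume "\<omega> \<in> range (n \<circ> m)"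
        then obtain \<beta> where \<beta>: "\<beta> \<in> range m" "\<omega> = n \<beta>"
          by auto
        show "\<omega> \<in> n ` (range m - {\<alpha>})"
        proof (cases "\<beta> = \<alpha>")
          case True
          then show ?thesis
            using n z[OF n(1)] \<beta> zm \<open>\<alpha> \<noteq> z\<close> by (intro image_eqI[of _ _ z]) auto
        next
          case False
          then show ?thesis
            using \<beta> by blast
        qed
      qed
    qed auto
    then have "card (range (n \<circ> m)) \<le> card (range m - {\<alpha>})"
      by (simp add: card_image_le)
    also have "\<dots> < card (range m)"
      using that by (intro card_Diff1_less) auto
    finally show False
      using min[OF comp[OF m n(1)]] by simp
  qed
  then have "m = (\<lambda>_. z)"
    by auto
  then show ?thesis
    using m by simp
qed

text \<open>If \<open>em\<close> were not zero, it would generate the whole \<open>0\<close>-minimal ideal, and then \<open>e = a(em)b\<close> would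
  exhibit \<open>e\<close> as an element of \<open>MmM\<close>.\<close>

lemma zero_minimal_ideal_kills_avoiding:
  assumes G: "monoid G" and \<theta>: "\<theta> \<in> carrier G" and zero: "\<And>m. m \<in> carrier G \<Longrightarrow> \<theta> \<otimes>\<^bsub>G\<^esub> m = \<theta>"
    and min: "zero_minimal_ideal G \<theta> I" and e: "e \<in> I"
    and m: "m \<in> ideal_avoiding G e"
  shows "e \<otimes>\<^bsub>G\<^esub> m = \<theta>"
proof (rule ccontr)
  interpret monoid G by fact
  assume ne: "e \<otimes>\<^bsub>G\<^esub> m \<noteq> \<theta>"
  have I: "monoid_ideal G I" and Imin: "\<And>T. \<lbrakk>monoid_ideal G T; T \<noteq> {\<theta>}; T \<subseteq> I\<rbrakk> \<Longrightarrow> T = I"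
    using min by (auto simp: zero_minimal_ideal_def)
  have ec: "e \<in> carrier G" and mc: "m \<in> carrier G"
    using I e m by (auto simp: monoid_ideal_def ideal_avoiding_def)
  let ?T = "{a \<otimes>\<^bsub>G\<^esub> (e \<otimes>\<^bsub>G\<^esub> m) \<otimes>\<^bsub>G\<^esub> b |a b. a \<in> carrier G \<and> b \<in> carrier G}"
  have em: "e \<otimes>\<^bsub>G\<^esub> m \<in> ?T"
    using ec mc by (force intro: exI[of _ "\<one>\<^bsub>G\<^esub>"])
  have "monoid_ideal G ?T"
    unfolding monoid_ideal_def
  proof (intro conjI ballI)
    show "?T \<noteq> {}"
      using em by blast
    show "?T \<subseteq> carrier G"
      using ec mc by auto
    fix x n assume "x \<in> ?T" and n: "n \<in> carrier G"
    then obtain a b where ab: "a \<in> carrier G" "b \<in> carrier G" "x = a \<otimes>\<^bsub>G\<^esub> (e \<otimes>\<^bsub>G\<^esub> m) \<otimes>\<^bsub>G\<^esub> b"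
      by blast
    have "n \<otimes>\<^bsub>G\<^esub> x = (n \<otimes>\<^bsub>G\<^esub> a) \<otimes>\<^bsub>G\<^esub> (e \<otimes>\<^bsub>G\<^esub> m) \<otimes>\<^bsub>G\<^esub> b" "x \<otimes>\<^bsub>G\<^esub> n = a \<otimes>\<^bsub>G\<^esub> (e \<otimes>\<^bsub>G\<^esub> m) \<otimes>\<^bsub>G\<^esub> (b \<otimes>\<^bsub>G\<^esub> n)"
      using ab n ec mc by (simp_all add: m_assoc)
    then show "n \<otimes>\<^bsub>G\<^esub> x \<in> ?T" "x \<otimes>\<^bsub>G\<^esub> n \<in> ?T"
      using ab n by blast+
  qed
  moreover have "?T \<noteq> {\<theta>}"
    using em ne by auto
  moreover have "?T \<subseteq> I"
    using I e mc by (auto simp: monoid_ideal_def)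
  ultimately have "e \<in> ?T"
    using Imin e by blast
  then obtain a b where ab: "a \<in> carrier G" "b \<in> carrier G" "e = a \<otimes>\<^bsub>G\<^esub> (e \<otimes>\<^bsub>G\<^esub> m) \<otimes>\<^bsub>G\<^esub> b"
    by blast
  then have "e = (a \<otimes>\<^bsub>G\<^esub> e) \<otimes>\<^bsub>G\<^esub> m \<otimes>\<^bsub>G\<^esub> b"
    using ec mc by (simp add: m_assoc)
  moreover have "a \<otimes>\<^bsub>G\<^esub> e \<in> carrier G"
    using ab ec by simp
  ultimately show False
    using m ab(2) unfolding ideal_avoiding_def by blast
qed

section \<open>The projective cover of the contracted module\<close>

theorem theorem9p9:
  fixes M :: "('w::finite \<Rightarrow> 'w) set" and z :: 'w
    and I :: "('w \<Rightarrow> 'w) set" and e :: "'w \<Rightarrow> 'w"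
  assumes "submonoid M full_transformation_monoid"
    and "zero_transitive M z"
    and "zero_minimal_ideal (transformation_monoid M) (\<lambda>_. z) I"
    and "e \<in> I" and "e \<circ> e = e" and "e \<noteq> (\<lambda>_. z)"
  shows "let G = transformation_monoid M;
             KM = (monoid_algebra G :: (('w \<Rightarrow> 'w) \<Rightarrow>\<^sub>0 'k::field_char_0) ring);
             V = contracted_module z;
             Ve = corner_module V e;
             KGe = monoid_algebra (maximal_subgroup G e);
             L = induction_bimodule G e;
             P = induced_module G e Ve;
             \<phi> = induced_natural_map V
         in (\<forall>v\<in>carrier Ve. \<forall>a\<in>carrier L. \<forall>x\<in>a. \<phi> (tensor KGe Ve L v a) = v \<triangleleft>\<^bsub>V\<^esub> x) \<and>
            projective_cover TYPE('a) TYPE('b) KM P V \<phi> \<and>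
            (semisimple_ring KM \<longrightarrow> right_module_iso KM P V)"
proof -
  have reach: "\<And>\<alpha> \<omega>. \<alpha> \<noteq> z \<Longrightarrow> \<exists>m\<in>M. m \<alpha> = \<omega>" and fixz: "\<And>m. m \<in> M \<Longrightarrow> m z = z"
    using zero_transitiveD[OF assms(2)] by blast+
  interpret pointed_transformation_monoid M z "TYPE('k)"
    using assms(1) fixz by (rule pointed_transformation_monoid.intro)
  have \<theta>M: "(\<lambda>_. z) \<in> M"
    by (rule zero_map_mem[OF assms(1,2)])
  have eM: "e \<in> M"
    using assms(3,4) by (auto simp: zero_minimal_ideal_def monoid_ideal_def transformation_monoid_simps)
  have kill: "e \<otimes>\<^bsub>G\<^esub> m = (\<lambda>_. z)" if m: "m \<in> ideal_avoiding G e" for m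
  proof (rule zero_minimal_ideal_kills_avoiding[OF G.monoid_axioms _ _ assms(3,4) m])
    show "(\<lambda>_. z) \<in> carrier G"
      by (simp add: transformation_monoid_simps \<theta>M)
    show "(\<lambda>_. z) \<otimes>\<^bsub>G\<^esub> n = (\<lambda>_. z)" if "n \<in> carrier G" for n
      using that by (simp add: transformation_monoid_simps fixz fun_eq_iff)
  qed
  have V\<theta>: "v \<triangleleft>\<^bsub>V\<^esub> Poly_Mapping.single (\<lambda>_. z) 1 = \<zero>\<^bsub>V\<^esub>" if v: "v \<in> carrier V" for v
  proof -
    obtain u where u: "v = N +>\<^bsub>U\<^esub> u"
      using v by (auto simp: carrier_V)
    have "u \<triangleleft>\<^bsub>U\<^esub> Poly_Mapping.single (\<lambda>_. z) 1 \<in> N"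
      unfolding transformation_module_simps
      by (rule bilinear_extension_closed[of _ UNIV _ "{\<lambda>_. z}"]) (auto simp: lin_span_def)
    then show ?thesis
      by (simp add: u act_V single_A \<theta>M coset_N)
  qed
  interpret C: corner_induction_zero G e "TYPE('k)" V "\<lambda>_. z"
    using assms(5,6) eM \<theta>M kill V\<theta>
    by unfold_locales (simp_all add: transformation_monoid_simps fixz fun_eq_iff)

  have gen: "S = carrier V" if S: "right_submodule A S V" and sub: "carrier C.Ve \<subseteq> S" for S
  proof -
    note s = V.right_submoduleD[OF S]
    obtain \<alpha> where \<alpha>: "e \<alpha> \<noteq> z"
      using assms(6) by auto
    have "point (e \<alpha>) \<triangleleft>\<^bsub>V\<^esub> Poly_Mapping.single e 1 = point (e \<alpha>)"
      using assms(5) by (simp add: point_act eM fun_eq_iff)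
    then have "point (e \<alpha>) \<in> S"
      using sub by (auto simp: C.carrier_Ve)
    then have pS: "point \<omega> \<in> S" for \<omega>
      using reach[OF \<alpha>, of \<omega>] s(5)[OF _ single_A] point_act by metis
    have "v \<in> S" if "v \<in> carrier V" for v
      using that by (induction v rule: V_induct) (simp_all add: s pS)
    then show ?thesis
      using s(1) by blast
  qed
  have surj: "C.\<phi> ` carrier C.P = carrier V"
    by (rule C.natural_map_surj[OF gen])

  have "projective_module TYPE('a) TYPE('b) A C.P"
    unfolding projective_module_def
  proof (intro conjI allI impI)
    show "right_module A C.P"
      by (rule C.P.right_module_axioms)
    fix X :: "('a, ('w \<Rightarrow> 'w) \<Rightarrow>\<^sub>0 'k) right_mod" and Y :: "('b, ('w \<Rightarrow> 'w) \<Rightarrow>\<^sub>0 'k) right_mod" and g f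
    assume as: "right_module A X \<and> right_module A Y \<and> g \<in> right_module_hom A X Y \<and>
      g ` carrier X = carrier Y \<and> f \<in> right_module_hom A C.P Y"
    then have X: "right_module A X" and Y: "right_module A Y" and g: "g \<in> right_module_hom A X Y"
      and gsurj: "g ` carrier X = carrier Y" and f: "f \<in> right_module_hom A C.P Y"
      by auto
    interpret X: right_module A X by (rule X)
    interpret Y: right_module A Y by (rule Y)
    note gD = right_module_homD[OF g] and fD = right_module_homD[OF f]
    \<comment> \<open>The map to be lifted, extended from \<open>Ve\<close> to all of \<open>V\<close> by way of \<open>v \<mapsto> ve\<close>, so that the
      basis of \<open>V\<close> can be used.\<close>
    define q where "q v = f (C.tens (v \<triangleleft>\<^bsub>V\<^esub> C.\<epsilon>) (C.cls C.\<epsilon>))" for v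
    have v\<epsilon>: "v \<triangleleft>\<^bsub>V\<^esub> C.\<epsilon> \<in> carrier C.Ve" if "v \<in> carrier V" for v
      using that by (simp add: C.carrier_Ve V.ract_closed V.ract_mult[symmetric])
    have t\<epsilon>: "C.tens (v \<triangleleft>\<^bsub>V\<^esub> C.\<epsilon>) (C.cls C.\<epsilon>) \<in> carrier C.P" if "v \<in> carrier V" for v
      using v\<epsilon>[OF that] by (simp add: C.P_eq)
    have q_closed: "q v \<in> carrier Y" if "v \<in> carrier V" for v
      using fD(1)[OF t\<epsilon>[OF that]] by (simp add: q_def)
    have q_add: "q (v \<oplus>\<^bsub>V\<^esub> w) = q v \<oplus>\<^bsub>Y\<^esub> q w" if "v \<in> carrier V" "w \<in> carrier V" for v w
      using fD(2)[OF t\<epsilon>[OF that(1)] t\<epsilon>[OF that(2)]] C.T.tensor_add_left[OF v\<epsilon>[OF that(1)] v\<epsilon>[OF that(2)] C.cls_\<epsilon>_L] that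
      by (simp add: q_def C.P_eq V.ract_add_left C.corner_module_simps)
    have q_scale: "q (v \<triangleleft>\<^bsub>V\<^esub> scalar c) = q v \<triangleleft>\<^bsub>Y\<^esub> scalar c" if v: "v \<in> carrier V" for v c
    proof -
      let ?s = "Poly_Mapping.single e c :: ('w \<Rightarrow> 'w) \<Rightarrow>\<^sub>0 'k"
      have s: "?s \<in> carrier C.KH"
        using C.H.one_closed by (simp add: C.one_H monoid_algebra_simps lin_span_single)
      have "v \<triangleleft>\<^bsub>V\<^esub> scalar c \<triangleleft>\<^bsub>V\<^esub> C.\<epsilon> = v \<triangleleft>\<^bsub>V\<^esub> C.\<epsilon> \<triangleleft>\<^bsub>C.Ve\<^esub> ?s"
        using v assms(5) s by (simp add: C.corner_module_simps V.ract_mult[symmetric] C.KH_subset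
            mult_monoid_algebra transformation_monoid_simps)
      then have "C.tens (v \<triangleleft>\<^bsub>V\<^esub> scalar c \<triangleleft>\<^bsub>V\<^esub> C.\<epsilon>) (C.cls C.\<epsilon>) =
          C.tens (v \<triangleleft>\<^bsub>V\<^esub> C.\<epsilon>) (C.cls ?s)"
        using C.T.tensor_balanced[OF v\<epsilon>[OF v] s C.cls_\<epsilon>_L] s by (simp add: C.cls_lact C.\<epsilon>_KH_mult)
      also have "C.cls ?s = C.cls C.\<epsilon> \<triangleleft>\<^bsub>C.L\<^esub> scalar c"
        by (simp add: C.cls_ract mult_monoid_algebra transformation_monoid_simps)
      also have "C.tens (v \<triangleleft>\<^bsub>V\<^esub> C.\<epsilon>) (C.cls C.\<epsilon> \<triangleleft>\<^bsub>C.L\<^esub> scalar c) =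
          C.tens (v \<triangleleft>\<^bsub>V\<^esub> C.\<epsilon>) (C.cls C.\<epsilon>) \<triangleleft>\<^bsub>C.P\<^esub> scalar c"
        unfolding C.P_eq by (rule C.T.tensor_ract[OF v\<epsilon>[OF v] C.cls_\<epsilon>_L scalar_A, symmetric])
      finally show ?thesis
        unfolding q_def by (simp only: fD(3)[OF t\<epsilon>[OF v] scalar_A])
    qed
    \<comment> \<open>A preimage for each basis vector; the value \<open>0\<close> at \<open>z\<close> is forced by \<open>point z = 0\<close>.\<close>
    define b where "b \<omega> = (if \<omega> = z then \<zero>\<^bsub>X\<^esub> else SOME x. x \<in> carrier X \<and> g x = q (point \<omega>))" for \<omega>
    have b: "b \<omega> \<in> carrier X \<and> g (b \<omega>) = q (point \<omega>)" for \<omega>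
    proof (cases "\<omega> = z")
      case True
      have "q \<zero>\<^bsub>V\<^esub> = \<zero>\<^bsub>Y\<^esub>"
        using q_add[of "\<zero>\<^bsub>V\<^esub>" "\<zero>\<^bsub>V\<^esub>"] q_closed[of "\<zero>\<^bsub>V\<^esub>"] by simp
      then show ?thesis
        using True right_module_hom_zero[OF X Y g] by (simp add: b_def point_z)
    next
      case False
      have "\<exists>x. x \<in> carrier X \<and> g x = q (point \<omega>)"
        using gsurj q_closed[of "point \<omega>"] by (metis imageE point_V)
      then show ?thesis
        using False by (simp add: b_def) (rule someI_ex)
    qed
    have bz: "b z = \<zero>\<^bsub>X\<^esub>"
      by (simp add: b_def)
    obtain p where p: "\<And>v. v \<in> carrier V \<Longrightarrow> p v \<in> carrier X"
      "\<And>v w. \<lbrakk>v \<in> carrier V; w \<in> carrier V\<rbrakk> \<Longrightarrow> p (v \<oplus>\<^bsub>V\<^esub> w) = p v \<oplus>\<^bsub>X\<^esub> p w"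
      "\<And>v c. v \<in> carrier V \<Longrightarrow> p (v \<triangleleft>\<^bsub>V\<^esub> scalar c) = p v \<triangleleft>\<^bsub>X\<^esub> scalar c"
      "\<And>\<omega>. p (point \<omega>) = b \<omega>"
      by (rule linear_extension[where b = b, OF X conjunct1[OF b] bz]) (rule that)
    have gp: "g (p v) = q v" if "v \<in> carrier V" for v
    proof (rule linear_maps_eqI[OF Y _ _ _ q_closed q_add q_scale _ that, of "\<lambda>v. g (p v)"])
      show "g (p (point \<omega>)) = q (point \<omega>)" for \<omega>
        unfolding p(4) using b by simp
      show "g (p v) \<in> carrier Y" if "v \<in> carrier V" for v
        by (rule gD(1)[OF p(1)[OF that]])
      show "g (p (v \<oplus>\<^bsub>V\<^esub> w)) = g (p v) \<oplus>\<^bsub>Y\<^esub> g (p w)" if "v \<in> carrier V" "w \<in> carrier V" for v w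
        unfolding p(2)[OF that] by (rule gD(2)[OF p(1)[OF that(1)] p(1)[OF that(2)]])
      show "g (p (v \<triangleleft>\<^bsub>V\<^esub> scalar c)) = g (p v) \<triangleleft>\<^bsub>Y\<^esub> scalar c" if "v \<in> carrier V" for v c
        unfolding p(3)[OF that] by (rule gD(3)[OF p(1)[OF that] scalar_A])
    qed
    \<comment> \<open>Multiplying by \<open>e\<close> moves the values into the corner \<open>Xe\<close>, as averaging over \<open>G\<^sub>e\<close> requires.\<close>
    define h0 where "h0 v = p v \<triangleleft>\<^bsub>X\<^esub> C.\<epsilon>" for v
    show "\<exists>h\<in>right_module_hom A C.P X. \<forall>x\<in>carrier C.P. g (h x) = f x"
    proof (rule C.induced_lift_through_hom[OF _ X Y g f, of h0])
      show "of_nat (card (carrier C.H)) \<noteq> (0 :: 'k)"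
        using C.finite_H C.H.one_closed by auto
      fix v assume "v \<in> carrier C.Ve"
      then have v: "v \<in> carrier V" and ve: "v \<triangleleft>\<^bsub>V\<^esub> C.\<epsilon> = v"
        by (auto simp: C.carrier_Ve)
      show "h0 v \<in> carrier (corner_module X e)"
        using p(1)[OF v] by (simp add: h0_def C.carrier_corner_module[OF X] X.ract_closed X.ract_mult[symmetric])
      show "h0 (v \<oplus>\<^bsub>V\<^esub> w) = h0 v \<oplus>\<^bsub>X\<^esub> h0 w" if "w \<in> carrier C.Ve" for w
        using that v by (simp add: h0_def C.carrier_Ve p X.ract_add_left)
      show "h0 (v \<triangleleft>\<^bsub>V\<^esub> Poly_Mapping.single e c) = h0 v \<triangleleft>\<^bsub>X\<^esub> Poly_Mapping.single e c" for c
      proof -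
        have ec: "Poly_Mapping.single e c \<in> carrier A"
          by (simp add: single_A eM)
        have eq: "C.\<epsilon> \<otimes>\<^bsub>A\<^esub> scalar c = Poly_Mapping.single e c" "scalar c \<otimes>\<^bsub>A\<^esub> C.\<epsilon> = Poly_Mapping.single e c"
          "C.\<epsilon> \<otimes>\<^bsub>A\<^esub> Poly_Mapping.single e c = Poly_Mapping.single e c"
          using assms(5) by (simp_all add: mult_monoid_algebra transformation_monoid_simps)
        have "v \<triangleleft>\<^bsub>V\<^esub> Poly_Mapping.single e c = v \<triangleleft>\<^bsub>V\<^esub> C.\<epsilon> \<triangleleft>\<^bsub>V\<^esub> scalar c"
          using v by (simp add: V.ract_mult[symmetric] eq)
        then show ?thesis
          using v ve p(1)[OF v] ec by (simp add: h0_def p X.ract_mult[symmetric] eq)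
      qed
      show "g (h0 v) = f (C.tens v (C.cls C.\<epsilon>))"
      proof -
        have "g (h0 v) = q v \<triangleleft>\<^bsub>Y\<^esub> C.\<epsilon>"
          using p(1)[OF v] v by (simp add: h0_def gD gp)
        also have "\<dots> = f (C.tens v (C.cls C.\<epsilon>) \<triangleleft>\<^bsub>C.P\<^esub> C.\<epsilon>)"
          using t\<epsilon>[OF v] by (simp add: q_def ve fD)
        also have "C.tens v (C.cls C.\<epsilon>) \<triangleleft>\<^bsub>C.P\<^esub> C.\<epsilon> = C.tens v (C.cls C.\<epsilon>)"
          using C.tensor_cls[of v C.\<epsilon>] \<open>v \<in> carrier C.Ve\<close> by simp
        finally show ?thesis .
      qed
    qed
  qed
  then have "projective_cover TYPE('a) TYPE('b) A C.P V C.\<phi>"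
    unfolding projective_cover_def
    using V.right_module_axioms C.natural_map_hom surj C.kernel_subset_radical by blast
  moreover have "right_module_iso A C.P V" if "semisimple_ring A"
    by (rule right_module_iso_if_trivial_kernel[OF C.P.right_module_axioms V.right_module_axioms
          C.natural_map_hom surj C.kernel_trivial_if_semisimple[OF that]])
  ultimately show ?thesis
    unfolding Let_def using C.natural_map_tensor by blast
qed

end
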